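(* Let $S$ be a non-empty subset of $\{3, 4, \ldots, \infty\}$. Then any isometric action of the (abstract) group $\mathrm{Homeo}(D_S)$ on any metric space has a bounded orbit. In particular, the group $\mathrm{Homeo}(D_S)$ has property (FH).
   Context: A dendrite is a locally connected, connected, compact metrisable space containing no simple closed curve. The order of a point $x$ of a dendrite $X$ is the cardinality of the set of connected components of $X\setminus\{x\}$ (the symbol $\infty$ stands for the cardinal $\aleph_0$); branch points are points of order at least three. For non-empty $S\subseteq\{3,4,\ldots,\infty\}$, the generalised Wa\.zewski dendrite $D_S$ is the dendrite, not reduced to a point and unique up to homeomorphism, such that all branch points have order in $S$ and, for every $n\in S$, every arc (not reduced to a point) contains a point of order $n$. $\mathrm{Homeo}(D_S)$ is its group of homeomorphisms, regarded here without topology. A group has property (FH) if each of its actions by (affine) isometries on a Hilbert space has a fixed point. *)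

theory Defs
  imports
    "HOL-Analysis.Analysis"
    "HOL-Algebra.Group_Action"
    "HOL-Library.Extended_Nat"
    "HOL-Library.Equipollence"
begin

definition simple_closed_curve_in :: "'a topology \<Rightarrow> 'a set \<Rightarrow> bool" where
  "simple_closed_curve_in X C \<longleftrightarrow>
     C \<subseteq> topspace X \<and> subtopology X C homeomorphic_space top_of_set (sphere (0::complex) 1)"

definition dendrite :: "'a topology \<Rightarrow> bool" where
  "dendrite X \<longleftrightarrow>
     locally_connected_space X \<and> connected_space X \<and> compact_space X \<and> metrizable_space X \<and>
     (\<nexists>C. simple_closed_curve_in X C)"

definition arc_in :: "'a topology \<Rightarrow> 'a set \<Rightarrow> bool" where
  "arc_in X A \<longleftrightarrow>
     A \<subseteq> topspace X \<and> subtopology X A homeomorphic_space top_of_set {0..1::real}"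

abbreviation point_complement_components :: "'a topology \<Rightarrow> 'a \<Rightarrow> 'a set set" where
  "point_complement_components X x \<equiv>
     connected_components_of (subtopology X (topspace X - {x}))"

text \<open>
  The set of all natural numbers \<open>i\<close> with \<open>enat i < n\<close> has \<open>n\<close> elements if \<open>n\<close> is finite, and is
  countably infinite if \<open>n = \<infinity>\<close>; so \<open>\<infinity>\<close> stands for the first infinite cardinal.
\<close>

definition has_order :: "'a topology \<Rightarrow> 'a \<Rightarrow> enat \<Rightarrow> bool" where
  "has_order X x n \<longleftrightarrow>
     x \<in> topspace X \<and> point_complement_components X x \<approx> {i. enat i < n}"

definition branch_point :: "'a topology \<Rightarrow> 'a \<Rightarrow> bool" where
  "branch_point X x \<longleftrightarrow>
     x \<in> topspace X \<and> {..<3::nat} \<lesssim> point_complement_components X x"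

text \<open>
  The defining properties of \<open>D\<^sub>S\<close>, which determine it up to homeomorphism. The second conjunct
  excludes a one-point space, and also the empty space, which \<^const>\<open>connected_space\<close> admits.
\<close>

definition wazewski_dendrite :: "enat set \<Rightarrow> 'a topology \<Rightarrow> bool" where
  "wazewski_dendrite S X \<longleftrightarrow>
     dendrite X \<and>
     (\<nexists>a. topspace X \<subseteq> {a}) \<and>
     (\<forall>x. branch_point X x \<longrightarrow> (\<exists>n\<in>S. has_order X x n)) \<and>
     (\<forall>n\<in>S. \<forall>A. arc_in X A \<longrightarrow> (\<exists>x\<in>A. has_order X x n))"

text \<open>
  As in \<^const>\<open>BijGroup\<close>, the elements are extensional functions, so that each self-homeomorphism
  of \<open>X\<close> is represented exactly once.
\<close>

definition Homeo :: "'a topology \<Rightarrow> ('a \<Rightarrow> 'a) monoid" where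
  "Homeo X =
     (BijGroup (topspace X))\<lparr>carrier := {f \<in> Bij (topspace X). homeomorphic_map X X f}\<rparr>"

lemma subgroup_homeomorphisms:
  "subgroup {f \<in> Bij (topspace X). homeomorphic_map X X f} (BijGroup (topspace X))"
proof -
  interpret B: group "BijGroup (topspace X)" by (rule group_BijGroup)
  let ?H = "{f \<in> Bij (topspace X). homeomorphic_map X X f}"
  show ?thesis
  proof (rule B.subgroupI)
    show "?H \<subseteq> carrier (BijGroup (topspace X))"
      by (auto simp: BijGroup_def)
    have "homeomorphic_map X X (\<lambda>x\<in>topspace X. x)"
      by (rule homeomorphic_map_eq[of X X id]) auto
    then show "?H \<noteq> {}"
      using id_Bij[of "topspace X"] by blast
  next
    fix f assume "f \<in> ?H"
    then have f: "f \<in> Bij (topspace X)" and hf: "homeomorphic_map X X f" by auto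
    obtain g where g: "homeomorphic_maps X X f g"
      using hf homeomorphic_map_maps by blast
    have hg: "homeomorphic_map X X g"
      using g homeomorphic_maps_map by blast
    have "homeomorphic_map X X (restrict (inv_into (topspace X) f) (topspace X))"
    proof (rule homeomorphic_map_eq[OF hg])
      fix x assume x: "x \<in> topspace X"
      have "f (g x) = x" and "g x \<in> topspace X"
        using g x hg homeomorphic_imp_surjective_map by (fastforce simp: homeomorphic_maps_def)+
      moreover have "inj_on f (topspace X)"
        using f by (auto simp: Bij_def bij_betw_def)
      ultimately show "g x = restrict (inv_into (topspace X) f) (topspace X) x"
        using x by (metis inv_into_f_f restrict_apply')
    qed
    then show "inv\<^bsub>BijGroup (topspace X)\<^esub> f \<in> ?H"
      using f by (simp add: inv_BijGroup restrict_inv_into_Bij)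
  next
    fix f g assume "f \<in> ?H" "g \<in> ?H"
    then have f: "f \<in> Bij (topspace X)" "homeomorphic_map X X f"
      and g: "g \<in> Bij (topspace X)" "homeomorphic_map X X g" by auto
    have "homeomorphic_map X X (compose (topspace X) f g)"
      by (rule homeomorphic_map_eq[OF homeomorphic_map_compose[OF g(2) f(2)]])
        (simp add: compose_def)
    then show "f \<otimes>\<^bsub>BijGroup (topspace X)\<^esub> g \<in> ?H"
      using f g by (simp add: BijGroup_def compose_Bij)
  qed
qed

lemma group_Homeo: "group (Homeo X)"
  unfolding Homeo_def
  by (rule subgroup.subgroup_is_group[OF subgroup_homeomorphisms group_BijGroup])

definition isometric_action ::
  "('g, 'c) monoid_scheme \<Rightarrow> 'm set \<Rightarrow> ('m \<Rightarrow> 'm \<Rightarrow> real) \<Rightarrow> ('g \<Rightarrow> 'm \<Rightarrow> 'm) \<Rightarrow> bool" where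
  "isometric_action G M d \<phi> \<longleftrightarrow>
     group_action G M \<phi> \<and>
     (\<forall>g\<in>carrier G. \<forall>x\<in>M. \<forall>y\<in>M. d (\<phi> g x) (\<phi> g y) = d x y)"

text \<open>
  Property (FH) for actions on the Hilbert space \<open>'h\<close>; the full property is obtained by letting the
  type \<open>'h\<close> range over all Hilbert spaces. Affineness is not imposed: bijective isometries
  of real normed spaces are affine (Mazur--Ulam), and complex Hilbert spaces are covered through
  their underlying real ones.
\<close>

definition property_FH ::
  "'h::{real_inner, complete_space} itself \<Rightarrow> ('g, 'c) monoid_scheme \<Rightarrow> bool" where
  "property_FH _ G \<longleftrightarrow>
     (\<forall>\<phi>. isometric_action G (UNIV :: 'h set) dist \<phi> \<longrightarrow>
       (\<exists>x. \<forall>g\<in>carrier G. \<phi> g x = x))"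

end

theory Submission
  imports Defs "HOL-Probability.Discrete_Topology"
begin

text \<open>
  Interior points of arcs in a dendrite separate their endpoints, so the branch points of \<open>D\<^sub>S\<close> form a
  countable set with a betweenness relation in which every interval contains branch points of every
  order in \<open>S\<close>. A back-and-forth argument makes this structure homogeneous for chains of points, and an
  automorphism of it extends to a homeomorphism by compactness.

  Let \<open>L g = d x (g x)\<close> be the displacement of a base point. If it were unbounded on the homeomorphisms
  supported off a half-tree, one could choose \<open>g\<^sub>n\<close> there with very large \<open>L g\<^sub>n\<close> and encode all of
  them in one homeomorphism, from which each is recovered as a commutator of controlled length. So \<open>L\<close> is
  bounded on such homeomorphisms. Finally, given five disjoint half-trees, every homeomorphism moves one of
  the first three off one of the last two, and is therefore a product of two homeomorphisms each supported
  off one of the five. For Hilbert spaces a bounded orbit has a circumcentre, which is fixed.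
\<close>

subsection \<open>Arcs in locally connected continua\<close>

text \<open>The action is not assumed continuous for any topology on the group, so no compactness or
  category argument on the group is available: of the action only subadditivity and symmetry of
  \<open>L\<close> survive. Boundedness has to be forced algebraically, by writing elements as words
  whose length does not depend on them. Infinite products must be homeomorphisms for this, hence
  supports are kept disjoint and shrinking to a point, where alone continuity is in doubt. This also
  explains why half-trees are nested: a given one needs infinitely many shrinking translates under a
  homeomorphism living on a larger one, and the larger one needs such translates in turn, one for
  each element to be encoded. Homogeneity is used for four collinear points only, but the
  back-and-forth must leave the chain: the place where a new branch point attaches can itself be a
  new branch point of prescribed order.\<close>

lemma connected_imp_epsilon_chain:
  fixes C :: "'a::metric_space set"
  assumes "connected C" "x \<in> C" "y \<in> C" "0 < e"
  obtains n :: nat and p where "p 0 = x" "p n = y" "\<And>i. p i \<in> C" "\<And>i. dist (p i) (p (Suc i)) < e"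
    "\<And>i. n \<le> i \<Longrightarrow> p i = y"
proof -
  define R where "R = {(u,v). u \<in> C \<and> v \<in> C \<and> dist u v < e}"
  have "sym R" by (auto simp: R_def sym_def dist_commute)
  have "(x,y) \<in> R\<^sup>*"
  proof (rule connected_equivalence_relation[OF assms(1-3), where R="\<lambda>u v. (u,v) \<in> R\<^sup>*"])
    fix a assume a: "a \<in> C"
    show "\<exists>T. openin (top_of_set C) T \<and> a \<in> T \<and> (\<forall>x\<in>T. (a, x) \<in> R\<^sup>*)"
      using a \<open>0 < e\<close> by (intro exI[of _ "C \<inter> ball a e"]) (auto simp: R_def openin_open_Int)
  qed (use \<open>sym R\<close> in \<open>auto dest: sym_rtrancl symD\<close>)
  then obtain n where "(x,y) \<in> R ^^ n" using rtrancl_imp_relpow by blast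
  then obtain f where f: "f 0 = x" "f n = y" "\<And>i. i < n \<Longrightarrow> (f i, f (Suc i)) \<in> R"
    unfolding relpow_fun_conv by blast
  show thesis
  \<comment> \<open>Freezing the chain at \<open>y\<close> after \<open>n\<close> steps allows
    chains of different lengths to be padded to a common length later.\<close>
  proof (rule that[of "\<lambda>i. f (min i n)" n])
    show "f (min i n) \<in> C" for i
      using f \<open>y \<in> C\<close> by (cases "i < n") (auto simp: R_def)
    show "dist (f (min i n)) (f (min (Suc i) n)) < e" for i
      using f(3)[of i] \<open>0 < e\<close> by (cases "i < n") (auto simp: R_def)
  qed (use f in auto)
qed

text \<open>Cover \<open>K\<close> by open sets cutting out small connected pieces; a Lebesgue
  number of the cover serves as \<open>d\<close>. A piece within \<open>e/2\<close> of its centre is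
  within \<open>e\<close> of each of its points.\<close>

lemma compact_locally_connected_uniform:
  fixes K :: "'a::metric_space set"
  assumes "compact K" "locally connected K" "0 < e"
  obtains d where "0 < d" "\<And>x y. x \<in> K \<Longrightarrow> y \<in> K \<Longrightarrow> dist x y < d \<Longrightarrow>
     \<exists>C. connected C \<and> C \<subseteq> K \<and> C \<subseteq> ball x e \<and> x \<in> C \<and> y \<in> C"
proof -
  have "\<exists>V. open V \<and> x \<in> V \<and> connected (K \<inter> V) \<and> K \<inter> V \<subseteq> ball x (e/2)" if "x \<in> K" for x
  proof -
    have "openin (top_of_set K) (K \<inter> ball x (e/2))" by auto
    moreover have "x \<in> K \<inter> ball x (e/2)" using that \<open>0 < e\<close> by auto
    ultimately obtain U where U: "openin (top_of_set K) U" "connected U" "x \<in> U"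
      "U \<subseteq> K \<inter> ball x (e/2)"
      using assms(2) unfolding locally_connected by meson
    then obtain V where "open V" "U = K \<inter> V" by (auto simp: openin_open)
    then show ?thesis using U by blast
  qed
  then obtain V where V: "\<And>x. x \<in> K \<Longrightarrow> open (V x)" "\<And>x. x \<in> K \<Longrightarrow> x \<in> V x"
    "\<And>x. x \<in> K \<Longrightarrow> connected (K \<inter> V x)" "\<And>x. x \<in> K \<Longrightarrow> K \<inter> V x \<subseteq> ball x (e/2)"
    by metis
  show thesis
  proof (cases "K = {}")
    case True
    then show ?thesis by (intro that[of 1]) auto
  next
    case False
    obtain d where d: "0 < d" "\<And>T. T \<subseteq> K \<Longrightarrow> diameter T < d \<Longrightarrow> \<exists>B\<in>V ` K. T \<subseteq> B"
      by (rule Lebesgue_number_lemma[of K "V ` K"]) (use assms V False in auto)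
    show ?thesis
    proof (rule that[OF \<open>0 < d\<close>])
      fix x y assume xy: "x \<in> K" "y \<in> K" "dist x y < d"
      then have "diameter {x,y} < d"
        unfolding diameter_def using \<open>0 < d\<close> by (auto simp: cSup_eq_Max dist_commute xy)
      then obtain z where z: "z \<in> K" "x \<in> V z" "y \<in> V z" using d(2)[of "{x,y}"] xy by auto
      have "K \<inter> V z \<subseteq> ball x e"
      proof
        fix w assume w: "w \<in> K \<inter> V z"
        then have "dist z w < e/2" "dist z x < e/2" using V(4)[OF z(1)] xy z by auto
        then show "w \<in> ball x e" using dist_triangle_half_r[of z w e x] by (auto simp: dist_commute)
      qed
      then show "\<exists>C. connected C \<and> C \<subseteq> K \<and> C \<subseteq> ball x e \<and> x \<in> C \<and> y \<in> C"
        using V(3)[OF z(1)] z xy by blast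
    qed
  qed
qed

text \<open>Start from the single link \<open>x\<close>, \<open>y\<close> and refine: a link of
  level \<open>k\<close> lies in a connected set of radius \<open>E k\<close>, which contains a
  chain with links shorter than \<open>D (Suc k)\<close>. Completeness yields a limit path, and
  \<open>K\<close> is closed.\<close>

lemma close_points_path:
  fixes K :: "'a::complete_space set"
  assumes "compact K" "locally connected K" "0 < e"
  obtains d where "0 < d" "\<And>x y. x \<in> K \<Longrightarrow> y \<in> K \<Longrightarrow> dist x y < d \<Longrightarrow>
     \<exists>g. path g \<and> path_image g \<subseteq> K \<inter> cball x e \<and> pathstart g = x \<and> pathfinish g = y"
proof -
  \<comment> \<open>The \<open>E k\<close> sum to \<open>e\<close>, the total drift allowed from
    \<open>x\<close>.\<close>
  define E where "E = (\<lambda>k::nat. (e/2) * (1/2)^k)"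
  have Epos: "0 < E k" for k using \<open>0 < e\<close> by (simp add: E_def)
  have "\<exists>d. 0 < d \<and> d \<le> E k \<and> (\<forall>x\<in>K. \<forall>y\<in>K. dist x y < d \<longrightarrow>
     (\<exists>C. connected C \<and> C \<subseteq> K \<and> C \<subseteq> ball x (E k) \<and> x \<in> C \<and> y \<in> C))" for k
  proof -
    obtain d where "0 < d" "\<And>x y. x \<in> K \<Longrightarrow> y \<in> K \<Longrightarrow> dist x y < d \<Longrightarrow>
     \<exists>C. connected C \<and> C \<subseteq> K \<and> C \<subseteq> ball x (E k) \<and> x \<in> C \<and> y \<in> C"
      using compact_locally_connected_uniform[OF assms(1,2) Epos] by metis
    then show ?thesis using Epos[of k] by (intro exI[of _ "min d (E k)"]) auto
  qed
  then obtain D where D: "\<And>k. 0 < D k" "\<And>k. D k \<le> E k"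
    "\<And>k x y. x \<in> K \<Longrightarrow> y \<in> K \<Longrightarrow> dist x y < D k \<Longrightarrow>
     (\<exists>C. connected C \<and> C \<subseteq> K \<and> C \<subseteq> ball x (E k) \<and> x \<in> C \<and> y \<in> C)"
    by metis
  have refine: "\<exists>n p. p 0 = x \<and> p n = y \<and> (\<forall>i. p i \<in> K) \<and> (\<forall>i. dist x (p i) < E k) \<and>
     (\<forall>i\<ge>n. p i = y) \<and> (\<forall>i. dist (p i) (p (Suc i)) < D (Suc k))"
    if xy: "x \<in> K" "y \<in> K" "dist x y < D k" for x y k
  proof -
    obtain C where C: "connected C" "C \<subseteq> K" "C \<subseteq> ball x (E k)" "x \<in> C" "y \<in> C"
      using D(3)[OF xy] by blast
    obtain n :: nat and p where p: "p 0 = x" "p n = y" "\<And>i. p i \<in> C"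
      "\<And>i. dist (p i) (p (Suc i)) < D (Suc k)" "\<And>i. n \<le> i \<Longrightarrow> p i = y"
      using connected_imp_epsilon_chain[OF C(1,4,5) D(1)] by metis
    then show ?thesis using C by (intro exI[of _ n] exI[of _ p]) (auto simp: subset_iff)
  qed
  show thesis
  proof (rule that[OF D(1)[of 0]])
    fix x y assume xy: "x \<in> K" "y \<in> K" "dist x y < D 0"
    define good where "good = (\<lambda>k (M :: nat, p :: nat \<Rightarrow> 'a). 0 < M \<and> p 0 = x \<and> p M = y \<and>
      (\<forall>j. p j \<in> K) \<and> (\<forall>j. j < M \<longrightarrow> dist (p j) (p (Suc j)) < D k))"
    define step where "step = (\<lambda>k (M :: nat, p :: nat \<Rightarrow> 'a) (M' :: nat, p' :: nat \<Rightarrow> 'a). \<exists>N>0. M' =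
      M * N \<and> (\<forall>j<M. \<forall>i\<le>N. dist (p j) (p' (j*N+i)) < E k))"
    have "\<exists>F. \<forall>k. good k (F k) \<and> step k (F k) (F (Suc k)) \<and> (k = 0 \<longrightarrow> fst (F k) = 1)"
    proof -
      have "\<exists>F. \<forall>k. (good k (F k) \<and> (k = 0 \<longrightarrow> fst (F k) = 1)) \<and> step k (F k) (F (Suc k))"
      proof (rule dependent_nat_choice)
        show "\<exists>Mp. good 0 Mp \<and> (0 = 0 \<longrightarrow> fst Mp = 1)"
          using xy by (intro exI[of _ "(1, \<lambda>i. if i = 0 then x else y)"]) (auto simp: good_def)
      next
        fix Mp k assume "good k Mp \<and> (k = 0 \<longrightarrow> fst Mp = 1)"
        then obtain M p where Mp: "Mp = (M, p)" "0 < M" "p 0 = x" "p M = y" "\<And>j. p j \<in> K"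
           "\<And>j. j < M \<Longrightarrow> dist (p j) (p (Suc j)) < D k" by (cases Mp) (auto simp: good_def)
        have "\<forall>j. \<exists>n q. j < M \<longrightarrow> q 0 = p j \<and> q n = p (Suc j) \<and> (\<forall>i. q i \<in> K) \<and> (\<forall>i. dist (p j) (q i) < E k) \<and>
          (\<forall>i\<ge>n. q i = p (Suc j)) \<and> (\<forall>i. dist (q i) (q (Suc i)) < D (Suc k))"
          using refine[OF Mp(5) Mp(5) Mp(6)] by meson
        then obtain n q where q: "\<And>j. j < M \<Longrightarrow> q j 0 = p j" "\<And>j i. j < M \<Longrightarrow> q j i \<in> K"
          "\<And>j i. j < M \<Longrightarrow> dist (p j) (q j i) < E k" "\<And>j i. j < M \<Longrightarrow> n j \<le> i \<Longrightarrow> q j i = p (Suc j)"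
          "\<And>j i. j < M \<Longrightarrow> dist (q j i) (q j (Suc i)) < D (Suc k)"
          by metis
        \<comment> \<open>All links get the same number \<open>N\<close> of pieces, so that position
          \<open>j\<close> becomes position \<open>j * N\<close> and both stand for the same
          parameter in [0,1]. Shorter chains repeat their last point; \<open>Suc\<close> makes
          \<open>N\<close> positive.\<close>
        define N where "N = Suc (Max (n ` {..<M}))"
        have nN: "n j \<le> N" if "j < M" for j
          unfolding N_def using that by (intro le_SucI Max_ge) auto
        have N: "0 < N" by (simp add: N_def)
        define p' where "p' = (\<lambda>i. if i < M * N then q (i div N) (i mod N) else y)"
        have p': "p' (j * N + i) = q j i" if "j < M" "i \<le> N" for i j
        proof (cases "i = N")
          case False
          then have "i < N" using that by simp
          moreover have "j * N + i < M * N"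
          proof -
            have "j * N + i < Suc j * N" using \<open>i < N\<close> by simp
            also have "\<dots> \<le> M * N" using that by (intro mult_right_mono) auto
            finally show ?thesis .
          qed
          ultimately show ?thesis using N by (simp add: p'_def)
        next
          case True
          have e: "j * N + i = Suc j * N" using True by simp
          have "q j i = p (Suc j)" using q(4) nN that True by auto
          moreover have "p' (Suc j * N) = p (Suc j)"
          proof (cases "Suc j < M")
            case True
            then have "Suc j * N < M * N" using N by (simp del: mult_Suc)
            moreover have "Suc j * N div N = Suc j" "Suc j * N mod N = 0" using N
              by (simp_all del: mult_Suc)
            ultimately show ?thesis using q(1)[OF True] unfolding p'_def by (simp del: mult_Suc)
          next
            case False
            then have "Suc j = M" using that by simp
            then show ?thesis using Mp by (simp add: p'_def del: mult_Suc)
          qed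
          ultimately show ?thesis unfolding e by simp
        qed
        have "good (Suc k) (M * N, p')"
          unfolding good_def prod.case
        proof (intro conjI allI impI)
          show "0 < M * N" using N Mp by simp
          show "p' 0 = x" using p'[of 0 0] Mp q(1)[of 0] by simp
          show "p' (M * N) = y" by (simp add: p'_def)
          show "p' j \<in> K" for j
            using q(2)[of "j div N" "j mod N"] xy N by (auto simp: p'_def less_mult_imp_div_less)
          fix j assume j: "j < M * N"
          then have "j div N < M" by (simp add: less_mult_imp_div_less)
          moreover have "j mod N < N" using N by simp
          moreover have "j = (j div N) * N + j mod N" "Suc j = (j div N) * N + Suc (j mod N)"
            by simp_all
          ultimately show "dist (p' j) (p' (Suc j)) < D (Suc k)"
            using p'[of "j div N" "j mod N"] p'[of "j div N" "Suc (j mod N)"] q(5)[of "j div N"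
              "j mod N"] by simp
        qed
        moreover have "step k Mp (M * N, p')"
          unfolding step_def Mp prod.case using N p' q(3) by (intro exI[of _ N]) auto
        ultimately show "\<exists>Mp'. (good (Suc k) Mp' \<and> (Suc k = 0 \<longrightarrow> fst Mp' = 1)) \<and> step k Mp Mp'"
          by blast
      qed
      then show ?thesis by blast
    qed
    then obtain F where F: "\<And>k. good k (F k)" "\<And>k. step k (F k) (F (Suc k))" "fst (F 0) = 1"
      by blast
    define M where "M = (\<lambda>k. fst (F k))"
    define p where "p = (\<lambda>k. snd (F k))"
    have M: "0 < M k" "p k 0 = x" "p k (M k) = y" "p k j \<in> K"
      "j < M k \<Longrightarrow> dist (p k j) (p k (Suc j)) < D k" for k j
      using F(1)[of k] by (auto simp: good_def M_def p_def case_prod_beta)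
    have MN: "\<exists>N>0. M (Suc k) = M k * N \<and> (\<forall>j<M k. \<forall>i\<le>N. dist (p k j) (p (Suc k) (j*N+i)) < E k)"
      for k
      using F(2)[of k] by (auto simp: step_def M_def p_def case_prod_beta)
    \<comment> \<open>The \<open>f k\<close> are step functions whose jumps are at most \<open>E k\<close>; their uniform limit is therefore
      continuous.\<close>
    define f where "f = (\<lambda>k (t::real). p k (nat \<lfloor>t * M k\<rfloor>))"
    have fstep: "dist (f k t) (f (Suc k) t) < E k" if "t \<in> {0..1}" for k t
    proof (cases "t = 1")
      case True
      then show ?thesis using Epos M by (simp add: f_def)
    next
      case False
      obtain N where N: "0 < N" "M (Suc k) = M k * N"
        "\<And>j i. j < M k \<Longrightarrow> i \<le> N \<Longrightarrow> dist (p k j) (p (Suc k) (j*N+i)) < E k"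
        using MN[of k] by metis
      define j where "j = nat \<lfloor>t * M k\<rfloor>"
      define j' where "j' = nat \<lfloor>t * M (Suc k)\<rfloor>"
      have "t * M k < M k" using that False M(1)[of k] by simp
      then have jM: "j < M k" using that unfolding j_def by (simp add: nat_less_iff floor_less_iff)
      have j1: "real j \<le> t * M k" "t * M k < real j + 1" using that unfolding j_def by simp_all
      have j2: "real j' \<le> t * M k * N" "t * M k * N < real j' + 1" using that N unfolding j'_def
        by (simp_all add: mult.assoc)
      have "real j * real N \<le> t * M k * N" "t * M k * N < (real j + 1) * N"
        using j1 N by (auto intro!: mult_right_mono mult_strict_right_mono)
      then have "real (j * N) < real (j' + 1)" "real j' < real ((j + 1) * N)" using j2
        by (auto simp: algebra_simps)
      then have "j * N \<le> j'" "j' < (j+1) * N" by linarith+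
      then obtain i where "j' = j * N + i" "i \<le> N"
        by (intro that[of "j' - j * N"]) auto
      then show ?thesis using N(3)[OF jM] by (simp add: f_def j_def[symmetric] j'_def[symmetric])
    qed
    have Esum: "dist (f k t) (f (k + m) t) \<le> 2 * E k - 2 * E (k + m)" if "t \<in> {0..1}" for k m t
    proof (induction m)
      case (Suc m)
      have "dist (f k t) (f (k + Suc m) t) \<le> dist (f k t) (f (k + m) t) + dist (f (k+m) t) (f (Suc
        (k + m)) t)"
        by (simp add: dist_triangle)
      also have "\<dots> \<le> 2 * E k - 2 * E (k + m) + E (k+m)" using Suc fstep[OF that, of "k+m"]
        by linarith
      also have "\<dots> = 2 * E k - 2 * E (k + Suc m)" by (simp add: E_def)
      finally show ?case .
    qed auto
    then have fE: "dist (f k t) (f n t) \<le> 2 * E k" if "t \<in> {0..1}" "k \<le> n" for k n t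
      using Esum[of t k "n - k"] that Epos[of n] by simp
    have E0: "E \<longlonglongrightarrow> 0"
      unfolding E_def by (intro tendsto_mult_right_zero LIMSEQ_realpow_zero) auto
    have fC: "Cauchy (\<lambda>k. f k t)" if "t \<in> {0..1}" for t
    proof (rule metric_CauchyI)
      fix r :: real assume "0 < r"
      then obtain k where k: "E k < r/4" using order_tendstoD(2)[OF E0, of "r/4"]
        by (auto simp: eventually_sequentially)
      have "dist (f m t) (f n t) < r" if "k \<le> m" "k \<le> n" for m n
        using fE[OF \<open>t \<in> _\<close> that(1)] fE[OF \<open>t \<in> _\<close> that(2)] dist_triangle3[of "f m t" "f n t"
          "f k t"] k by linarith
      then show "\<exists>M. \<forall>m\<ge>M. \<forall>n\<ge>M. dist (f m t) (f n t) < r" by blast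
    qed
    define g where "g = (\<lambda>t. lim (\<lambda>k. f k t))"
    have fg: "(\<lambda>k. f k t) \<longlonglongrightarrow> g t" if "t \<in> {0..1}" for t
      unfolding g_def using Cauchy_convergent[OF fC[OF that]] by (simp add: convergent_LIMSEQ_iff)
    have gE: "dist (f k t) (g t) \<le> 2 * E k" if "t \<in> {0..1}" for k t
      by (rule LIMSEQ_le_const2[OF tendsto_dist[OF tendsto_const fg[OF that]]])
        (use fE[OF that] in blast)
    have "continuous_on {0..1} g"
      unfolding continuous_on_iff
    proof safe
      fix t r :: real assume t: "t \<in> {0..1}" "0 < r"
      then obtain k where k: "E k < r/5" using order_tendstoD(2)[OF E0, of "r/5"]
        by (auto simp: eventually_sequentially)
      have close: "dist (f k s) (f k u) < E k" if su: "s \<in> {0..1}" "u \<in> {0..1}" "s \<le> u"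
        "u - s < 1 / M k" for s u
      proof -
        define i where "i = nat \<lfloor>s * M k\<rfloor>"
        define j where "j = nat \<lfloor>u * M k\<rfloor>"
        have "(u - s) * M k < 1" using su M(1)[of k] by (simp add: field_simps)
        then have "u * M k < s * M k + 1" by (simp add: algebra_simps)
        moreover have "s * M k \<le> u * M k" "u * M k \<le> M k" using su
          by (auto intro: mult_right_mono mult_left_le_one_le)
        moreover have "0 \<le> s * M k" using su by auto
        ultimately have "j = i \<or> j = Suc i \<and> j \<le> M k" unfolding i_def j_def by linarith
        then show ?thesis
        proof
          assume "j = i" then show ?thesis using Epos[of k] by (simp add: f_def i_def j_def)
        next
          assume "j = Suc i \<and> j \<le> M k"
          then show ?thesis using M(5)[where k=k and j=i] D(2)[of k]
            by (simp add: f_def i_def[symmetric] j_def[symmetric])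
        qed
      qed
      show "\<exists>d>0. \<forall>x'\<in>{0..1}. dist x' t < d \<longrightarrow> dist (g x') (g t) < r"
      proof (intro exI[of _ "1 / M k"] conjI ballI impI)
        show "0 < 1 / real (M k)" using M(1)[of k] by simp
        fix s assume s: "s \<in> {0..1}" "dist s t < 1 / M k"
        have "dist (f k s) (f k t) < E k"
          using close[of s t] close[of t s] s t
            by (cases "s \<le> t") (auto simp: dist_real_def dist_commute)
        then show "dist (g s) (g t) < r"
          using gE[OF s(1), of k] gE[OF t(1), of k] k dist_triangle3[of "g s" "g t"
            "f k s"] dist_triangle[of "f k s" "g t" "f k t"] by linarith
      qed
    qed
    moreover have "g t \<in> K \<inter> cball x e" if "t \<in> {0..1}" for t
    proof -
      have "g t \<in> K"
        by (rule Lim_in_closed_set[OF compact_imp_closed[OF assms(1)] _ _ fg[OF that]])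
          (auto simp: f_def M)
      moreover have "g t \<in> cball x e"
      proof (cases "t = 1")
        case True
        have "f k t = y" for k using True M by (simp add: f_def)
        then have "g t = y" using fg[OF that] by (simp add: LIMSEQ_const_iff)
        moreover have "dist x y \<le> e" using xy D(2)[of 0] \<open>0 < e\<close> by (simp add: E_def)
        ultimately show ?thesis by simp
      next
        case False
        \<comment> \<open>Level 0 is a single link, so \<open>f 0\<close> stays at \<open>x\<close>
          before \<open>t = 1\<close> and the limit drifts by at most
          \<open>2 * E 0 = e\<close>.\<close>
        have "nat \<lfloor>t * M 0\<rfloor> = 0" using F(3) that False by (simp add: M_def floor_eq_iff)
        then have "f 0 t = x" using M by (simp add: f_def)
        then show ?thesis using gE[OF that, of 0] by (simp add: E_def)
      qed
      ultimately show ?thesis by simp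
    qed
    moreover have "g 0 = x" using fg[of 0] M by (simp add: f_def LIMSEQ_const_iff)
    moreover have "g 1 = y" using fg[of 1] M by (simp add: f_def LIMSEQ_const_iff)
    ultimately show "\<exists>g. path g \<and> path_image g \<subseteq> K \<inter> cball x e \<and> pathstart g = x \<and> pathfinish g = y"
      by (intro exI[of _ g]) (auto simp: path_def path_image_def pathstart_def pathfinish_def)
  qed
qed

text \<open>The Mazurkiewicz--Moore--Menger theorem in the compact case.\<close>

proposition compact_locally_connected_imp_locally_path_connected:
  fixes K :: "'a::complete_space set"
  assumes "compact K" "locally connected K"
  shows "locally path_connected K"
  unfolding locally_path_connected_im_kleinen
proof safe
  fix V x assume V: "openin (top_of_set K) V" "x \<in> V"
  then obtain e where e: "0 < e" "K \<inter> cball x e \<subseteq> V" "x \<in> K"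
    by (metis Int_commute openin_contains_cball openin_imp_subset subsetD)
  obtain d where d: "0 < d" "\<And>x y. x \<in> K \<Longrightarrow> y \<in> K \<Longrightarrow> dist x y < d \<Longrightarrow>
     \<exists>g. path g \<and> path_image g \<subseteq> K \<inter> cball x e \<and> pathstart g = x \<and> pathfinish g = y"
    using close_points_path[OF assms e(1)] by metis
  show "\<exists>u. openin (top_of_set K) u \<and> x \<in> u \<and> u \<subseteq> V \<and>
            (\<forall>y. y \<in> u \<longrightarrow> (\<exists>p. path p \<and> path_image p \<subseteq> V \<and> pathstart p = x \<and> pathfinish p = y))"
  proof (intro exI[of _ "K \<inter> ball x (min d e)"] conjI allI impI)
    fix y assume "y \<in> K \<inter> ball x (min d e)"
    then show "\<exists>p. path p \<and> path_image p \<subseteq> V \<and> pathstart p = x \<and> pathfinish p = y"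
      using d(2)[of x y] e by fastforce
  qed (use e d in auto)
qed

section \<open>Separation by arcs and medians\<close>

lemma first_and_last_hit:
  fixes g :: "real \<Rightarrow> 'a::topological_space"
  assumes "continuous_on {0..1} g" "closed H" "0 \<le> u" "v \<le> 1" "w \<in> {u..v}" "g w \<in> H"
  shows "\<exists>a\<in>{u..v}. g a \<in> H \<and> (\<forall>s\<in>{u..v}. g s \<in> H \<longrightarrow> a \<le> s)"
    "\<exists>b\<in>{u..v}. g b \<in> H \<and> (\<forall>s\<in>{u..v}. g s \<in> H \<longrightarrow> s \<le> b)"
proof -
  have "continuous_on {u..v} g" using assms by (auto intro: continuous_on_subset)
  then have "closed ({u..v} \<inter> g -` H)" using assms(2) by (intro continuous_closed_preimage) auto
  moreover have "bounded ({u..v} \<inter> g -` H)" by (meson bounded_Int bounded_closed_interval)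
  ultimately have c: "compact ({u..v} \<inter> g -` H)" using compact_eq_bounded_closed by blast
  have ne: "{u..v} \<inter> g -` H \<noteq> {}" using assms by blast
  show "\<exists>a\<in>{u..v}. g a \<in> H \<and> (\<forall>s\<in>{u..v}. g s \<in> H \<longrightarrow> a \<le> s)"
    using compact_attains_inf[OF c ne] by blast
  show "\<exists>b\<in>{u..v}. g b \<in> H \<and> (\<forall>s\<in>{u..v}. g s \<in> H \<longrightarrow> s \<le> b)"
    using compact_attains_sup[OF c ne] by blast
qed

text \<open>Let \<open>h\<close> be an arc between the ends that avoids \<open>g t\<close>. Cut
  \<open>g\<close> at its last contact with \<open>h\<close> before \<open>t\<close> and at its
  first contact after \<open>t\<close>: this piece and the part of \<open>h\<close> between the two
  contacts form a circle.\<close>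

lemma arc_interior_separates:
  fixes K :: "'a::{complete_space,real_normed_vector} set"
  assumes K: "compact K" "locally connected K"
    and circ: "\<nexists>C. C \<subseteq> K \<and> C homeomorphic sphere (0::complex) 1"
    and g: "arc g" "path_image g \<subseteq> K" and t: "0 < t" "t < 1"
  shows "\<not> connected_component (K - {g t}) (pathstart g) (pathfinish g)"
proof
  assume *: "connected_component (K - {g t}) (pathstart g) (pathfinish g)"
  have "locally path_connected (K - {g t})"
    by (rule locally_open_subset[OF compact_locally_connected_imp_locally_path_connected[OF K]])
      (simp add: openin_delete)
  then have "path_component (K - {g t}) (pathstart g) (pathfinish g)"
    using path_component_eq_connected_component_set[of "K - {g t}" "pathstart g"] * by blast
  then obtain h0 where h0: "path h0" "path_image h0 \<subseteq> K - {g t}" "pathstart h0 = pathstart g"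
    "pathfinish h0 = pathfinish g"
    unfolding path_component_def by blast
  obtain h where h: "arc h" "path_image h \<subseteq> path_image h0" "pathstart h = pathstart g"
    "pathfinish h = pathfinish g"
    using path_contains_arc[OF h0(1,3,4) arc_distinct_ends[OF g(1), symmetric]] by metis
  define H where "H = path_image h"
  have H: "compact H" "H \<subseteq> K" "g t \<notin> H" "g 0 \<in> H" "g 1 \<in> H"
    using h h0 pathstart_in_path_image[of h] pathfinish_in_path_image[of h]
    by (auto simp: H_def compact_arc_image pathstart_def pathfinish_def)
  have cg: "continuous_on {0..1} g" using g by (simp add: arc_def path_def)
  obtain a where a: "a \<in> {0..t}" "g a \<in> H" "\<And>s. s \<in> {0..t} \<Longrightarrow> g s \<in> H \<Longrightarrow> s \<le> a"
    using first_and_last_hit(2)[OF cg compact_imp_closed[OF H(1)] order_refl less_imp_le[OF t(2)] _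
      H(4)] t
    by (meson atLeastAtMost_iff less_imp_le order_refl)
  obtain b where b: "b \<in> {t..1}" "g b \<in> H" "\<And>s. s \<in> {t..1} \<Longrightarrow> g s \<in> H \<Longrightarrow> b \<le> s"
    using first_and_last_hit(1)[OF cg compact_imp_closed[OF H(1)] less_imp_le[OF t(1)] order_refl _
      H(5)] t
    by (meson atLeastAtMost_iff less_imp_le order_refl)
  have ab: "a < t" "t < b" using a b H by (auto simp: order_less_le)
  obtain \<sigma> \<tau> where st: "\<sigma> \<in> {0..1}" "\<tau> \<in> {0..1}" "h \<sigma> = g a" "h \<tau> = g b"
    using a(2) b(2) unfolding H_def path_image_def by (metis imageE)
  have inj: "inj_on g {0..1}" using g by (simp add: arc_def)
  have "g a \<noteq> g b" using inj_onD[OF inj, of a b] ab a b by auto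
  then have "\<sigma> \<noteq> \<tau>" using st by auto
  have "simple_path (subpath a b g +++ subpath \<tau> \<sigma> h)"
  proof (rule simple_path_join_loop)
    show "arc (subpath a b g)" using g ab a b t by (intro arc_subpath_arc) auto
    show "arc (subpath \<tau> \<sigma> h)" using h st \<open>\<sigma> \<noteq> \<tau>\<close> by (intro arc_subpath_arc) auto
    show "path_image (subpath a b g) \<inter> path_image (subpath \<tau> \<sigma> h) \<subseteq> {pathstart (subpath a b g),
      pathstart (subpath \<tau> \<sigma> h)}"
    proof
      fix w assume w: "w \<in> path_image (subpath a b g) \<inter> path_image (subpath \<tau> \<sigma> h)"
      then obtain s where s: "s \<in> {a..b}" "w = g s" using ab
        by (auto simp: path_image_subpath split: if_splits)
      have "w \<in> H" using w path_image_subpath_subset[OF st(2,1), of h] by (auto simp: H_def)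
      then have "s = a \<or> s = b" using a(3)[of s] b(3)[of s] a(1) b(1) s by (cases "s \<le> t") auto
      then show "w \<in> {pathstart (subpath a b g), pathstart (subpath \<tau> \<sigma> h)}" using s st by auto
    qed
  qed (use st in auto)
  then have "path_image (subpath a b g +++ subpath \<tau> \<sigma> h) homeomorphic sphere (0::complex) 1"
    by (rule homeomorphic_simple_path_image_circle) (use st in auto)
  moreover have "path_image (subpath a b g +++ subpath \<tau> \<sigma> h) \<subseteq> K"
  proof -
    have "path_image (subpath a b g) \<subseteq> path_image g" using a b t
      by (intro path_image_subpath_subset) auto
    moreover have "path_image (subpath \<tau> \<sigma> h) \<subseteq> H" using st unfolding H_def
      by (intro path_image_subpath_subset) auto
    ultimately show ?thesis using H g by (intro order_trans[OF path_image_join_subset]) auto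
  qed
  ultimately show False using circ by blast
qed

lemma locally_connected_continuum_arc:
  fixes K :: "'a::{complete_space,real_normed_vector} set"
  assumes K: "compact K" "locally connected K" "connected K" and xy: "x \<in> K" "y \<in> K" "x \<noteq> y"
  obtains g where "arc g" "path_image g \<subseteq> K" "pathstart g = x" "pathfinish g = y"
proof -
  have "path_component_set K x = connected_component_set K x"
    by (rule path_component_eq_connected_component_set)
      (rule compact_locally_connected_imp_locally_path_connected[OF K(1,2)])
  then have "path_component K x y" using K xy by (auto simp: connected_component_eq_self)
  then show thesis using path_contains_arc xy(3) that unfolding path_component_def
    by (metis order_trans)
qed

text \<open>The median is the point where an arc from \<open>z\<close> first reaches an arc
  \<open>g\<close> from \<open>x\<close> to \<open>y\<close>. Interior points of arcs separate the
  ends, so it is enough that this point lies on an arc between each pair.\<close>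

lemma no_circle_median:
  fixes K :: "'a::{complete_space,real_normed_vector} set"
  assumes K: "compact K" "locally connected K" "connected K"
    and circ: "\<nexists>C. C \<subseteq> K \<and> C homeomorphic sphere (0::complex) 1"
    and xyz: "x \<in> K" "y \<in> K" "z \<in> K"
  shows "\<exists>m\<in>K. \<forall>(u,v)\<in>{(x,y),(y,z),(x,z)}. m = u \<or> m = v \<or> \<not> connected_component (K - {m}) u v"
proof (cases "x = y \<or> y = z \<or> x = z")
  case True
  then show ?thesis using xyz by blast
next
  case False
  note sep = arc_interior_separates[OF K(1,2) circ]
  obtain g where g: "arc g" "path_image g \<subseteq> K" "pathstart g = x" "pathfinish g = y"
    using locally_connected_continuum_arc[OF K xyz(1,2)] False by metis
  have on_arc: "m = pathstart p \<or> m = pathfinish p \<or>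
    \<not> connected_component (K - {m}) (pathstart p) (pathfinish p)"
    if p: "arc p" "path_image p \<subseteq> K" "m \<in> path_image p" for m p
  proof -
    obtain t where "t \<in> {0..1}" "m = p t" using p(3) by (auto simp: path_image_def)
    then show ?thesis using sep[OF p(1,2), of t]
      by (cases "t = 0 \<or> t = 1") (auto simp: pathstart_def pathfinish_def)
  qed
  \<comment> \<open>Since \<open>k\<close> meets \<open>g\<close> only in \<open>m\<close>,
    following \<open>k\<close> from \<open>z\<close> and then \<open>g\<close> towards either end
    gives an arc through \<open>m\<close>.\<close>
  have gz: "m = x \<or> m = z \<or> \<not> connected_component (K - {m}) x z"
    "m = y \<or> m = z \<or> \<not> connected_component (K - {m}) y z"
    if k: "arc k" "path_image k \<subseteq> K" "pathstart k = z" "pathfinish k = m"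
      "path_image k \<inter> path_image g = {m}" for k m
  proof -
    obtain s where s: "s \<in> {0..1}" "m = g s" using k(5) unfolding path_image_def by blast
    have *: "m = g u \<or> m = z \<or> \<not> connected_component (K - {m}) (g u) z" if u: "u \<in> {0,1}" for u
    proof (cases "m = g u")
      case False
      have a: "arc (subpath s u g)" by (rule arc_subpath_arc) (use g s u False in auto)
      have i: "path_image (subpath s u g) \<subseteq> path_image g"
        by (rule path_image_subpath_subset) (use s u in auto)
      have "path_image k \<inter> path_image (subpath s u g) \<subseteq> {pathstart (subpath s u g)}"
        using i k s by auto
      then have j: "arc (k +++ subpath s u g)" using k s a by (intro arc_join) auto
      have "path_image (k +++ subpath s u g) \<subseteq> K" using k i g
        by (intro order_trans[OF path_image_join_subset]) auto
      moreover have "m \<in> path_image (k +++ subpath s u g)"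
        using k s pathfinish_in_path_image[of k] by (subst path_image_join) auto
      ultimately show ?thesis using on_arc[OF j] k by (auto simp: connected_component_sym_eq)
    qed auto
    show "m = x \<or> m = z \<or> \<not> connected_component (K - {m}) x z"
      "m = y \<or> m = z \<or> \<not> connected_component (K - {m}) y z"
      using *[of 0] *[of 1] g by (auto simp: pathstart_def pathfinish_def)
  qed
  show ?thesis
  proof (cases "z \<in> path_image g")
    case True
    then show ?thesis using on_arc[OF g(1,2) True] g xyz by auto
  next
    case zg: False
    obtain h where h: "arc h" "path_image h \<subseteq> K" "pathstart h = z" "pathfinish h = x"
      using locally_connected_continuum_arc[OF K xyz(3,1)] False by metis
    have "continuous_on {0..1} h" "closed (path_image g)" "h 1 \<in> path_image g"
      using h(1,4) g(1,3) pathstart_in_path_image[of g]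
      by (auto simp: arc_def path_def compact_imp_closed compact_arc_image pathfinish_def)
    then obtain s where s: "s \<in> {0..1}" "h s \<in> path_image g"
      "\<And>r. r \<in> {0..1} \<Longrightarrow> h r \<in> path_image g \<Longrightarrow> s \<le> r"
      using first_and_last_hit(1)[of h "path_image g" 0 1 1]
        by (meson atLeastAtMost_iff order_refl zero_le_one)
    have "s \<noteq> 0" using s zg h by (auto simp: pathstart_def)
    have arc: "arc (subpath 0 s h)" using h s \<open>s \<noteq> 0\<close> by (intro arc_subpath_arc) auto
    have "path_image (subpath 0 s h) = h ` {0..s}" using s by (auto simp: path_image_subpath)
    then have "path_image (subpath 0 s h) \<inter> path_image g = {h s}" using s by fastforce
    moreover have "path_image (subpath 0 s h) \<subseteq> K"
      using path_image_subpath_subset[of 0 s h] s h by auto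
    ultimately have "h s = x \<or> h s = z \<or> \<not> connected_component (K - {h s}) x z"
      "h s = y \<or> h s = z \<or> \<not> connected_component (K - {h s}) y z"
      using gz[OF arc] h by (auto simp: pathstart_def pathfinish_def subpath_def)
    moreover have "h s = x \<or> h s = y \<or> \<not> connected_component (K - {h s}) x y"
      using on_arc[OF g(1,2) s(2)] g by auto
    ultimately show ?thesis using s g by (intro bexI[of _ "h s"]) auto
  qed
qed

subsection \<open>Separation in dendrites\<close>

lemma (in Metric_space) compact_space_countable_dense:
  assumes "compact_space mtopology"
  obtains C where "countable C" "C \<subseteq> M" "\<And>x \<epsilon>. x \<in> M \<Longrightarrow> 0 < \<epsilon> \<Longrightarrow> \<exists>c\<in>C. d x c < \<epsilon>"
proof -
  have "mtotally_bounded M"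
    using assms compact_space_eq_mcomplete_mtotally_bounded by blast
  then have "\<exists>K. finite K \<and> K \<subseteq> M \<and> M \<subseteq> (\<Union>x\<in>K. mball x (inverse (Suc n)))" for n
    unfolding mtotally_bounded_def by simp
  then obtain K where K: "\<And>n. finite (K n)" "\<And>n. K n \<subseteq> M"
    "\<And>n. M \<subseteq> (\<Union>x\<in>K n. mball x (inverse (Suc n)))"
    by metis
  show thesis
  proof
    show "countable (\<Union>n. K n)" using K(1) by (simp add: countable_finite)
    show "(\<Union>n. K n) \<subseteq> M" using K(2) by blast
    fix x and \<epsilon> :: real assume "x \<in> M" "0 < \<epsilon>"
    obtain n where n: "inverse (Suc n) < \<epsilon>" using \<open>0 < \<epsilon>\<close> reals_Archimedean by blast
    obtain c where "c \<in> K n" "x \<in> mball c (inverse (Suc n))" using K(3)[of n] \<open>x \<in> M\<close> by blast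
    then show "\<exists>c\<in>\<Union>n. K n. d x c < \<epsilon>" using n by (intro bexI[of _ c]) (auto simp: commute)
  qed
qed

text \<open>
  Kuratowski's embedding. It moves the dendrite into a Banach space, where the library's theorems on
  arcs apply. The index type is \<open>'a discrete\<close> because the completeness instance of \<open>\<Rightarrow>\<^sub>C\<close>
  requires a metric domain.
\<close>

lemma compact_metrizable_embedding:
  assumes "compact_space X" "metrizable_space X"
  obtains e :: "'a \<Rightarrow> ('a discrete \<Rightarrow>\<^sub>C real)"
    where "homeomorphic_map X (top_of_set (e ` topspace X)) e"
proof -
  obtain M d where Md: "Metric_space M d" "X = Metric_space.mtopology M d"
    using assms(2) unfolding metrizable_space_def by blast
  interpret Metric_space M d by (rule Md)
  have "mbounded M"
    using assms(1) Md(2) by (metis compact_space_def compactin_imp_mbounded topspace_mtopology)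
  then obtain B where B: "\<And>x y. x \<in> M \<Longrightarrow> y \<in> M \<Longrightarrow> d x y \<le> B" unfolding mbounded_alt by blast
  define e :: "'a \<Rightarrow> ('a discrete \<Rightarrow>\<^sub>C real)" where
    "e = (\<lambda>x. Bcontfun (\<lambda>y. if of_discrete y \<in> M then d x (of_discrete y) else 0))"
  have cont: "continuous_on UNIV f" for f :: "'a discrete \<Rightarrow> real"
    by (simp add: continuous_on_open_vimage open_discrete)
  have e: "apply_bcontfun (e x) = (\<lambda>y. if of_discrete y \<in> M then d x (of_discrete y) else 0)"
    if "x \<in> M" for x
    unfolding e_def
    by (rule Bcontfun_inverse, rule bcontfun_normI[where b="max B 0"])
      (use B[OF that] cont in \<open>auto simp: le_max_iff_disj\<close>)
  have le: "dist (e x) (e y) \<le> d x y" if "x \<in> M" "y \<in> M" for x y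
  proof (rule dist_bound)
    fix z
    show "dist (e x z) (e y z) \<le> d x y"
      using that triangle[of x y "of_discrete z"] triangle[of y x "of_discrete z"]
        by (auto simp: e dist_real_def commute)
  qed
  have inj: "inj_on e M"
  proof (rule inj_onI)
    fix x y assume xy: "x \<in> M" "y \<in> M" "e x = e y"
    then have "apply_bcontfun (e x) (discrete y) = apply_bcontfun (e y) (discrete y)" by simp
    then have "d x y = d y y" using xy(1,2) unfolding e[OF xy(1)] e[OF xy(2)]
      by (simp add: discrete_inverse)
    then show "x = y" using xy(1,2) zero[of x y] zero[of y y] by simp
  qed
  have tX: "topspace X = M" using Md by simp
  have "continuous_map X euclidean e"
    unfolding continuous_map_def
  proof (intro conjI allI impI)
    fix U :: "('a discrete \<Rightarrow>\<^sub>C real) set" assume "openin euclidean U"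
    then have U: "open U" by simp
    show "openin X {x \<in> topspace X. e x \<in> U}"
      unfolding Md(2) openin_mtopology
    proof (intro conjI allI impI)
      fix x assume x: "x \<in> {x \<in> topspace mtopology. e x \<in> U}"
      then obtain r where r: "0 < r" "ball (e x) r \<subseteq> U" using U open_contains_ball by blast
      have "mball x r \<subseteq> {x \<in> topspace mtopology. e x \<in> U}"
      proof
        fix y assume "y \<in> mball x r"
        then have "y \<in> M" "dist (e x) (e y) < r" using le[of x y] by auto
        then show "y \<in> {x \<in> topspace mtopology. e x \<in> U}" using r by auto
      qed
      then show "\<exists>r>0. mball x r \<subseteq> {x \<in> topspace mtopology. e x \<in> U}" using r by blast
    qed auto
  qed auto
  then have c: "continuous_map X (top_of_set (e ` topspace X)) e"
    by (simp add: continuous_map_in_subtopology)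
  have "homeomorphic_map X (top_of_set (e ` topspace X)) e"
  proof (rule bijective_closed_imp_homeomorphic_map[OF c])
    show "closed_map X (top_of_set (e ` topspace X)) e"
      by (rule continuous_imp_closed_map_gen[OF assms(1) _ c])
        (simp add: Hausdorff_imp_kc_space Hausdorff_space_subtopology)
  qed (use inj tX in auto)
  then show thesis by (rule that)
qed

lemma homeomorphic_space_top_of_set:
  assumes "S homeomorphic T" shows "top_of_set S homeomorphic_space top_of_set T"
proof -
  obtain f g where "homeomorphism S T f g" using assms homeomorphic_def by blast
  then have "homeomorphic_maps (top_of_set S) (top_of_set T) f g"
    by (auto simp: homeomorphism_def homeomorphic_maps_def)
  then show ?thesis unfolding homeomorphic_space_def by blast
qed

definition joined :: "'a topology \<Rightarrow> 'a \<Rightarrow> 'a \<Rightarrow> 'a \<Rightarrow> bool" where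
  "joined X p x y \<longleftrightarrow> p \<in> topspace X \<and> connected_component_of (subtopology X (topspace X - {p})) x y"

locale embedded_dendrite =
  fixes X :: "'a topology" and e :: "'a \<Rightarrow> ('a discrete \<Rightarrow>\<^sub>C real)" and K
  assumes dX: "dendrite X" and K_def: "K = e ` topspace X"
    and hom: "homeomorphic_map X (top_of_set K) e"
begin

lemma compact_K: "compact K"
proof -
  have "compact_space (top_of_set K)"
    using dX hom homeomorphic_map_imp_homeomorphic_space homeomorphic_compact_space
    unfolding dendrite_def by blast
  then show ?thesis using compactin_subspace[of euclidean K] by simp
qed

lemma connected_K: "connected K"
proof -
  have "connected_space (top_of_set K)"
    using dX hom homeomorphic_map_imp_homeomorphic_space homeomorphic_connected_space
    unfolding dendrite_def by blast
  then show ?thesis using connectedin_def[of euclidean K] by simp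
qed

lemma locally_connected_K: "locally connected K"
proof -
  have "locally_connected_space (top_of_set K)"
    using dX hom homeomorphic_locally_connected_space homeomorphic_map_imp_homeomorphic_space
    unfolding dendrite_def by blast
  then show ?thesis
    unfolding locally_connected_space locally_connected
    by (metis connectedin_iff_connected connectedin_subtopology)
qed

lemma no_circle_K: "\<nexists>C. C \<subseteq> K \<and> C homeomorphic sphere (0::complex) 1"
proof
  assume "\<exists>C. C \<subseteq> K \<and> C homeomorphic sphere (0::complex) 1"
  then obtain C where C: "C \<subseteq> K" "C homeomorphic sphere (0::complex) 1" by blast
  define A where "A = {x \<in> topspace X. e x \<in> C}"
  have "e ` A = C" using C K_def by (auto simp: A_def)
  then have "homeomorphic_map (subtopology X A) (subtopology (top_of_set K) C) e"
    using hom C by (intro homeomorphic_map_subtopologies) (auto simp: A_def)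
  moreover have "subtopology (top_of_set K) C = top_of_set C" using C
    by (simp add: subtopology_subtopology inf.absorb2)
  ultimately have "subtopology X A homeomorphic_space top_of_set (sphere (0::complex) 1)"
    using homeomorphic_map_imp_homeomorphic_space homeomorphic_space_trans
      homeomorphic_space_top_of_set[OF C(2)] by metis
  then have "simple_closed_curve_in X A" by (auto simp: simple_closed_curve_in_def A_def)
  then show False using dX dendrite_def by blast
qed

lemma e_inj: "x \<in> topspace X \<Longrightarrow> y \<in> topspace X \<Longrightarrow> e x = e y \<longleftrightarrow> x = y"
  using hom by (meson homeomorphic_imp_injective_map inj_onD)

lemma joined_embed:
  assumes "joined X p x y"
  shows "connected_component (K - {e p}) (e x) (e y)"
proof -
  obtain C where C: "connectedin X C" "C \<subseteq> topspace X - {p}" "x \<in> C" "y \<in> C" "p \<in> topspace X"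
    using assms unfolding joined_def connected_component_of_def
      by (auto simp: connectedin_subtopology)
  have "connectedin (top_of_set K) (e ` C)"
    by (rule connectedin_continuous_map_image[OF homeomorphic_imp_continuous_map[OF hom] C(1)])
  then have "connected (e ` C)" by (simp add: connectedin_subtopology)
  moreover have "e ` C \<subseteq> K - {e p}" using C e_inj by (fastforce simp: K_def)
  ultimately show ?thesis using C unfolding connected_component_def by blast
qed

lemma median:
  assumes "x \<in> topspace X" "y \<in> topspace X" "z \<in> topspace X"
  shows "\<exists>m\<in>topspace X. (m = x \<or> m = y \<or> \<not> joined X m x y) \<and> (m = y \<or> m = z \<or> \<not> joined X m y z) \<and>
    (m = x \<or> m = z \<or> \<not> joined X m x z)"
proof -
  have "e x \<in> K" "e y \<in> K" "e z \<in> K" using assms by (auto simp: K_def)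
  then obtain m where m: "m \<in> topspace X"
    "\<forall>(u,v)\<in>{(e x,e y),(e y,e z),(e x,e z)}. e m = u \<or> e m = v \<or>
      \<not> connected_component (K - {e m}) u v"
    using no_circle_median[OF compact_K locally_connected_K connected_K no_circle_K, of "e x" "e y"
      "e z"]
    by (auto simp: K_def)
  have "m = u \<or> m = v \<or> \<not> joined X m u v" if "(u,v) = (x,y) \<or> (u,v) = (y,z) \<or> (u,v) = (x,z)" for u v
  proof -
    have "e m = e u \<or> e m = e v \<or> \<not> connected_component (K - {e m}) (e u) (e v)"
      using bspec[OF m(2), of "(e u, e v)"] that by fastforce
    moreover have "u \<in> topspace X" "v \<in> topspace X" using that assms by auto
    ultimately show ?thesis using joined_embed[of m u v] e_inj[OF m(1)] by blast
  qed
  then show ?thesis by (intro bexI[OF _ m(1)] conjI) blast+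
qed

text \<open>A whole arc of separating points is produced because points of a given order are only
  postulated to exist on arcs. The middle third of an arc from \<open>x\<close> to \<open>y\<close>
  has only interior points.\<close>

lemma separating_arc:
  assumes "x \<in> topspace X" "y \<in> topspace X" "x \<noteq> y"
  obtains A where "arc_in X A" "\<And>p. p \<in> A \<Longrightarrow> p \<in> topspace X \<and> p \<noteq> x \<and> p \<noteq> y \<and> \<not> joined X p x y"
proof -
  have "e x \<in> K" "e y \<in> K" "e x \<noteq> e y" using assms e_inj by (auto simp: K_def)
  then obtain g where g: "arc g" "path_image g \<subseteq> K" "pathstart g = e x" "pathfinish g = e y"
    using locally_connected_continuum_arc[OF compact_K locally_connected_K connected_K] by metis
  define h where "h = subpath (1/3) (2/3) g"
  have h: "arc h" "path_image h = g ` {1/3..2/3}"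
    using g unfolding h_def by (auto intro: arc_subpath_arc simp: path_image_subpath)
  define A where "A = {x \<in> topspace X. e x \<in> path_image h}"
  have C: "path_image h \<subseteq> K" using g h by (auto simp: path_image_def)
  then have eA: "e ` A = path_image h" using K_def by (auto simp: A_def)
  then have "homeomorphic_map (subtopology X A) (subtopology (top_of_set K) (path_image h)) e"
    using hom C by (intro homeomorphic_map_subtopologies) (auto simp: A_def)
  moreover have "subtopology (top_of_set K) (path_image h) = top_of_set (path_image h)" using C
    by (simp add: subtopology_subtopology inf.absorb2)
  moreover have "path_image h homeomorphic {0..1::real}"
    by (rule homeomorphic_arc_image_interval[OF h(1)]) auto
  ultimately have "subtopology X A homeomorphic_space top_of_set {0..1::real}"
    using homeomorphic_map_imp_homeomorphic_space homeomorphic_space_trans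
      homeomorphic_space_top_of_set by metis
  then have "arc_in X A" by (auto simp: arc_in_def A_def)
  moreover have "p \<in> topspace X \<and> p \<noteq> x \<and> p \<noteq> y \<and> \<not> joined X p x y" if "p \<in> A" for p
  proof -
    have "e p \<in> g ` {1/3..2/3}" using that h(2) by (simp add: A_def)
    obtain t where t: "t \<in> {1/3..2/3}" "e p = g t" using \<open>e p \<in> g ` {1/3..2/3}\<close> by blast
    have "\<not> connected_component (K - {e p}) (e x) (e y)"
      using arc_interior_separates[OF compact_K locally_connected_K no_circle_K g(1,2), of t] t g
        by auto
    moreover have "g t \<noteq> g 0" "g t \<noteq> g 1" using g(1) t unfolding arc_def by (auto dest: inj_onD)
    ultimately show ?thesis using joined_embed[of p x y] t g that
      by (auto simp: A_def pathstart_def pathfinish_def)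
  qed
  ultimately show thesis by (rule that)
qed

end

lemma dendrite_embedded:
  assumes "dendrite X" obtains e K where "embedded_dendrite X e K"
  using compact_metrizable_embedding[of X] assms unfolding embedded_dendrite_def dendrite_def
    by metis

lemma dendrite_median:
  assumes "dendrite X" "x \<in> topspace X" "y \<in> topspace X" "z \<in> topspace X"
  shows "\<exists>m\<in>topspace X. (m = x \<or> m = y \<or> \<not> joined X m x y) \<and> (m = y \<or> m = z \<or> \<not> joined X m y z) \<and>
    (m = x \<or> m = z \<or> \<not> joined X m x z)"
proof -
  obtain e K where "embedded_dendrite X e K" by (rule dendrite_embedded[OF assms(1)])
  then show ?thesis by (rule embedded_dendrite.median[OF _ assms(2-4)])
qed

lemma wazewski_dendrite_separating_point:
  assumes "wazewski_dendrite S X" "n \<in> S" "x \<in> topspace X" "y \<in> topspace X" "x \<noteq> y"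
  shows "\<exists>p\<in>topspace X. has_order X p n \<and> p \<noteq> x \<and> p \<noteq> y \<and> \<not> joined X p x y"
proof -
  obtain e K where emb: "embedded_dendrite X e K"
    using dendrite_embedded assms(1) unfolding wazewski_dendrite_def by metis
  obtain A where A: "arc_in X A" "\<And>p. p \<in> A \<Longrightarrow> p \<in> topspace X \<and> p \<noteq> x \<and> p \<noteq> y \<and> \<not> joined X p x y"
    by (rule embedded_dendrite.separating_arc[OF emb assms(3-5)]) blast
  obtain p where "p \<in> A" "has_order X p n"
    using assms(1,2) A(1) unfolding wazewski_dendrite_def by blast
  then show ?thesis using A(2) by blast
qed

subsection \<open>Betweenness and back-and-forth\<close>

text \<open>
  \<open>J p x y\<close> abstracts the statement that \<open>x\<close> and \<open>y\<close> lie in the same component of the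
  complement of \<open>p\<close>; its negation \<open>bt p x y\<close> then says that \<open>p\<close> lies strictly between \<open>x\<close> and \<open>y\<close>.
\<close>

locale pretree =
  fixes \<Omega> :: "'a set" and J :: "'a \<Rightarrow> 'a \<Rightarrow> 'a \<Rightarrow> bool"
  assumes J_dom: "J p x y \<Longrightarrow> p \<in> \<Omega> \<and> x \<in> \<Omega> \<and> y \<in> \<Omega> \<and> x \<noteq> p \<and> y \<noteq> p"
    and J_refl: "p \<in> \<Omega> \<Longrightarrow> x \<in> \<Omega> \<Longrightarrow> x \<noteq> p \<Longrightarrow> J p x x"
    and J_sym: "J p x y \<Longrightarrow> J p y x"
    and J_trans: "J p x y \<Longrightarrow> J p y z \<Longrightarrow> J p x z"
    and J_swap: "p \<in> \<Omega> \<Longrightarrow> q \<in> \<Omega> \<Longrightarrow> x \<in> \<Omega> \<Longrightarrow> p \<noteq> q \<Longrightarrow> x \<noteq> p \<Longrightarrow> \<not> J p x q \<Longrightarrow> J q x p"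
begin

definition bt :: "'a \<Rightarrow> 'a \<Rightarrow> 'a \<Rightarrow> bool" where
  "bt p x y \<longleftrightarrow> p \<in> \<Omega> \<and> x \<in> \<Omega> \<and> y \<in> \<Omega> \<and> x \<noteq> p \<and> y \<noteq> p \<and> \<not> J p x y"

definition wbt :: "'a \<Rightarrow> 'a \<Rightarrow> 'a \<Rightarrow> bool" where
  "wbt p x y \<longleftrightarrow> p = x \<or> p = y \<or> bt p x y"

definition med :: "'a \<Rightarrow> 'a \<Rightarrow> 'a \<Rightarrow> 'a \<Rightarrow> bool" where
  "med m x y z \<longleftrightarrow> wbt m x y \<and> wbt m y z \<and> wbt m x z"

lemma bt_dom: "bt p x y \<Longrightarrow> p \<in> \<Omega> \<and> x \<in> \<Omega> \<and> y \<in> \<Omega> \<and> x \<noteq> p \<and> y \<noteq> p \<and> x \<noteq> y"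
  unfolding bt_def using J_refl by blast

lemma bt_sym: "bt p x y \<Longrightarrow> bt p y x"
  unfolding bt_def using J_sym by blast

lemma bt_asym: "bt p x y \<Longrightarrow> \<not> bt x p y"
  unfolding bt_def using J_swap J_sym by metis

lemma bt_split: "bt p x y \<Longrightarrow> z \<in> \<Omega> \<Longrightarrow> z \<noteq> p \<Longrightarrow> bt p x z \<or> bt p z y"
  unfolding bt_def using J_trans by blast

lemma wbt_sym: "wbt p x y \<Longrightarrow> wbt p y x"
  unfolding wbt_def using bt_sym by blast

lemma med_perm: "med m x y z \<Longrightarrow> med m y x z" "med m x y z \<Longrightarrow> med m x z y" "med m x y z \<Longrightarrow> med m z y x"
  "med m x y z \<Longrightarrow> med m y z x" "med m x y z \<Longrightarrow> med m z x y"
  unfolding med_def using wbt_sym by blast+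

text \<open>The points are in the order \<open>x\<close>, \<open>p\<close>, \<open>q\<close>,
  \<open>y\<close>. Each claim comes from splitting a hypothesis at the fourth point; the unwanted
  alternative contradicts \<open>bt_asym\<close>.\<close>

lemma bt_chain:
  assumes "bt p x y" "bt q p y" shows "bt q x y" "bt p x q"
proof -
  have "q \<noteq> x" using assms bt_asym by blast
  moreover have "p \<noteq> q" using assms bt_dom by blast
  ultimately have "bt q p x \<or> bt q x y" "bt p x q \<or> bt p q y"
    using bt_split[OF assms(2), of x] bt_split[OF assms(1), of q] assms bt_dom by blast+
  then show "bt q x y" "bt p x q" using bt_asym bt_sym assms by blast+
qed

lemma bt_concat:
  assumes "bt p x q" "bt q p y" shows "bt p x y" "bt q x y"
proof -
  have "p \<noteq> y" using assms bt_dom by blast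
  then have "bt p x y \<or> bt p y q" using bt_split[OF assms(1), of y] assms bt_dom by blast
  then show *: "bt p x y" using bt_asym bt_sym assms by blast
  show "bt q x y" using bt_chain[OF * assms(2)] by blast
qed

text \<open>A point \<open>p\<close> that \<open>a\<close> cuts off from all others is a leaf
  attached at \<open>a\<close>: it lies between no two of them, and by
  \<open>bt_leaf_replace\<close> the others see it in the direction of \<open>a\<close>.\<close>

lemma bt_leaf: "x = a \<or> bt a p x \<Longrightarrow> y = a \<or> bt a p y \<Longrightarrow> p \<noteq> a \<Longrightarrow> \<not> bt p x y"
  using bt_asym bt_sym bt_split bt_dom by metis

lemma bt_leaf_replace: "bt a p x \<Longrightarrow> bt x p y \<longleftrightarrow> bt x a y"
  using bt_asym bt_sym bt_split bt_dom by metis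

text \<open>The point \<open>m\<close> is the point of the convex hull of \<open>F\<close> nearest to \<open>p\<close>.\<close>

lemma gate_exists:
  assumes "finite F" "F \<noteq> {}" "F \<subseteq> \<Omega>" "p \<in> \<Omega>"
    and median: "\<And>x y z. x \<in> \<Omega> \<Longrightarrow> y \<in> \<Omega> \<Longrightarrow> z \<in> \<Omega> \<Longrightarrow> \<exists>m\<in>\<Omega>. med m x y z"
  shows "\<exists>m\<in>\<Omega>. (m \<in> F \<or> (\<exists>a\<in>F. \<exists>b\<in>F. bt m a b)) \<and> (m = p \<or> (\<forall>x\<in>F-{m}. bt m p x))"
  using assms(1-3)
proof (induction F rule: finite_ne_induct)
  case (singleton a)
  then show ?case by auto
next
  case (insert x F)
  then obtain m where m: "m \<in> \<Omega>" "m \<in> F \<or> (\<exists>a\<in>F. \<exists>b\<in>F. bt m a b)" "m = p \<or> (\<forall>x\<in>F-{m}. bt m p x)"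
    by auto
  have x: "x \<in> \<Omega>" "F \<subseteq> \<Omega>" using insert.prems by auto
  show ?case
  proof (cases "m = p \<or> m = x \<or> bt m p x")
    case True
    then show ?thesis using m by (intro bexI[of _ m]) auto
  next
    case False
    then have F: "\<forall>c\<in>F-{m}. bt m p c" "m \<noteq> p" "m \<noteq> x" "\<not> bt m p x" using m by auto
    \<comment> \<open>If the old gate \<open>m\<close> does not cut \<open>x\<close> off from
      \<open>p\<close>, the new gate is the median of \<open>p\<close>, \<open>x\<close> and
      \<open>m\<close>. It is \<open>p\<close> or lies between \<open>p\<close> and
      \<open>m\<close>, so it still shields \<open>F\<close>; the point \<open>c\<close> found below
      puts it into the enlarged hull.\<close>
    obtain n where n: "n \<in> \<Omega>" "med n p x m" using median \<open>p \<in> \<Omega>\<close> x m by blast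
    have "n \<noteq> m"
      using n F x \<open>p \<in> \<Omega>\<close> m unfolding med_def wbt_def by blast
    have nx: "n = x \<or> n = p \<or> bt n p x" and nm: "n = x \<or> bt n x m" and np: "n = p \<or> bt n p m"
      using n \<open>n \<noteq> m\<close> by (auto simp: med_def wbt_def)
    have sx: "c \<in> F \<Longrightarrow> c \<noteq> m \<Longrightarrow> bt m x c" for c
      using F x bt_split[of m p c x] by blast
    have "\<exists>c\<in>F. c = m \<or> bt m x c"

    proof (cases "m \<in> F")
      case False
      then obtain a where "a \<in> F" "a \<noteq> m" using m(2) bt_dom by blast
      then show ?thesis using sx by blast
    qed blast
    then obtain c where c: "c \<in> F" "c = m \<or> bt m x c" by blast
    have gate1: "n = x \<or> bt n x c"
      using nm c bt_chain(1)[of m c x n] bt_sym by blast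
    have gate2: "n = p \<or> bt n p d" if "d \<in> F" for d
      using np that F bt_chain(1)[of m d p n] bt_sym by blast
    show ?thesis
      using n gate1 gate2 c nx by (intro bexI[of _ n]) auto
  qed
qed

end

text \<open>These are the needs of back-and-forth: \<open>dense\<close> provides points of every
  colour in intervals, \<open>directions\<close> makes room for new leaves at image points, and
  \<open>median_branch\<close> ensures that centres of tripods can be added to a partial
  isomorphism. The colour stands for the order of a branch point.\<close>

locale colored_pretree = pretree +
  fixes B :: "'a set" and col :: "'a \<Rightarrow> 'a \<Rightarrow> bool"
  assumes B_sub: "B \<subseteq> \<Omega>" and B_countable: "countable B"
    and col_refl: "x \<in> B \<Longrightarrow> col x x" and col_sym: "col x y \<Longrightarrow> col y x"
    and dense: "b \<in> B \<Longrightarrow> x \<in> \<Omega> \<Longrightarrow> y \<in> \<Omega> \<Longrightarrow> x \<noteq> y \<Longrightarrow> \<exists>p\<in>B. col b p \<and> bt p x y"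
    and median: "x \<in> \<Omega> \<Longrightarrow> y \<in> \<Omega> \<Longrightarrow> z \<in> \<Omega> \<Longrightarrow> \<exists>m\<in>\<Omega>. med m x y z"
    and median_branch: "bt m x y \<Longrightarrow> bt m y z \<Longrightarrow> bt m x z \<Longrightarrow> m \<in> B"
    and directions: "a \<in> B \<Longrightarrow> a' \<in> B \<Longrightarrow> col a a' \<Longrightarrow>
      (\<lambda>x. {y. J a x y}) ` (\<Omega> - {a}) \<approx> (\<lambda>x. {y. J a' x y}) ` (\<Omega> - {a'})"
begin

text \<open>
  The domain of a partial isomorphism has to be closed under medians: the colour of a median is not
  determined by the colours and the betweenness relation of the three points.
\<close>

definition piso :: "('a \<times> 'a) set \<Rightarrow> bool" where
  "piso P \<longleftrightarrow> finite P \<and> (\<forall>x x'. (x,x') \<in> P \<longrightarrow> x \<in> B \<and> x' \<in> B \<and> col x x') \<and>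
     (\<forall>x x' y y'. (x,x') \<in> P \<longrightarrow> (y,y') \<in> P \<longrightarrow> (x = y \<longleftrightarrow> x' = y')) \<and>
     (\<forall>x x' y y' z z'. (x,x') \<in> P \<longrightarrow> (y,y') \<in> P \<longrightarrow> (z,z') \<in> P \<longrightarrow>
        (bt x y z \<longleftrightarrow> bt x' y' z') \<and> (\<exists>m\<in>Domain P. med m x y z))"

lemma pisoD:
  assumes "piso P"
  shows "finite P" "(x,x') \<in> P \<Longrightarrow> x \<in> B" "(x,x') \<in> P \<Longrightarrow> x' \<in> B" "(x,x') \<in> P \<Longrightarrow> col x x'"
    "(x,x') \<in> P \<Longrightarrow> (y,y') \<in> P \<Longrightarrow> x = y \<longleftrightarrow> x' = y'"
    "(x,x') \<in> P \<Longrightarrow> (y,y') \<in> P \<Longrightarrow> (z,z') \<in> P \<Longrightarrow> bt x y z \<longleftrightarrow> bt x' y' z'"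
    "x \<in> Domain P \<Longrightarrow> y \<in> Domain P \<Longrightarrow> z \<in> Domain P \<Longrightarrow> \<exists>m\<in>Domain P. med m x y z"
  using assms unfolding piso_def by (simp_all, blast)

lemma pisoI:
  assumes "finite P" "\<And>x x'. (x,x') \<in> P \<Longrightarrow> x \<in> B \<and> x' \<in> B \<and> col x x'"
    "\<And>x x' y y'. (x,x') \<in> P \<Longrightarrow> (y,y') \<in> P \<Longrightarrow> x = y \<longleftrightarrow> x' = y'"
    "\<And>x x' y y' z z'. (x,x') \<in> P \<Longrightarrow> (y,y') \<in> P \<Longrightarrow> (z,z') \<in> P \<Longrightarrow> bt x y z \<longleftrightarrow> bt x' y' z'"
    "\<And>x x' y y' z z'. (x,x') \<in> P \<Longrightarrow> (y,y') \<in> P \<Longrightarrow> (z,z') \<in> P \<Longrightarrow> \<exists>m\<in>Domain P. med m x y z"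
  shows "piso P"
  unfolding piso_def using assms(1,2) by (intro conjI allI impI) (simp_all add: assms(3,4,5))

lemma piso_wbt:
  assumes "piso P" "(x,x') \<in> P" "(y,y') \<in> P" "(z,z') \<in> P"
  shows "wbt x y z \<longleftrightarrow> wbt x' y' z'"
  unfolding wbt_def using pisoD(5)[OF assms(1,2,3)] pisoD(5)[OF assms(1,2,4)] pisoD(6)[OF assms]
    by blast

text \<open>The range is closed under medians because medians are characterised by betweenness,
  which is preserved.\<close>

lemma piso_converse:
  assumes "piso P" shows "piso (P\<inverse>)"
proof (rule pisoI)
  show "finite (P\<inverse>)" using pisoD(1)[OF assms] by simp
next
  fix x x' y y' z z' assume "(x,x') \<in> P\<inverse>" "(y,y') \<in> P\<inverse>" "(z,z') \<in> P\<inverse>"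
  then have *: "(x',x) \<in> P" "(y',y) \<in> P" "(z',z) \<in> P" by auto
  obtain m where m: "m \<in> Domain P" "med m x' y' z'" using pisoD(7)[OF assms] * by blast
  then obtain m' where "(m,m') \<in> P" by blast
  then have "med m' x y z" using m piso_wbt[OF assms] * unfolding med_def by blast
  then show "\<exists>m\<in>Domain (P\<inverse>). med m x y z" using \<open>(m,m') \<in> P\<close> by blast
next
  fix x x' y y' assume "(x,x') \<in> P\<inverse>" "(y,y') \<in> P\<inverse>"
  then have *: "(x',x) \<in> P" "(y',y) \<in> P" by auto
  show "x = y \<longleftrightarrow> x' = y'" using pisoD(5)[OF assms *] by simp
  fix z z' assume "(z,z') \<in> P\<inverse>"
  then show "bt x y z \<longleftrightarrow> bt x' y' z'" using pisoD(6)[OF assms *, of z' z] by simp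
qed (use pisoD(2-4)[OF assms] col_sym in auto)

text \<open>Only triples containing the new point once matter, in the middle (\<open>1\<close>) or
  at an end (\<open>2\<close>); a triple that repeats it has it as median. Closure under medians is
  checked on the domain and passes to the range by \<open>piso_converse\<close>.\<close>

lemma piso_insert:
  assumes P: "piso P" and p: "p \<in> B" "p' \<in> B" "col p p'" "p \<notin> Domain P" "p' \<notin> Range P"
    and 1: "\<And>x x' y y'. (x,x') \<in> P \<Longrightarrow> (y,y') \<in> P \<Longrightarrow> bt p x y \<longleftrightarrow> bt p' x' y'"
    and 2: "\<And>x x' y y'. (x,x') \<in> P \<Longrightarrow> (y,y') \<in> P \<Longrightarrow> bt x p y \<longleftrightarrow> bt x' p' y'"
    and 3: "\<And>x y. x \<in> Domain P \<Longrightarrow> y \<in> Domain P \<Longrightarrow> \<exists>m\<in>insert p (Domain P). med m p x y"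
  shows "piso (insert (p,p') P)"
proof (rule pisoI)
  show "finite (insert (p,p') P)" using pisoD(1)[OF P] by simp
  fix x x' y y' z z' assume *: "(x,x') \<in> insert (p,p') P" "(y,y') \<in> insert (p,p') P"
  show "x = y \<longleftrightarrow> x' = y'" using * p(4,5) pisoD(5)[OF P, of x x' y y'] by auto
  assume **: "(z,z') \<in> insert (p,p') P"
  have n: "\<not> bt u u v" "\<not> bt u v u" "\<not> bt u v v" for u v using bt_dom by blast+
  show "bt x y z \<longleftrightarrow> bt x' y' z'"
    using * ** 1[of y y' z z'] 2[of x x' z z'] 2[of x x' y y'] pisoD(6)[OF P, of x x' y y' z z'] n
      bt_sym by auto
  have D: "Domain (insert (p,p') P) = insert p (Domain P)" by auto
  have t: "med p p p u" "med p p u p" "med p u p p" for u by (auto simp: med_def wbt_def)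
  show "\<exists>m\<in>Domain (insert (p,p') P). med m x y z"
  proof (cases "x = p \<and> y = p \<or> x = p \<and> z = p \<or> y = p \<and> z = p")
    case True
    then have "med p x y z" using t by auto
    then show ?thesis using D by blast
  next
    case False
    consider "x \<in> Domain P \<and> y \<in> Domain P \<and> z \<in> Domain P" | "x = p \<and> y \<in> Domain P \<and> z \<in> Domain P"
      | "y = p \<and> x \<in> Domain P \<and> z \<in> Domain P" | "z = p \<and> x \<in> Domain P \<and> y \<in> Domain P"
      using False * ** by auto
    then show ?thesis
    proof cases
      case 1 then show ?thesis unfolding D using pisoD(7)[OF P] by blast
    next
      case 2 then show ?thesis unfolding D using 3 by blast
    next
      case 3 then show ?thesis unfolding D using assms(9)[of x z] med_perm by blast
    next
      case 4 then show ?thesis unfolding D using assms(9)[of x y] med_perm by blast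
    qed
  qed
qed (use p pisoD(2-4)[OF P] in auto)

text \<open>A leaf inherits everything from its point of attachment. If \<open>a\<close> is the
  median of \<open>a\<close>, \<open>x\<close>, \<open>y\<close>, it is also that of
  \<open>p\<close>, \<open>x\<close>, \<open>y\<close>; otherwise \<open>bt_leaf_replace\<close>
  lets \<open>p\<close> take the place of \<open>a\<close>.\<close>

lemma piso_insert_leaf:
  assumes P: "piso P" and p: "p \<in> B" "p' \<in> B" "col p p'" "p \<noteq> a" "p' \<noteq> a'"
    and a: "(a,a') \<in> P"
    and s: "\<And>x x'. (x,x') \<in> P \<Longrightarrow> x \<noteq> a \<Longrightarrow> bt a p x \<and> bt a' p' x'"
  shows "piso (insert (p,p') P)"
proof (rule piso_insert[OF P p(1-3)])
  have s': "x = a \<or> bt a p x" if "x \<in> Domain P" for x using s that by blast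
  show "p \<notin> Domain P" using s' p bt_dom by blast
  show "p' \<notin> Range P"
  proof
    assume "p' \<in> Range P"
    then obtain x where "(x,p') \<in> P" by blast
    then show False using s[of x p'] pisoD(5)[OF P a, of x p'] p bt_dom by blast
  qed
  fix x y assume x: "x \<in> Domain P" "y \<in> Domain P"
  obtain m where m: "m \<in> Domain P" "med m a x y" using pisoD(7)[OF P] x a by blast
  have "med m p x y"
  proof (cases "m = a")
    case True
    then show ?thesis using m s'[OF x(1)] s'[OF x(2)] by (auto simp: med_def wbt_def)
  next
    case False
    then have "bt a p m" using s'[OF m(1)] by blast
    then show ?thesis using m False bt_leaf_replace[of a p m] by (auto simp: med_def wbt_def)
  qed
  then show "\<exists>m\<in>insert p (Domain P). med m p x y" using m by blast
next
  fix x x' y y' assume xy: "(x,x') \<in> P" "(y,y') \<in> P"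
  have eq: "x = a \<longleftrightarrow> x' = a'" "y = a \<longleftrightarrow> y' = a'" using pisoD(5)[OF P] a xy by blast+
  then show "bt p x y \<longleftrightarrow> bt p' x' y'"
    using bt_leaf[of x a p y] bt_leaf[of x' a' p' y'] s xy p by blast
  show "bt x p y \<longleftrightarrow> bt x' p' y'"
  proof (cases "x = a")
    case True
    then show ?thesis using eq s xy bt_dom by metis
  next
    case False
    then have "bt x p y \<longleftrightarrow> bt x a y" "bt x' p' y' \<longleftrightarrow> bt x' a' y'"
      using bt_leaf_replace s[OF xy(1)] by blast+
    then show ?thesis using pisoD(6)[OF P] a xy by blast
  qed
qed

end

section \<open>The two sides of a point inside an interval\<close>

context pretree begin

text \<open>The condition \<open>x = a \<or> bt a x b\<close> says that \<open>x\<close> lies behind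
  \<open>a\<close> as seen from \<open>b\<close>. A point \<open>p\<close> inside the interval does
  not separate such points from each other, but cuts all of them off from \<open>b\<close>.\<close>

lemma beyond_same_side:
  assumes "bt p a b" "x = a \<or> bt a x b" "y = a \<or> bt a y b"
  shows "\<not> bt p x y" "bt p x b"
proof -
  have *: "bt p z b \<and> (z \<noteq> a \<longrightarrow> \<not> bt p z a)" if "z = a \<or> bt a z b" for z
    using that assms(1) bt_chain[of a z b p] bt_asym bt_sym by blast
  show "bt p x b" using *[OF assms(2)] by blast
  show "\<not> bt p x y"
  proof
    assume "bt p x y"
    then have "bt p x a \<or> bt p a y" using bt_split[of p x y a] assms(1) bt_dom by blast
    moreover have "\<not> bt p x a" using *[OF assms(2)] bt_dom[of p x a] by blast
    moreover have "\<not> bt p a y" using *[OF assms(3)] bt_dom[of p a y] bt_sym[of p a y] by blast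
    ultimately show False by blast
  qed
qed

lemma beyond_other_side:
  assumes "bt p a b" "x = a \<or> bt a x b" "y = b \<or> bt b y a"
  shows "bt p x y"
proof -
  have x: "bt p x b" "bt p y a"
    using beyond_same_side(2)[OF assms(1,2,2)] beyond_same_side(2)[OF bt_sym[OF assms(1)]
      assms(3,3)] by blast+
  show ?thesis
  proof (cases "x = a")
    case True then show ?thesis using x bt_sym by blast
  next
    case False
    then have "bt a x b" using assms by blast
    then have "\<not> bt p x a" using assms(1) bt_chain[of a x b p] bt_asym bt_sym by blast
    then show ?thesis using bt_split[of p a y x] x bt_sym bt_dom by blast
  qed
qed

lemma bt_iff_sides_differ:
  assumes "bt p a b" "x = a \<or> bt a x b \<or> x = b \<or> bt b x a" "y = a \<or> bt a y b \<or> y = b \<or> bt b y a"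
  shows "bt p x y \<longleftrightarrow> (x = a \<or> bt a x b) \<noteq> (y = a \<or> bt a y b)"
  using beyond_same_side(1)[OF assms(1), of x y] beyond_other_side[OF assms(1), of x y]
    beyond_same_side(1)[OF bt_sym[OF assms(1)], of x y] beyond_other_side[OF assms(1), of y x]
    assms(2,3) bt_sym[of p y x]
  by blast

text \<open>As \<open>p\<close> lies between \<open>x\<close> and \<open>b\<close>, both are in one
  direction as seen from \<open>x\<close>.\<close>

lemma beyond_replace:
  assumes "bt p a b" "x = a \<or> bt a x b"
  shows "bt x p y \<longleftrightarrow> bt x b y"
proof -
  have "bt p x b" using beyond_same_side(2)[OF assms assms(2)] .
  then have "\<not> bt x p b" "x \<noteq> p" "x \<noteq> b" "b \<in> \<Omega>" "p \<in> \<Omega>" using bt_asym bt_dom by blast+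
  then show ?thesis using bt_split[of x p y b] bt_split[of x b y p] bt_sym by blast
qed

end

context colored_pretree begin

text \<open>Take a pair around \<open>p\<close> with the fewest points of the domain in between. By
  \<open>bt_split\<close> any such point would form, with one of the two, a pair around
  \<open>p\<close> with fewer points in between.\<close>

lemma adjacent_pair:
  assumes P: "piso P" and p: "bt p a b" "a \<in> Domain P" "b \<in> Domain P" "p \<notin> Domain P"
  obtains c d where "c \<in> Domain P" "d \<in> Domain P" "bt p c d" "\<And>x. x \<in> Domain P \<Longrightarrow> \<not> bt x c d"
proof -
  define \<mu> where "\<mu> = (\<lambda>(c,d). card {x \<in> Domain P. bt x c d})"
  define Q where "Q = (\<lambda>(c,d). c \<in> Domain P \<and> d \<in> Domain P \<and> bt p c d)"
  have "Q (a,b)" using p by (simp add: Q_def)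
  then obtain cd where cd: "Q cd" "\<And>cd'. Q cd' \<Longrightarrow> \<mu> cd \<le> \<mu> cd'"
    using ex_has_least_nat[of Q "(a,b)" \<mu>] by blast
  obtain c d where [simp]: "cd = (c,d)" by (cases cd)
  have c: "c \<in> Domain P" "d \<in> Domain P" "bt p c d" using cd(1) by (auto simp: Q_def)
  have fin: "finite (Domain P)" using pisoD(1)[OF P] by (rule finite_Domain)
  have "\<not> bt x c d" if x: "x \<in> Domain P" for x
  proof
    assume b: "bt x c d"
    have "x \<noteq> p" using x p by blast
    then have "bt p c x \<or> bt p x d" using bt_split[OF c(3), of x] b bt_dom by blast
    then show False
    proof
      assume *: "bt p c x"
      then have "\<mu> (c,d) \<le> \<mu> (c,x)" using cd(2)[of "(c,x)"] c x by (auto simp: Q_def)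
      moreover have "{y \<in> Domain P. bt y c x} \<subset> {y \<in> Domain P. bt y c d}"
        using bt_chain(1)[of x d c] bt_sym b x bt_dom by blast
      ultimately show False using psubset_card_mono[of "{y \<in> Domain P. bt y c d}"
        "{y \<in> Domain P. bt y c x}"] fin by (simp add: \<mu>_def)
    next
      assume *: "bt p x d"
      then have "\<mu> (c,d) \<le> \<mu> (x,d)" using cd(2)[of "(x,d)"] c x by (auto simp: Q_def)
      moreover have "{y \<in> Domain P. bt y x d} \<subset> {y \<in> Domain P. bt y c d}"
        using bt_chain(1)[of x c d] b x bt_dom by blast
      ultimately show False using psubset_card_mono[of "{y \<in> Domain P. bt y c d}"
        "{y \<in> Domain P. bt y x d}"] fin by (simp add: \<mu>_def)
    qed
  qed
  then show thesis using that c by blast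
qed

text \<open>For an adjacent pair \<open>a\<close>, \<open>b\<close> around \<open>p\<close>, the
  betweenness of \<open>p\<close> with points of the domain depends only on the side on which these
  lie. Hence any \<open>p'\<close> of the right colour between \<open>a'\<close> and
  \<open>b'\<close> will do.\<close>

lemma piso_insert_interval:
  assumes P: "piso P" and p: "p \<in> B" "p \<notin> Domain P"
    and ab: "a0 \<in> Domain P" "b0 \<in> Domain P" "bt p a0 b0"
  obtains p' where "p' \<in> B" "piso (insert (p,p') P)"
proof -
  obtain a b where ab: "a \<in> Domain P" "b \<in> Domain P" "bt p a b"
    and adj: "\<And>x. x \<in> Domain P \<Longrightarrow> \<not> bt x a b"
    using adjacent_pair[OF P ab(3,1,2) p(2)] by metis
  obtain a' b' where a': "(a,a') \<in> P" "(b,b') \<in> P" using ab by blast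
  have "a' \<noteq> b'" using pisoD(5)[OF P a'] bt_dom ab by blast
  then obtain p' where p': "p' \<in> B" "col p p'" "bt p' a' b'"
    using dense[OF p(1), of a' b'] pisoD(3)[OF P] a' B_sub by blast
  \<comment> \<open>The median of \<open>x\<close>, \<open>a\<close>, \<open>b\<close> is in the
    domain, and adjacency forces it to be \<open>a\<close> or \<open>b\<close>.\<close>
  have side: "x = a \<or> bt a x b \<or> x = b \<or> bt b x a" if x: "x \<in> Domain P" for x
  proof -
    obtain m where "m \<in> Domain P" "med m x a b" using pisoD(7)[OF P x ab(1,2)] by blast
    then show ?thesis using adj bt_sym bt_dom[OF ab(3)] by (auto simp: med_def wbt_def)
  qed
  have transfer: "(x = a \<or> bt a x b) \<longleftrightarrow> (x' = a' \<or> bt a' x' b')"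
    "(x = b \<or> bt b x a) \<longleftrightarrow> (x' = b' \<or> bt b' x' a')"
    if "(x,x') \<in> P" for x x'
    using pisoD(5)[OF P that a'(1)] pisoD(5)[OF P that a'(2)] pisoD(6)[OF P a'(1) that a'(2)]
      pisoD(6)[OF P a'(2) that a'(1)] by blast+
  note ba = bt_sym[OF ab(3)] bt_sym[OF p'(3)]
  have "piso (insert (p,p') P)"
  proof (rule piso_insert[OF P p(1) p'(1,2) p(2)])
    show "p' \<notin> Range P"
    proof
      assume "p' \<in> Range P"
      then obtain x where "(x,p') \<in> P" by blast
      then show False using adj pisoD(6)[OF P _ a', of x p'] p'(3) by blast
    qed
  next
    fix x x' y y' assume xy: "(x,x') \<in> P" "(y,y') \<in> P"
    have sx: "x = a \<or> bt a x b \<or> x = b \<or> bt b x a" "y = a \<or> bt a y b \<or> y = b \<or> bt b y a"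
      using side xy by blast+
    note t = transfer[OF xy(1)] transfer[OF xy(2)]
    show "bt p x y \<longleftrightarrow> bt p' x' y'"
    proof -
      have "x' = a' \<or> bt a' x' b' \<or> x' = b' \<or> bt b' x' a'"
        "y' = a' \<or> bt a' y' b' \<or> y' = b' \<or> bt b' y' a'"
        using sx t by blast+
      then show ?thesis using bt_iff_sides_differ[OF ab(3) sx] bt_iff_sides_differ[OF p'(3)] t
        by simp
    qed
    show "bt x p y \<longleftrightarrow> bt x' p' y'"
    proof (cases "x = a \<or> bt a x b")
      case True
      then have T': "x' = a' \<or> bt a' x' b'" using t by blast
      show ?thesis
        using beyond_replace[OF ab(3) True] beyond_replace[OF p'(3) T'] pisoD(6)[OF P xy(1) a'(2)
          xy(2)] by blast
    next
      case False
      then have F: "x = b \<or> bt b x a" using sx by blast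
      then have F': "x' = b' \<or> bt b' x' a'" using t by blast
      show ?thesis
        using beyond_replace[OF ba(1) F] beyond_replace[OF ba(2) F'] pisoD(6)[OF P xy(1) a'(1)
          xy(2)] by blast
    qed
  next
    \<comment> \<open>The median of two points behind \<open>a\<close> with the far end
      \<open>b\<close> is again behind \<open>a\<close>, and \<open>p\<close> can replace
      \<open>b\<close> in it. Arbitrary \<open>a\<close> and \<open>b\<close> are allowed so that
      the claim also covers the other side.\<close>
    have same: "\<exists>m\<in>insert p (Domain P). med m p x y"
      if ab: "a \<in> Domain P" "b \<in> Domain P" "bt p a b" and adj: "\<And>x. x \<in> Domain P \<Longrightarrow> \<not> bt x a b"
        and side: "\<And>x. x \<in> Domain P \<Longrightarrow> x = a \<or> bt a x b \<or> x = b \<or> bt b x a"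
        and x: "x \<in> Domain P" "y \<in> Domain P" "x = a \<or> bt a x b" "y = a \<or> bt a y b" for x y a b
    proof -
      obtain m where m: "m \<in> Domain P" "med m x y b" using pisoD(7)[OF P x(1,2) ab(2)] by blast
      have "\<not> bt b z a \<and> z \<noteq> b" if "z = a \<or> bt a z b" for z
        using that bt_asym[of b a z] bt_sym[of b z a] bt_sym[of a z b] bt_dom[of a z b] bt_dom[of b
          z a] bt_dom[OF ab(3)] by blast
      then have nb: "\<not> bt b x a" "\<not> bt b y a" "x \<noteq> b" "y \<noteq> b" using x(3,4) by blast+
      have "m \<noteq> b"
      proof
        assume "m = b"
        then have "bt b x y" using m nb by (auto simp: med_def wbt_def)
        then have "bt b x a \<or> bt b a y" using bt_split ab(3) bt_dom by blast
        then show False using nb bt_sym by blast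
      qed
      moreover have "\<not> bt b m a"
      proof
        assume bm: "bt b m a"
        have "m \<noteq> x" using bm nb by blast
        then have "bt m x b" using m \<open>m \<noteq> b\<close> by (auto simp: med_def wbt_def)
        then have "bt b x a" using bt_concat(2)[of m x b a] bm by blast
        then show False using nb by blast
      qed
      ultimately have mm: "m = a \<or> bt a m b" using side[OF m(1)] by blast
      have "wbt m p x" "wbt m p y"
        using beyond_replace[OF ab(3) mm] m \<open>m \<noteq> b\<close> bt_sym by (auto simp: med_def wbt_def)
      then have "med m p x y" using m by (auto simp: med_def)
      then show ?thesis using m by blast
    qed
    fix x y assume xy: "x \<in> Domain P" "y \<in> Domain P"
    consider "x = a \<or> bt a x b" "y = a \<or> bt a y b" | "x = b \<or> bt b x a" "y = b \<or> bt b y a"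
      | "x = a \<or> bt a x b" "y = b \<or> bt b y a" | "y = a \<or> bt a y b" "x = b \<or> bt b x a"
      using side[OF xy(1)] side[OF xy(2)] by blast
    then show "\<exists>m\<in>insert p (Domain P). med m p x y"
    proof cases
      case 1 then show ?thesis using same[OF ab adj side xy] by blast
    next
      case 2
      have "\<not> bt x b a" if "x \<in> Domain P" for x using adj[OF that] bt_sym by blast
      moreover have "x = b \<or> bt b x a \<or> x = a \<or> bt a x b" if "x \<in> Domain P" for x
        using side[OF that] by blast
      ultimately show ?thesis using same[OF ab(2,1) ba(1) _ _ xy 2] by blast
    next
      case 3
      then have "bt p x y" using beyond_other_side[OF ab(3)] by blast
      then show ?thesis by (auto simp: med_def wbt_def)
    next
      case 4
      then have "bt p x y" using beyond_other_side[OF ab(3), of y x] bt_sym by blast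
      then show ?thesis by (auto simp: med_def wbt_def)
    qed
  qed
  then show thesis using that p' by blast
qed

text \<open>The direction of \<open>p\<close> at \<open>a\<close> contains no point of
  \<open>F\<close>, so \<open>F\<close> does not fill all directions at \<open>a\<close>; and
  \<open>g\<close>, which preserves \<open>bt a\<close>, induces a map from the directions filled at
  \<open>a\<close> onto those filled at \<open>a'\<close>. Were the latter all directions at
  \<open>a'\<close>, their number would be finite, equal to that at \<open>a\<close>, and yet
  smaller.\<close>

lemma fresh_direction:
  assumes a: "a \<in> B" "a' \<in> B" "col a a'" and F: "finite F" "F \<subseteq> \<Omega> - {a}" "g ` F \<subseteq> \<Omega> - {a'}"
    and g: "\<And>x y. x \<in> F \<Longrightarrow> y \<in> F \<Longrightarrow> bt a x y \<longleftrightarrow> bt a' (g x) (g y)"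
    and p: "p \<in> \<Omega> - {a}" "\<And>x. x \<in> F \<Longrightarrow> bt a p x"
  shows "\<exists>c\<in>\<Omega>-{a'}. \<forall>x\<in>F. bt a' c (g x)"
proof (rule ccontr)
  assume no: "\<not> ?thesis"
  define D where "D = (\<lambda>a x. {y. J a x y})"
  have eqD: "D a x = D a y \<longleftrightarrow> \<not> bt a x y" if "x \<in> \<Omega> - {a}" "y \<in> \<Omega> - {a}" "a \<in> \<Omega>" for a x y
    using that J_refl J_sym J_trans unfolding D_def bt_def by blast
  have aO: "a \<in> \<Omega>" "a' \<in> \<Omega>" using a B_sub by auto
  have "D a' ` (\<Omega> - {a'}) \<subseteq> D a' ` g ` F"
  proof
    fix d assume "d \<in> D a' ` (\<Omega> - {a'})"
    then obtain c where c: "c \<in> \<Omega> - {a'}" "d = D a' c" by blast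
    then obtain x where "x \<in> F" "\<not> bt a' c (g x)" using no by blast
    then have "D a' c = D a' (g x)" using eqD[of c a' "g x"] c F aO by blast
    then show "d \<in> D a' ` g ` F" using c \<open>x \<in> F\<close> by blast
  qed
  moreover have "D a' ` g ` F \<subseteq> D a' ` (\<Omega> - {a'})" using F by blast
  ultimately have e1: "D a' ` (\<Omega> - {a'}) = D a' ` g ` F" by blast
  define h where "h = (\<lambda>d. D a' (g (inv_into F (D a) d)))"
  have h: "h (D a x) = D a' (g x)" if "x \<in> F" for x
  proof -
    define z where "z = inv_into F (D a) (D a x)"
    have z: "z \<in> F" "D a z = D a x" using that by (auto simp: z_def inv_into_into f_inv_into_f)
    then have "\<not> bt a' (g z) (g x)" using eqD[of z a x] F that aO g by blast
    then have "D a' (g z) = D a' (g x)" using eqD[of "g z" a' "g x"] F z that aO by blast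
    then show ?thesis by (simp add: h_def z_def)
  qed
  have "D a' ` g ` F = h ` D a ` F" using h by (auto simp: image_image)
  then have le: "card (D a' ` g ` F) \<le> card (D a ` F)" using F by (simp add: card_image_le)
  have eqp: "D a ` (\<Omega> - {a}) \<approx> D a' ` (\<Omega> - {a'})" using directions[OF a] unfolding D_def .
  have fin': "finite (D a' ` (\<Omega> - {a'}))" using e1 F by simp
  then have fin: "finite (D a ` (\<Omega> - {a}))" using eqp eqpoll_finite_iff by blast
  have "card (D a ` (\<Omega> - {a})) = card (D a' ` (\<Omega> - {a'}))"
    using eqp fin fin' by (simp add: eqpoll_iff_card)
  moreover have "D a p \<notin> D a ` F"
    using eqD[OF p(1)] p(2) F aO by blast
  then have "D a ` F \<subset> D a ` (\<Omega> - {a})" using p F by blast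
  then have "card (D a ` F) < card (D a ` (\<Omega> - {a}))" using fin by (rule psubset_card_mono[rotated])
  ultimately show False using le e1 by simp
qed

lemma piso_extend_leaf:
  assumes P: "piso P" and p: "p \<in> B" "(a,a') \<in> P" "p \<noteq> a"
    and s: "\<And>x. x \<in> Domain P \<Longrightarrow> x \<noteq> a \<Longrightarrow> bt a p x"
  obtains p' where "piso (insert (p,p') P)"
proof -
  have "\<forall>x\<in>Domain P. \<exists>x'. (x,x') \<in> P" by blast
  then obtain g where g: "\<And>x. x \<in> Domain P \<Longrightarrow> (x, g x) \<in> P" by metis
  have gx: "g x = x'" if "(x,x') \<in> P" for x x' using g[of x] pisoD(5)[OF P that, of x "g x"] that
    by blast
  define F where "F = Domain P - {a}"
  have "\<exists>c\<in>\<Omega>-{a'}. \<forall>x\<in>F. bt a' c (g x)"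
  proof (rule fresh_direction)
    show "a \<in> B" "a' \<in> B" "col a a'" using pisoD(2-4)[OF P] p by blast+
    show "finite F" using pisoD(1)[OF P] by (simp add: F_def finite_Domain)
    show "F \<subseteq> \<Omega> - {a}" using pisoD(2)[OF P] B_sub by (auto simp: F_def)
    show "g ` F \<subseteq> \<Omega> - {a'}" using pisoD(3)[OF P g] pisoD(5)[OF P g p(2)] B_sub by (auto simp: F_def)
    show "bt a x y \<longleftrightarrow> bt a' (g x) (g y)" if "x \<in> F" "y \<in> F" for x y
      using pisoD(6)[OF P p(2) g g] that by (auto simp: F_def)
    show "p \<in> \<Omega> - {a}" using p B_sub by blast
    show "bt a p x" if "x \<in> F" for x using that s by (auto simp: F_def)
  qed
  then obtain c where c: "c \<in> \<Omega>" "c \<noteq> a'" "\<And>x. x \<in> F \<Longrightarrow> bt a' c (g x)" by blast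
  have a': "a' \<in> \<Omega>" using pisoD(3)[OF P p(2)] B_sub by blast
  \<comment> \<open>The point \<open>c\<close> only marks a free direction at \<open>a'\<close>;
    density provides a point of the right colour in it.\<close>
  obtain p' where p': "p' \<in> B" "col p p'" "bt p' a' c" using dense[OF p(1) a' c(1)] c(2) by blast
  have "piso (insert (p,p') P)"
  proof (rule piso_insert_leaf[OF P p(1) p'(1,2) p(3) _ p(2)])
    show "p' \<noteq> a'" using p' bt_dom by blast
    fix x x' assume x: "(x,x') \<in> P" "x \<noteq> a"
    then have "bt a' c x'" using c(3)[of x] gx[OF x(1)] by (auto simp: F_def)
    then have "bt a' p' x'" using p'(3) bt_asym bt_sym bt_split bt_dom by metis
    then show "bt a p x \<and> bt a' p' x'" using s x by blast
  qed
  then show thesis by (rule that)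
qed

text \<open>Let \<open>m\<close> be the gate from \<open>p\<close> to the hull of the domain. If
  \<open>m\<close> is in the domain, \<open>p\<close> is a leaf at \<open>m\<close>; if
  \<open>m = p\<close>, it lies in an interval. Otherwise \<open>m\<close> is the centre of a tripod
  formed by \<open>p\<close> and two points of the domain, hence in \<open>B\<close>, and must be
  added before \<open>p\<close> to keep the domain closed under medians.\<close>

lemma piso_extend:
  assumes P: "piso P" "P \<noteq> {}" and p: "p \<in> B"
  obtains Q where "piso Q" "P \<subseteq> Q" "p \<in> Domain Q"
proof (cases "p \<in> Domain P")
  case True
  then show ?thesis using that P by blast
next
  case False
  have "finite (Domain P)" "Domain P \<noteq> {}" "Domain P \<subseteq> \<Omega>" "p \<in> \<Omega>"
    using pisoD(1,2)[OF P(1)] P(2) B_sub p by (auto simp: finite_Domain)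
  from gate_exists[OF this median]
  obtain m where m: "m \<in> \<Omega>" "m \<in> Domain P \<or> (\<exists>a\<in>Domain P. \<exists>b\<in>Domain P. bt m a b)"
    "m = p \<or> (\<forall>x\<in>Domain P-{m}. bt m p x)" by blast
  show ?thesis
  proof (cases "m \<in> Domain P")
    case True
    then have "m \<noteq> p" using False by blast
    obtain m' where m': "(m,m') \<in> P" using True by blast
    obtain p' where "piso (insert (p,p') P)"
      using piso_extend_leaf[OF P(1) p m'] \<open>m \<noteq> p\<close> m(3) by blast
    then show ?thesis using that[of "insert (p,p') P"] by blast
  next
    case mP: False
    then obtain a b where ab: "a \<in> Domain P" "b \<in> Domain P" "bt m a b" using m(2) by blast
    show ?thesis
    proof (cases "m = p")
      case True
      then obtain p' where "piso (insert (p,p') P)"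
        using piso_insert_interval[OF P(1) p False ab(1,2)] ab(3) by blast
      then show ?thesis using that[of "insert (p,p') P"] by blast
    next
      case neq: False
      then have s: "\<And>x. x \<in> Domain P \<Longrightarrow> bt m p x" using m(3) mP by blast
      then have "m \<in> B" using median_branch[of m p a b] ab by blast
      then obtain m' where m': "piso (insert (m,m') P)"
        using piso_insert_interval[OF P(1) _ mP ab] by blast
      obtain p' where "piso (insert (p,p') (insert (m,m') P))"
        using piso_extend_leaf[OF m' p, of m m'] neq s by blast
      then show ?thesis using that[of "insert (p,p') (insert (m,m') P)"] by blast
    qed
  qed
qed

definition bt_auto :: "('a \<Rightarrow> 'a) \<Rightarrow> bool" where
  "bt_auto f \<longleftrightarrow> bij_betw f B B \<and> (\<forall>x\<in>B. \<forall>y\<in>B. \<forall>z\<in>B. bt x y z \<longleftrightarrow> bt (f x) (f y) (f z))"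

theorem back_and_forth:
  assumes P: "piso P" "P \<noteq> {}"
  obtains f where "bt_auto f" "\<And>x x'. (x,x') \<in> P \<Longrightarrow> f x = x'"
proof -
  have "B \<noteq> {}" using P pisoD(2)[OF P(1)] by auto
  define b where "b = from_nat_into B"
  have b: "b n \<in> B" for n using from_nat_into[OF \<open>B \<noteq> {}\<close>] by (simp add: b_def)
  have surj: "\<exists>n. b n = x" if "x \<in> B" for x using from_nat_into_surj[OF B_countable that]
    by (simp add: b_def)
  have "\<exists>Q. \<forall>n. (piso (Q n) \<and> P \<subseteq> Q n) \<and> (Q n \<subseteq> Q (Suc n) \<and> b n \<in> Domain (Q (Suc n)) \<and>
    b n \<in> Range (Q (Suc n)))"
  proof (rule dependent_nat_choice)
    show "\<exists>Q. piso Q \<and> P \<subseteq> Q" using P by blast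
    fix Q n assume Q: "piso Q \<and> P \<subseteq> Q"
    then have "Q \<noteq> {}" using P by blast
    then obtain Q1 where Q1: "piso Q1" "Q \<subseteq> Q1" "b n \<in> Domain Q1" using piso_extend[OF _ _ b] Q
      by blast
    then have "piso (Q1\<inverse>)" "Q1\<inverse> \<noteq> {}" using piso_converse \<open>Q \<noteq> {}\<close> by auto
    then obtain Q2 where Q2: "piso Q2" "Q1\<inverse> \<subseteq> Q2" "b n \<in> Domain Q2" using piso_extend[OF _ _ b]
      by blast
    show "\<exists>Q'. (piso Q' \<and> P \<subseteq> Q') \<and> Q \<subseteq> Q' \<and> b n \<in> Domain Q' \<and> b n \<in> Range Q'"
      using Q1 Q2 Q piso_converse[OF Q2(1)] by (intro exI[of _ "Q2\<inverse>"]) auto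
  qed
  then obtain Q where Q: "\<And>n. piso (Q n)" "\<And>n. P \<subseteq> Q n" "\<And>n. Q n \<subseteq> Q (Suc n)"
    "\<And>n. b n \<in> Domain (Q (Suc n))" "\<And>n. b n \<in> Range (Q (Suc n))" by blast
  have mono: "Q m \<subseteq> Q n" if "m \<le> n" for m n using lift_Suc_mono_le[of Q] Q(3) that by blast
  define R where "R = (\<Union>n. Q n)"
  have com: "\<exists>n. {(x,x'),(y,y'),(z,z')} \<subseteq> Q n"
    if "(x,x') \<in> R" "(y,y') \<in> R" "(z,z') \<in> R" for x x' y y' z z'
  proof -
    obtain i j k where "(x,x') \<in> Q i" "(y,y') \<in> Q j" "(z,z') \<in> Q k"
      using \<open>(x,x') \<in> R\<close> \<open>(y,y') \<in> R\<close> \<open>(z,z') \<in> R\<close> unfolding R_def by blast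
    then show ?thesis using mono[of i "i+j+k"] mono[of j "i+j+k"] mono[of k "i+j+k"]
      by (intro exI[of _ "i+j+k"]) auto
  qed
  have R1: "x = y \<longleftrightarrow> x' = y'" if xy: "(x,x') \<in> R" "(y,y') \<in> R" for x x' y y'
  proof -
    obtain n where "(x,x') \<in> Q n" "(y,y') \<in> Q n" using com[OF xy xy(2)] by blast
    then show ?thesis by (rule pisoD(5)[OF Q(1)])
  qed
  have R2: "bt x y z \<longleftrightarrow> bt x' y' z'" if xyz: "(x,x') \<in> R" "(y,y') \<in> R" "(z,z') \<in> R"
    for x x' y y' z z'
  proof -
    obtain n where "(x,x') \<in> Q n" "(y,y') \<in> Q n" "(z,z') \<in> Q n" using com[OF xyz] by blast
    then show ?thesis by (rule pisoD(6)[OF Q(1)])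
  qed
  have R3: "x \<in> B" "x' \<in> B" if "(x,x') \<in> R" for x x'
    using that pisoD(2,3)[OF Q(1)] unfolding R_def by blast+
  have R4: "\<exists>x'. (x,x') \<in> R" "\<exists>x'. (x',x) \<in> R" if "x \<in> B" for x
    using surj[OF that] Q(4,5) unfolding R_def by blast+
  define f where "f = (\<lambda>x. SOME x'. (x,x') \<in> R)"
  have f: "(x, f x) \<in> R" if "x \<in> B" for x using someI_ex[OF R4(1)[OF that]] by (simp add: f_def)
  have "bij_betw f B B"
    unfolding bij_betw_def
  proof (intro conjI inj_onI equalityI subsetI)
    fix x y assume "x \<in> B" "y \<in> B" "f x = f y"
    then show "x = y" using R1[OF f f] by blast
  next
    fix x assume "x \<in> f ` B" then show "x \<in> B" using R3(2)[OF f] by blast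
  next
    fix y assume y: "y \<in> B"
    then obtain x where "(x,y) \<in> R" using R4 by blast
    then have "x \<in> B" "f x = y" using R3 R1 f by blast+
    then show "y \<in> f ` B" by blast
  qed
  then have "bt_auto f" using R2[OF f f f] by (auto simp: bt_auto_def)
  moreover have "f x = x'" if "(x,x') \<in> P" for x x'
  proof -
    have "(x,x') \<in> R" using that Q(2) unfolding R_def by blast
    then show ?thesis using R1 f R3 by blast
  qed
  ultimately show thesis by (rule that)
qed

text \<open>Each point of the chain is a leaf at its predecessor, so the partial isomorphism grows
  from \<open>b\<close> alone; only the orders of the moved points have to match.\<close>

theorem chain_homogeneous:
  assumes B: "b \<in> B" "q \<in> B" "p \<in> B" "u \<in> B" "p' \<in> B" "u' \<in> B" "col p p'" "col u u'"
    and c: "bt q b p" "bt p q u" "bt q b p'" "bt p' q u'"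
  obtains f where "bt_auto f" "f b = b" "f q = q" "f p = p'" "f u = u'"
proof -
  have c': "bt p b u" "bt p' b u'" using bt_concat c by blast+
  have 1: "piso {(b,b)}"
    using B col_refl bt_dom by (intro pisoI) (auto simp: med_def wbt_def)
  have 2: "piso (insert (q,q) {(b,b)})"
    using B c bt_dom col_refl by (intro piso_insert_leaf[OF 1, where a=b and a'=b]) auto
  have 3: "piso (insert (p,p') (insert (q,q) {(b,b)}))"
    using B c bt_dom bt_sym by (intro piso_insert_leaf[OF 2, where a=q and a'=q]) auto
  have 4: "piso (insert (u,u') (insert (p,p') (insert (q,q) {(b,b)})))"
    using B c c' bt_dom bt_sym by (intro piso_insert_leaf[OF 3, where a=p and a'=p']) auto
  show thesis
    by (rule back_and_forth[OF 4]) (use that in auto)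
qed

end

subsection \<open>Homeomorphisms of Wazewski dendrites\<close>

abbreviation homeo :: "'a topology \<Rightarrow> ('a \<Rightarrow> 'a) \<Rightarrow> bool" where
  "homeo X \<equiv> homeomorphic_map X X"

locale wdendrite =
  fixes S :: "enat set" and X :: "'a topology"
  assumes S: "S \<noteq> {}" "S \<subseteq> {3..}" and wd: "wazewski_dendrite S X"
begin

abbreviation "\<Omega> \<equiv> topspace X"
abbreviation "J \<equiv> joined X"

definition B :: "'a set" where "B = {x. branch_point X x}"
definition col :: "'a \<Rightarrow> 'a \<Rightarrow> bool" where
  "col x y \<longleftrightarrow> point_complement_components X x \<approx> point_complement_components X y"

lemma dendX: "dendrite X" using wd by (simp add: wazewski_dendrite_def)

lemma X_props: "locally_connected_space X" "connected_space X" "compact_space X"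
  "metrizable_space X" "Hausdorff_space X"
  using dendX metrizable_imp_Hausdorff_space by (auto simp: dendrite_def)

lemma J_open: "openin X {y. J p x y}"
proof (cases "p \<in> \<Omega> \<and> x \<in> \<Omega> - {p}")
  case True
  have "openin X (\<Omega> - {p})" using X_props(5) True
    by (simp add: openin_diff Hausdorff_imp_t1_space closedin_t1_singleton)
  then have "openin X (connected_component_of_set (subtopology X (\<Omega> - {p})) x)"
    using X_props(1) True unfolding locally_connected_space_eq_open_connected_component_of by blast
  then show ?thesis using True by (simp add: joined_def)
next
  case False
  then have "{y. J p x y} = {}"
    using connected_component_in_topspace[of "subtopology X (\<Omega> - {p})" x] by (auto simp: joined_def)
  then show ?thesis by simp
qed

lemma joined_domain: "J p x y \<Longrightarrow> p \<in> \<Omega> \<and> x \<in> \<Omega> \<and> y \<in> \<Omega> \<and> x \<noteq> p \<and> y \<noteq> p"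
  unfolding joined_def using connected_component_in_topspace[of "subtopology X (\<Omega> - {p})" x y]
    by auto

lemma J_connectedI:
  assumes "connectedin X C" "p \<notin> C" "x \<in> C" "y \<in> C" "p \<in> \<Omega>" shows "J p x y"
proof -
  have "C \<subseteq> \<Omega> - {p}" using connectedin_subset_topspace[OF assms(1)] assms by blast
  then show ?thesis unfolding joined_def connected_component_of_def using assms
    by (auto simp: connectedin_subtopology)
qed

lemma J_equiv:
  "p \<in> \<Omega> \<Longrightarrow> x \<in> \<Omega> \<Longrightarrow> x \<noteq> p \<Longrightarrow> J p x x" "J p x y \<Longrightarrow> J p y x" "J p x y \<Longrightarrow> J p y z \<Longrightarrow> J p x z"
  unfolding joined_def
  by (simp add: connected_component_of_refl, meson connected_component_of_sym, meson
    connected_component_of_trans)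

text \<open>The component \<open>C\<close> of \<open>x\<close> in the complement of \<open>p\<close>
  is open; the space being connected, \<open>C\<close> is not closed, and its closure can only add
  \<open>p\<close>. So \<open>C\<close> together with \<open>p\<close> is connected, and it misses
  \<open>q\<close>.\<close>

lemma joined_swap:
  assumes "p \<in> \<Omega>" "q \<in> \<Omega>" "x \<in> \<Omega>" "p \<noteq> q" "x \<noteq> p" "\<not> J p x q"
  shows "J q x p"
proof -
  define C where "C = {y. J p x y}"
  have C: "openin X C" "x \<in> C" "q \<notin> C" "p \<notin> C"
    using J_open J_equiv(1) assms by (auto simp: C_def dest: joined_domain)
  have CC: "C = connected_component_of_set (subtopology X (\<Omega> - {p})) x"
    using assms by (simp add: C_def joined_def)
  have con: "connectedin X C"
    unfolding CC using connectedin_connected_component_of[of "subtopology X (\<Omega> - {p})" x]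
      by (simp add: connectedin_subtopology)
  have "closedin (subtopology X (\<Omega> - {p})) C" unfolding CC by (rule closedin_connected_component_of)
  then have "(\<Omega> - {p}) \<inter> X closure_of C = C" by (simp add: closedin_Int_closure_of)
  then have cl: "X closure_of C \<subseteq> insert p C" using closure_of_subset_topspace[of X C] by blast
  have "p \<in> X closure_of C"
  proof (rule ccontr)
    assume "p \<notin> X closure_of C"
    then have "X closure_of C \<subseteq> C" using cl by blast
    then have "closedin X C" using closure_of_subset_eq C openin_subset by metis
    then have "C = {} \<or> C = \<Omega>" using X_props(2) C(1) connected_space_clopen_in by blast
    then show False using C assms by blast
  qed
  then have "connectedin X (insert p C)"
    using connectedin_intermediate_closure_of[OF con, of "insert p C"] closure_of_subset[of C X] C
      openin_subset by blast
  then show ?thesis by (rule J_connectedI) (use C assms in auto)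
qed

sublocale pretree \<Omega> J
proof
  show "J p x y \<Longrightarrow> p \<in> \<Omega> \<and> x \<in> \<Omega> \<and> y \<in> \<Omega> \<and> x \<noteq> p \<and> y \<noteq> p" for p x y by (rule joined_domain)
qed (rule J_equiv joined_swap; assumption)+

lemma bt_open: "openin X {x. bt q b x}"
proof (cases "q \<in> \<Omega> \<and> b \<in> \<Omega> \<and> b \<noteq> q")
  case True
  have "{x. bt q b x} = \<Union>((\<lambda>z. {y. J q z y}) ` {z. bt q b z})"
  proof (intro equalityI subsetI)
    fix x assume "x \<in> {x. bt q b x}"
    then show "x \<in> \<Union>((\<lambda>z. {y. J q z y}) ` {z. bt q b z})" using J_equiv(1) bt_dom by blast
  next
    fix x assume "x \<in> \<Union>((\<lambda>z. {y. J q z y}) ` {z. bt q b z})"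
    then obtain z where z: "bt q b z" "J q z x" by blast
    then have "\<not> J q b x" using J_equiv(2,3) unfolding bt_def by blast
    then show "x \<in> {x. bt q b x}" using joined_domain[OF z(2)] True by (auto simp: bt_def)
  qed
  moreover have "openin X (\<Union>((\<lambda>z. {y. J q z y}) ` {z. bt q b z}))" using J_open
    by (auto intro!: openin_Union)
  ultimately show ?thesis by simp
next
  case False
  then have "{x. bt q b x} = {}" using bt_dom by blast
  then show ?thesis by simp
qed

lemma order_branch:
  assumes "has_order X p n" "n \<in> S" shows "p \<in> B"
proof -
  have "3 \<le> n" using assms(2) S(2) by auto
  then have "{..<3::nat} \<subseteq> {i. enat i < n}"
    by (auto intro!: order.strict_trans2[of _ 3 n] simp: numeral_eq_enat)
  then have "{..<3::nat} \<lesssim> {i. enat i < n}" by (rule subset_imp_lepoll)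
  then have "{..<3::nat} \<lesssim> point_complement_components X p"
    using assms(1) eqpoll_sym lepoll_trans2 unfolding has_order_def by metis
  then show ?thesis using assms(1) by (simp add: B_def branch_point_def has_order_def)
qed

lemma branch_order: "b \<in> B \<Longrightarrow> \<exists>n\<in>S. has_order X b n"
  using wd by (simp add: B_def wazewski_dendrite_def)

lemma components_J: "a \<in> \<Omega> \<Longrightarrow> point_complement_components X a = (\<lambda>x. {y. J a x y}) ` (\<Omega> - {a})"
  by (auto simp: connected_components_of_def joined_def)

lemma branch_triple:
  assumes "b \<in> B"
  obtains x y z where "bt b x y" "bt b y z" "bt b x z"
proof -
  have b: "b \<in> \<Omega>" "{..<3::nat} \<lesssim> point_complement_components X b" using assms
    by (auto simp: B_def branch_point_def)
  then obtain f where f: "inj_on f {..<3::nat}" "f ` {..<3} \<subseteq> (\<lambda>x. {y. J b x y}) ` (\<Omega> - {b})"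
    unfolding components_J[OF b(1)] lepoll_def by blast
  then have "\<forall>i\<in>{..<3}. \<exists>x\<in>\<Omega> - {b}. f i = {y. J b x y}" by blast
  then obtain g where g: "\<And>i. i < 3 \<Longrightarrow> g i \<in> \<Omega> - {b} \<and> f i = {y. J b (g i) y}"
    by (metis lessThan_iff)
  have "bt b (g i) (g j)" if "i < 3" "j < 3" "i \<noteq> j" for i j :: nat
  proof -
    have "f i \<noteq> f j" using inj_onD[OF f(1)] that by blast
    then have "\<not> J b (g i) (g j)" using g[OF that(1)] g[OF that(2)] J_equiv by blast
    then show ?thesis using g that b(1) by (auto simp: bt_def)
  qed
  then show thesis using that[of "g 0" "g 1" "g 2"] by auto
qed

lemma triple_branch:
  assumes "bt m x y" "bt m y z" "bt m x z" shows "m \<in> B"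
proof -
  define f where "f = (\<lambda>i::nat. {w. J m (if i = 0 then x else if i = 1 then y else z) w})"
  have m: "m \<in> \<Omega>" using assms bt_dom by blast
  have d: "x \<in> \<Omega> - {m}" "y \<in> \<Omega> - {m}" "z \<in> \<Omega> - {m}" using assms bt_dom by blast+
  have eq: "{w. J m u w} = {w. J m v w} \<Longrightarrow> v \<in> \<Omega> - {m} \<Longrightarrow> \<not> bt m u v" for u v
    using J_equiv(1)[OF m] unfolding bt_def by blast
  have "inj_on f {..<3}"
    using eq assms d bt_sym unfolding inj_on_def f_def by (auto simp: numeral_3_eq_3 less_Suc_eq)
  moreover have "f ` {..<3} \<subseteq> point_complement_components X m"
    unfolding components_J[OF m] using d by (auto simp: f_def)
  ultimately show ?thesis unfolding B_def branch_point_def lepoll_def using m by blast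
qed

text \<open>A branch point is the centre of a tripod with ends in a countable dense set, and the
  ends determine it: if \<open>b\<close> and \<open>c\<close> shared them, \<open>b\<close> would
  cut two of the ends off from \<open>c\<close>, and then \<open>c\<close> could not separate these
  two.\<close>

lemma countable_B: "countable B"
proof -
  obtain M d where Md: "Metric_space M d" "X = Metric_space.mtopology M d"
    using X_props(4) unfolding metrizable_space_def by blast
  interpret Metric_space M d by (rule Md)
  obtain C where C: "countable C" "C \<subseteq> M" "\<And>x \<epsilon>. x \<in> M \<Longrightarrow> 0 < \<epsilon> \<Longrightarrow> \<exists>c\<in>C. d x c < \<epsilon>"
    using compact_space_countable_dense X_props(3) Md by metis
  have dense: "\<exists>c\<in>C. J b x c" if "b \<in> \<Omega>" "x \<in> \<Omega>" "x \<noteq> b" for b x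
  proof -
    have "openin mtopology {y. J b x y}" using J_open[of b x] by (simp add: Md(2)[symmetric])
    moreover have "x \<in> {y. J b x y}" using J_equiv(1) that by simp
    ultimately obtain r where "r > 0" "mball x r \<subseteq> {y. J b x y}" unfolding openin_mtopology by blast
    moreover have "x \<in> M" using that Md(2) by simp
    ultimately show ?thesis using C(2) C(3)[of x r] by (fastforce simp: in_mball)
  qed
  have "\<exists>t \<in> C \<times> C \<times> C. bt b (fst t) (fst (snd t)) \<and> bt b (fst (snd t)) (snd (snd t)) \<and>
    bt b (fst t) (snd (snd t))"
    if b: "b \<in> B" for b
  proof -
    obtain x y z where xyz: "bt b x y" "bt b y z" "bt b x z" using branch_triple[OF b] .
    then have "b \<in> \<Omega>" "x \<in> \<Omega>" "y \<in> \<Omega>" "z \<in> \<Omega>" "x \<noteq> b" "y \<noteq> b" "z \<noteq> b" using bt_dom by blast+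
    then obtain x' y' z' where c: "x' \<in> C" "J b x x'" "y' \<in> C" "J b y y'" "z' \<in> C" "J b z z'"
      using dense by meson
    have "bt b u' v'" if "bt b u v" "J b u u'" "J b v v'" for u v u' v'
    proof -
      have "J b u' v' \<Longrightarrow> J b u v" using that(2,3) J_equiv(2,3) by meson
      then show ?thesis using that joined_domain[OF that(2)] joined_domain[OF that(3)]
        by (auto simp: bt_def)
    qed
    then have "bt b x' y'" "bt b y' z'" "bt b x' z'" using xyz c by blast+
    then show ?thesis using c by (intro bexI[of _ "(x',y',z')"]) auto
  qed
  then obtain t where t: "\<And>b. b \<in> B \<Longrightarrow> t b \<in> C \<times> C \<times> C"
    "\<And>b. b \<in> B \<Longrightarrow> bt b (fst (t b)) (fst (snd (t b))) \<and> bt b (fst (snd (t b))) (snd (snd (t b))) \<and>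
      bt b (fst (t b)) (snd (snd (t b)))"
    by metis
  have "inj_on t B"
  proof (rule inj_onI, rule ccontr)
    fix b c assume bc: "b \<in> B" "c \<in> B" "t b = t c" "b \<noteq> c"
    obtain x y z where x: "bt b x y" "bt b y z" "bt b x z" "bt c x y" "bt c y z" "bt c x z"
      using t(2)[OF bc(1)] t(2)[OF bc(2)] bc(3) by metis
    have two: False if "bt b u c" "bt b v c" "bt c u v" for u v
      using that bt_asym bt_sym bt_split[of c u v b] bt_dom by blast
    have "bt b x c \<or> bt b c y" "bt b y c \<or> bt b c z" "bt b x c \<or> bt b c z"
      using bt_split[OF x(1), of c] bt_split[OF x(2), of c] bt_split[OF x(3), of c] x bt_dom bc(4)
        by blast+
    then show False using two bt_sym x by blast
  qed
  moreover have "countable (t ` B)" using t(1) C(1)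
    by (intro countable_subset[of "t ` B" "C \<times> C \<times> C"] image_subsetI) auto
  ultimately show ?thesis using countable_image_inj_on by blast
qed

sublocale colored_pretree \<Omega> J B col
proof unfold_locales
  show "B \<subseteq> \<Omega>" by (auto simp: B_def branch_point_def)
  show "countable B" by (rule countable_B)
  show "col x x" for x by (simp add: col_def)
  show "col x y \<Longrightarrow> col y x" for x y by (simp add: col_def eqpoll_sym)
next
  fix b x y assume *: "b \<in> B" "x \<in> \<Omega>" "y \<in> \<Omega>" "x \<noteq> y"
  obtain n where n: "n \<in> S" "has_order X b n" using branch_order * by blast
  obtain p where p: "p \<in> \<Omega>" "has_order X p n" "p \<noteq> x" "p \<noteq> y" "\<not> J p x y"
    using wazewski_dendrite_separating_point[OF wd n(1) *(2-4)] by blast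
  have "col b p" using n(2) p(2) eqpoll_sym eqpoll_trans unfolding col_def has_order_def by metis
  then show "\<exists>p\<in>B. col b p \<and> bt p x y" using p n order_branch * by (auto simp: bt_def)
next
  fix x y z assume *: "x \<in> \<Omega>" "y \<in> \<Omega>" "z \<in> \<Omega>"
  obtain m where m: "m \<in> \<Omega>" "(m = x \<or> m = y \<or> \<not> J m x y)" "(m = y \<or> m = z \<or> \<not> J m y z)"
    "(m = x \<or> m = z \<or> \<not> J m x z)"
    using dendrite_median[OF dendX *] by blast
  then have "med m x y z" using * by (auto simp: med_def wbt_def bt_def)
  then show "\<exists>m\<in>\<Omega>. med m x y z" using m by blast
next
  show "bt m x y \<Longrightarrow> bt m y z \<Longrightarrow> bt m x z \<Longrightarrow> m \<in> B" for m x y z by (rule triple_branch)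
  show "a \<in> B \<Longrightarrow> a' \<in> B \<Longrightarrow> col a a' \<Longrightarrow>
    (\<lambda>x. {y. J a x y}) ` (\<Omega> - {a}) \<approx> (\<lambda>x. {y. J a' x y}) ` (\<Omega> - {a'})" for a a'
    using components_J[of a] components_J[of a'] by (auto simp: B_def branch_point_def col_def)
qed

lemma B_nonempty: "B \<noteq> {}" "\<exists>x y. x \<in> \<Omega> \<and> y \<in> \<Omega> \<and> x \<noteq> y"
proof -
  obtain n where n: "n \<in> S" using S by blast
  have "\<not> \<Omega> \<subseteq> {a}" for a using wd unfolding wazewski_dendrite_def by blast
  then show *: "\<exists>x y. x \<in> \<Omega> \<and> y \<in> \<Omega> \<and> x \<noteq> y" by blast
  then obtain p where "has_order X p n" using wazewski_dendrite_separating_point[OF wd n] by blast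
  then show "B \<noteq> {}" using order_branch n by blast
qed

lemma branch_separates: "x \<in> \<Omega> \<Longrightarrow> y \<in> \<Omega> \<Longrightarrow> x \<noteq> y \<Longrightarrow> \<exists>p\<in>B. bt p x y"
  using dense B_nonempty by blast

text \<open>Half-trees at branch points form a subbasis: every point outside \<open>U\<close> is
  separated from \<open>x\<close> by a branch point, and compactness leaves finitely many of
  these.\<close>

lemma nbhd_finite:
  assumes U: "openin X U" "x \<in> U"
  obtains F where "finite F" "F \<subseteq> B" "x \<notin> F" "\<And>y. y \<in> \<Omega> \<Longrightarrow> (\<And>p. p \<in> F \<Longrightarrow> J p x y) \<Longrightarrow> y \<in> U"
proof -
  have x: "x \<in> \<Omega>" using U openin_subset by blast
  have "compactin X (\<Omega> - U)" using X_props(3) U closedin_compact_space by blast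
  have "\<forall>y\<in>\<Omega> - U. \<exists>p\<in>B. bt p x y" using branch_separates x U by blast
  then obtain P where P: "\<And>y. y \<in> \<Omega> - U \<Longrightarrow> P y \<in> B" "\<And>y. y \<in> \<Omega> - U \<Longrightarrow> bt (P y) x y" by metis
  define \<C> where "\<C> = (\<lambda>y. {z. J (P y) y z}) ` (\<Omega> - U)"
  have "\<And>C. C \<in> \<C> \<Longrightarrow> openin X C" using J_open by (auto simp: \<C>_def)
  moreover have "\<Omega> - U \<subseteq> \<Union>\<C>"
    using P(2) bt_dom J_equiv(1) unfolding \<C>_def by blast
  ultimately obtain \<F> where \<F>: "finite \<F>" "\<F> \<subseteq> \<C>" "\<Omega> - U \<subseteq> \<Union>\<F>"
    using \<open>compactin X (\<Omega> - U)\<close> unfolding compactin_def by meson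
  obtain Y where Y: "finite Y" "Y \<subseteq> \<Omega> - U" "\<F> = (\<lambda>y. {z. J (P y) y z}) ` Y"
    using finite_subset_image[OF \<F>(1) \<F>(2)[unfolded \<C>_def]] by blast
  show thesis
  proof
    show "finite (P ` Y)" "P ` Y \<subseteq> B" using Y P(1) by auto
    show "x \<notin> P ` Y" using Y P(2) bt_dom by blast
    fix y assume y: "y \<in> \<Omega>" "\<And>p. p \<in> P ` Y \<Longrightarrow> J p x y"
    show "y \<in> U"
    proof (rule ccontr)
      assume "y \<notin> U"
      then obtain w where w: "w \<in> Y" "J (P w) w y" using \<F>(3) Y y by blast
      then have "J (P w) x w" using y(2) J_equiv(2,3) by blast
      then show False using P(2)[of w] w Y by (auto simp: bt_def)
    qed
  qed
qed

text \<open>A connected neighbourhood of \<open>x\<close> has a second point, and a branch point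
  separating the two cannot lie outside it.\<close>

lemma B_dense:
  assumes U: "openin X U" "x \<in> U" obtains b where "b \<in> B" "b \<in> U"
proof -
  obtain V where V: "openin X V" "connectedin X V" "x \<in> V" "V \<subseteq> U"
    using X_props(1) U unfolding locally_connected_space by meson
  have x: "x \<in> \<Omega>" using V openin_subset by blast
  have "V \<noteq> {x}"
  proof
    assume "V = {x}"
    moreover have "closedin X {x}" using x X_props(5)
      by (simp add: Hausdorff_imp_t1_space closedin_t1_singleton)
    ultimately have "\<Omega> = {x}" using V X_props(2) connected_space_clopen_in
      by (metis insert_not_empty)
    then show False using B_nonempty(2) by auto
  qed
  then obtain y where y: "y \<in> V" "y \<noteq> x" using V by blast
  then obtain p where p: "p \<in> B" "bt p x y" using branch_separates[of x y] x V openin_subset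
    by blast
  have "p \<in> V"
  proof (rule ccontr)
    assume "p \<notin> V"
    then have "J p x y" using J_connectedI[OF V(2)] V y p bt_dom by blast
    then show False using p by (simp add: bt_def)
  qed
  then show thesis using that p V by blast
qed

end

section \<open>Extending automorphisms of the branch points to homeomorphisms\<close>

context wdendrite begin

text \<open>
  A point is determined by the half-trees at branch points that contain it, so \<open>ext_rel f\<close> is the
  graph of the homeomorphism induced by \<open>f\<close>.
\<close>

definition ext_rel :: "('a \<Rightarrow> 'a) \<Rightarrow> 'a \<Rightarrow> 'a \<Rightarrow> bool" where
  "ext_rel f x y \<longleftrightarrow> x \<in> \<Omega> \<and> y \<in> \<Omega> \<and> (\<forall>p\<in>B. \<forall>q\<in>B. J p x q \<longrightarrow> J (f p) y (f q))"

lemma B_topspace: "x \<in> B \<Longrightarrow> x \<in> \<Omega>" using B_sub by blast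

lemma J_iff_not_bt: "p \<in> \<Omega> \<Longrightarrow> x \<in> \<Omega> \<Longrightarrow> y \<in> \<Omega> \<Longrightarrow> x \<noteq> p \<Longrightarrow> y \<noteq> p \<Longrightarrow> J p x y \<longleftrightarrow> \<not> bt p x y"
  by (auto simp: bt_def)

lemma branch_in_direction:
  assumes "p \<in> \<Omega>" "x \<in> \<Omega>" "x \<noteq> p" obtains q where "q \<in> B" "J p x q"
  using B_dense[OF J_open, of x p x] J_equiv(1)[OF assms] by blast

lemma bt_autoD:
  assumes "bt_auto f"
  shows "x \<in> B \<Longrightarrow> f x \<in> B" "x \<in> B \<Longrightarrow> y \<in> B \<Longrightarrow> f x = f y \<longleftrightarrow> x = y" "y \<in> B \<Longrightarrow> \<exists>x\<in>B. f x = y"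
    "p \<in> B \<Longrightarrow> x \<in> B \<Longrightarrow> y \<in> B \<Longrightarrow> J p x y \<longleftrightarrow> J (f p) (f x) (f y)"
proof -
  have bij: "bij_betw f B B"
    and b: "\<And>x y z. x \<in> B \<Longrightarrow> y \<in> B \<Longrightarrow> z \<in> B \<Longrightarrow> bt x y z \<longleftrightarrow> bt (f x) (f y) (f z)"
    using assms by (auto simp: bt_auto_def)
  show 1: "f x \<in> B" if "x \<in> B" for x using bij that by (auto simp: bij_betw_def)
  show 2: "f x = f y \<longleftrightarrow> x = y" if "x \<in> B" "y \<in> B" for x y using bij that
    by (auto simp: bij_betw_def inj_on_def)
  show "\<exists>x\<in>B. f x = y" if "y \<in> B" by (metis bij bij_betw_def imageE that)
  show "J p x y \<longleftrightarrow> J (f p) (f x) (f y)" if p: "p \<in> B" "x \<in> B" "y \<in> B"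
  proof (cases "x = p \<or> y = p")
    case True
    then show ?thesis using joined_domain by blast
  next
    case False
    then show ?thesis using J_iff_not_bt B_topspace p 1 2 b by simp
  qed
qed

lemma ext_rel_branch: "bt_auto f \<Longrightarrow> x \<in> B \<Longrightarrow> ext_rel f x (f x)"
  unfolding ext_rel_def using bt_autoD[of f] B_topspace by blast

lemma ext_rel_unique:
  assumes f: "bt_auto f" and r: "ext_rel f x y" "ext_rel f x y'"
  shows "y = y'"
proof (rule ccontr)
  assume "y \<noteq> y'"
  have O: "x \<in> \<Omega>" "y \<in> \<Omega>" "y' \<in> \<Omega>" using r by (auto simp: ext_rel_def)
  obtain p1 where p1: "p1 \<in> B" "bt p1 y y'" using branch_separates O \<open>y \<noteq> y'\<close> by blast
  \<comment> \<open>A second separating point is needed because the preimage of the first may be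
    \<open>x\<close> itself, and half-trees at \<open>x\<close> do not constrain the image of
    \<open>x\<close>.\<close>
  obtain p2 where p2: "p2 \<in> B" "bt p2 y p1" using branch_separates[of y p1] O p1 bt_dom by blast
  have "bt p2 y y'" "p1 \<noteq> p2" using bt_chain(1)[of p1 y' y p2] p1 p2 bt_sym bt_dom by blast+
  obtain q1 q2 where q: "q1 \<in> B" "f q1 = p1" "q2 \<in> B" "f q2 = p2" using bt_autoD(3)[OF f] p1 p2
    by meson
  then obtain p where p: "p \<in> B" "p \<noteq> x" "bt (f p) y y'"
    using \<open>p1 \<noteq> p2\<close> \<open>bt p2 y y'\<close> p1 by blast
  obtain q where q: "q \<in> B" "J p x q" using branch_in_direction[of p x] B_topspace p O by blast
  then have "J (f p) y (f q)" "J (f p) y' (f q)" using r p unfolding ext_rel_def by blast+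
  then have "J (f p) y y'" using J_equiv(2,3) by blast
  then show False using p by (simp add: bt_def)
qed

text \<open>The image is sought in the closed half-trees \<open>C (p,q)\<close>. Finitely many
  half-trees around \<open>x\<close> contain a common branch point \<open>w\<close>, and
  \<open>f w\<close> lies in the corresponding sets, so compactness applies.\<close>

lemma ext_rel_exists:
  assumes f: "bt_auto f" and x: "x \<in> \<Omega>"
  shows "\<exists>y. ext_rel f x y"
proof -
  define A where "A = {(p,q). p \<in> B \<and> q \<in> B \<and> J p x q}"
  define C where "C = (\<lambda>(p,q). insert (f p) {y. J (f p) y (f q)})"
  have closed: "closedin X (C pq)" if pq: "pq \<in> A" for pq
  proof -
    obtain p q where [simp]: "pq = (p,q)" by (cases pq)
    have p: "p \<in> B" "q \<in> B" "J p x q" using pq by (auto simp: A_def)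
    then have fp: "f p \<in> \<Omega>" "f q \<in> \<Omega>" "f p \<noteq> f q" using bt_autoD(1,2)[OF f] B_topspace joined_domain
      by blast+
    have "C pq = \<Omega> - {y. bt (f p) (f q) y}"
      using fp J_equiv(2)[of "f p"] by (auto simp: C_def bt_def dest: joined_domain)
    then show ?thesis using closedin_diff[OF closedin_topspace bt_open] by simp
  qed
  have fip: "\<exists>y\<in>\<Omega>. \<forall>pq\<in>A'. y \<in> C pq" if A': "finite A'" "A' \<subseteq> A" for A'
  proof -
    have "openin X (\<Omega> \<inter> (\<Inter>pq\<in>A'. {y. J (fst pq) x y}))"
      by (subst Int_commute, rule openin_INT[OF A'(1)]) (rule J_open)
    moreover have "x \<in> \<Omega> \<inter> (\<Inter>pq\<in>A'. {y. J (fst pq) x y})"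
      using x A' joined_domain J_equiv(1) unfolding A_def by fastforce
    ultimately obtain w where w: "w \<in> B" "w \<in> \<Omega> \<inter> (\<Inter>pq\<in>A'. {y. J (fst pq) x y})" by (rule B_dense)
    have "f w \<in> C pq" if pq: "pq \<in> A'" for pq
    proof -
      obtain p q where [simp]: "pq = (p,q)" by (cases pq)
      have p: "p \<in> B" "q \<in> B" "J p x q" using pq A' by (auto simp: A_def)
      have "J p x w" using w pq by auto
      then have "J p w q" using p J_equiv(2,3) by blast
      then have "J (f p) (f w) (f q)" using bt_autoD(4)[OF f] p w by blast
      then show ?thesis by (simp add: C_def)
    qed
    then show ?thesis using bt_autoD(1)[OF f w(1)] B_topspace by blast
  qed
  have "\<exists>y\<in>\<Omega>. \<forall>pq\<in>A. y \<in> C pq"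
  proof -
    have "\<Inter>\<F> \<noteq> {}" if F: "finite \<F>" "\<F> \<subseteq> insert \<Omega> (C ` A)" for \<F>
    proof -
      have "finite (\<F> - {\<Omega>})" "\<F> - {\<Omega>} \<subseteq> C ` A" using F by auto
      from finite_subset_image[OF this]
      obtain A' where A': "finite A'" "A' \<subseteq> A" "\<F> - {\<Omega>} = C ` A'" by blast
      obtain y where "y \<in> \<Omega>" "\<forall>pq\<in>A'. y \<in> C pq" using fip[OF A'(1,2)] by blast
      then have "y \<in> D" if "D \<in> \<F>" for D
        using that A'(3) by (cases "D = \<Omega>") auto
      then show ?thesis by blast
    qed
    moreover have "\<forall>D \<in> insert \<Omega> (C ` A). closedin X D" using closed by auto
    ultimately have "\<Inter>(insert \<Omega> (C ` A)) \<noteq> {}"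
      using compact_space_fip[THEN iffD1, OF X_props(3)] by meson
    then show ?thesis by blast
  qed
  then obtain y where y: "y \<in> \<Omega>" "\<And>p q. p \<in> B \<Longrightarrow> q \<in> B \<Longrightarrow> J p x q \<Longrightarrow> y = f p \<or> J (f p) y (f q)"
    unfolding A_def C_def by blast
  \<comment> \<open>Closing the half-trees added their roots. If \<open>y\<close> were the root
    \<open>f p\<close>, a branch point \<open>p1\<close> between \<open>x\<close> and
    \<open>p\<close> would have both on the same side.\<close>
  have "y \<noteq> f p" if p: "p \<in> B" "q \<in> B" "J p x q" for p q
  proof
    assume e: "y = f p"
    have "x \<noteq> p" using p joined_domain by blast
    then obtain p1 where p1: "p1 \<in> B" "bt p1 x p" using branch_separates x p B_topspace by blast
    then obtain q1 where q1: "q1 \<in> B" "J p1 x q1" using branch_in_direction x bt_dom by metis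
    have "f p \<noteq> f p1" using bt_autoD(2)[OF f] p p1 bt_dom by blast
    then have "J (f p1) (f p) (f q1)" using y(2)[OF p1(1) q1] e by simp
    then have "J p1 p q1" using bt_autoD(4)[OF f] p p1 q1 by blast
    then have "J p1 x p" using q1 J_equiv(2,3) by blast
    then show False using p1 by (simp add: bt_def)
  qed
  then have "ext_rel f x y" using x y unfolding ext_rel_def by blast
  then show ?thesis by blast
qed

text \<open>For the converse, \<open>x\<close> lies in some half-tree at \<open>p\<close>; its image
  contains \<open>y\<close> and must be the given one, as distinct half-trees at \<open>f p\<close>
  are disjoint.\<close>

lemma ext_rel_iff:
  assumes f: "bt_auto f" and r: "ext_rel f x y" and pq: "p \<in> B" "q \<in> B"
  shows "J p x q \<longleftrightarrow> J (f p) y (f q)"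
proof
  show "J p x q \<Longrightarrow> J (f p) y (f q)" using r pq unfolding ext_rel_def by blast
  assume j: "J (f p) y (f q)"
  have "x \<noteq> p"
  proof
    assume "x = p"
    then have "ext_rel f x (f x)" using ext_rel_branch[OF f] pq by blast
    then have "y = f p" using ext_rel_unique[OF f r] \<open>x = p\<close> by blast
    then show False using j joined_domain by blast
  qed
  moreover have "x \<in> \<Omega>" using r by (simp add: ext_rel_def)
  ultimately obtain q1 where q1: "q1 \<in> B" "J p x q1" using branch_in_direction[of p x] B_topspace pq
    by blast
  then have "J (f p) y (f q1)" using r pq unfolding ext_rel_def by blast
  then have "J (f p) (f q) (f q1)" using j J_equiv(2,3) by blast
  then have "J p q q1" using bt_autoD(4)[OF f] pq q1 by blast
  then show "J p x q" using q1 J_equiv(2,3) by blast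
qed

lemma bt_auto_inverse:
  assumes "bt_auto f" "x \<in> B"
  shows "inv_into B f x \<in> B" "f (inv_into B f x) = x" "inv_into B f (f x) = x"
  using assms by (auto simp: bt_auto_def bij_betw_def inv_into_into f_inv_into_f)

lemma bt_auto_inv:
  assumes "bt_auto f" shows "bt_auto (inv_into B f)"
proof -
  have "bij_betw (inv_into B f) B B" using assms by (simp add: bt_auto_def bij_betw_inv_into)
  then show ?thesis using assms bt_auto_inverse[OF assms] by (simp add: bt_auto_def)
qed

lemma ext_rel_inv:
  assumes "bt_auto f"
  shows "ext_rel (inv_into B f) y x \<longleftrightarrow> ext_rel f x y"
proof -
  define g where "g = inv_into B f"
  note g = bt_auto_inverse[OF assms, folded g_def] bt_autoD(1)[OF assms]
  have ga: "bt_auto g" using bt_auto_inv[OF assms] by (simp add: g_def)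
  have "ext_rel g y x" if r: "ext_rel f x y"
    unfolding ext_rel_def
  proof (intro conjI ballI impI)
    fix p q assume "p \<in> B" "q \<in> B" "J p y q"
    then show "J (g p) x (g q)" using ext_rel_iff[OF assms r, of "g p" "g q"] g by simp
  qed (use r in \<open>auto simp: ext_rel_def\<close>)
  moreover have "ext_rel f x y" if r: "ext_rel g y x"
    unfolding ext_rel_def
  proof (intro conjI ballI impI)
    fix p q assume "p \<in> B" "q \<in> B" "J p x q"
    then show "J (f p) y (f q)" using ext_rel_iff[OF ga r, of "f p" "f q"] g by simp
  qed (use r in \<open>auto simp: ext_rel_def\<close>)
  ultimately show ?thesis unfolding g_def by blast
qed

lemma ext_rel_continuous:
  assumes f: "bt_auto f" and F: "\<And>x. x \<in> \<Omega> \<Longrightarrow> ext_rel f x (F x)"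
  shows "continuous_map X X F"
  unfolding continuous_map_eq_topcontinuous_at topcontinuous_at_def
proof (intro ballI conjI allI impI)
  show "F \<in> \<Omega> \<rightarrow> \<Omega>" using F by (auto simp: ext_rel_def)
  fix x V assume x: "x \<in> \<Omega>" "openin X V \<and> F x \<in> V"
  then obtain Q where Q: "finite Q" "Q \<subseteq> B" "F x \<notin> Q"
    "\<And>y. y \<in> \<Omega> \<Longrightarrow> (\<And>p. p \<in> Q \<Longrightarrow> J p (F x) y) \<Longrightarrow> y \<in> V"
    using nbhd_finite by metis
  define g where "g = inv_into B f"
  note g = bt_auto_inverse(1,2)[OF f, folded g_def]
  \<comment> \<open>\<open>g\<close> pulls the finitely many half-trees around \<open>F x\<close>
    back to half-trees at the points \<open>g p\<close>. That \<open>x\<close> differs from these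
    roots follows from uniqueness of the image.\<close>
  define U where "U = \<Omega> \<inter> (\<Inter>p\<in>Q. {y. J (g p) x y})"
  have "openin X U" unfolding U_def
    by (subst Int_commute, rule openin_INT[OF Q(1)]) (rule J_open)
  moreover have "x \<in> U"
  proof -
    have "J (g p) x x" if "p \<in> Q" for p
    proof -
      have "x \<noteq> g p"
      proof
        assume e: "x = g p"
        then have "ext_rel f x (f x)" using ext_rel_branch[OF f] g Q that by blast
        then have "F x = p" using ext_rel_unique[OF f F[OF x(1)]] e g Q that by (metis subsetD)
        then show False using Q that by blast
      qed
      then show ?thesis using J_equiv(1)[of "g p" x] B_topspace g Q x that by blast
    qed
    then show ?thesis using x by (simp add: U_def)
  qed
  moreover have "F y \<in> V" if y: "y \<in> U" for y
  proof (rule Q(4))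
    have yO: "y \<in> \<Omega>" using y by (simp add: U_def)
    then show "F y \<in> \<Omega>" using F by (simp add: ext_rel_def)
    fix p assume p: "p \<in> Q"
    then have pB: "p \<in> B" "g p \<in> B" "J (g p) x y" using Q g y by (auto simp: U_def)
    then obtain q where q: "q \<in> B" "J (g p) x q" using branch_in_direction[of "g p" x] joined_domain
      by metis
    then have "J (g p) y q" using pB J_equiv(2,3) by blast
    then have "J p (F x) (f q)" "J p (F y) (f q)"
      using ext_rel_iff[OF f F[OF x(1)] pB(2) q(1)] ext_rel_iff[OF f F[OF yO] pB(2) q(1)] q g pB
        by auto
    then show "J p (F x) (F y)" using J_equiv(2,3) by blast
  qed
  ultimately show "\<exists>U. openin X U \<and> x \<in> U \<and> (\<forall>y\<in>U. F y \<in> V)" by blast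
qed

theorem bt_auto_extends:
  assumes f: "bt_auto f"
  obtains F where "homeo X F" "\<And>x. x \<in> B \<Longrightarrow> F x = f x"
proof -
  define g where "g = inv_into B f"
  have g: "bt_auto g" using bt_auto_inv[OF f] by (simp add: g_def)
  have "\<exists>y. ext_rel f x y" "\<exists>y. ext_rel g x y" if "x \<in> \<Omega>" for x
    using ext_rel_exists[OF f that] ext_rel_exists[OF g that] by blast+
  then obtain F G where F: "\<And>x. x \<in> \<Omega> \<Longrightarrow> ext_rel f x (F x)" and G: "\<And>x. x \<in> \<Omega> \<Longrightarrow> ext_rel g x (G x)"
    by metis
  have GF: "G (F x) = x" if "x \<in> \<Omega>" for x
  proof -
    have "F x \<in> \<Omega>" using F[OF that] by (simp add: ext_rel_def)
    moreover have "ext_rel g (F x) x" using F[OF that] ext_rel_inv[OF f] by (simp add: g_def)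
    ultimately show ?thesis using ext_rel_unique[OF g] G by blast
  qed
  have FG: "F (G x) = x" if "x \<in> \<Omega>" for x
  proof -
    have "G x \<in> \<Omega>" using G[OF that] by (simp add: ext_rel_def)
    moreover have "ext_rel f (G x) x" using G[OF that] ext_rel_inv[OF f] by (simp add: g_def)
    ultimately show ?thesis using ext_rel_unique[OF f] F by blast
  qed
  have "homeomorphic_maps X X F G"
    unfolding homeomorphic_maps_def
      using ext_rel_continuous[OF f F] ext_rel_continuous[OF g G] GF FG by blast
  then have "homeo X F" using homeomorphic_map_maps by blast
  moreover have "F x = f x" if "x \<in> B" for x
    using ext_rel_unique[OF f F ext_rel_branch[OF f that]] that B_topspace by blast
  ultimately show thesis by (rule that)
qed

theorem chain_homeomorphism:
  assumes "b \<in> B" "q \<in> B" "p \<in> B" "u \<in> B" "p' \<in> B" "u' \<in> B" "col p p'" "col u u'"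
    "bt q b p" "bt p q u" "bt q b p'" "bt p' q u'"
  obtains F where "homeo X F" "F b = b" "F q = q" "F p = p'" "F u = u'"
proof -
  obtain f where f: "bt_auto f" "f b = b" "f q = q" "f p = p'" "f u = u'"
    using chain_homogeneous[OF assms] .
  obtain F where "homeo X F" "\<And>x. x \<in> B \<Longrightarrow> F x = f x" using bt_auto_extends[OF f(1)] by blast
  then show thesis using that[of F] f assms by simp
qed

lemma homeomorphic_map_J:
  assumes h: "homeo X h" and p: "p \<in> \<Omega>" "x \<in> \<Omega>" "y \<in> \<Omega>"
  shows "J (h p) (h x) (h y) \<longleftrightarrow> J p x y"
proof -
  have 1: "J (h p) (h x) (h y)" if h: "homeo X h" and j: "J p x y" for h p x y
  proof -
    obtain C where C: "connectedin X C" "C \<subseteq> \<Omega> - {p}" "x \<in> C" "y \<in> C" "p \<in> \<Omega>"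
      using j unfolding joined_def connected_component_of_def
        by (auto simp: connectedin_subtopology)
    have "connectedin X (h ` C)"
      by (rule connectedin_continuous_map_image[OF homeomorphic_imp_continuous_map[OF h] C(1)])
    moreover have "h p \<in> \<Omega>" using h C(5) homeomorphic_imp_surjective_map by blast
    moreover have "h p \<notin> h ` C" using homeomorphic_imp_injective_map[OF h] C by (auto dest: inj_onD)
    ultimately show ?thesis using J_connectedI C by blast
  qed
  obtain g where g: "homeomorphic_maps X X h g" using h homeomorphic_map_maps by blast
  have "homeo X g" using g homeomorphic_maps_map by blast
  moreover have "g (h z) = z" if "z \<in> \<Omega>" for z using g that by (simp add: homeomorphic_maps_def)
  ultimately show ?thesis using 1[OF h, of p x y] 1[of g "h p" "h x" "h y"] p by auto
qed

lemma homeomorphic_map_B: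
  assumes h: "homeo X h" and p: "p \<in> B"
  shows "h p \<in> B" "col p (h p)"
proof -
  have pO: "p \<in> \<Omega>" "h p \<in> \<Omega>" using p B_topspace homeomorphic_imp_surjective_map[OF h] by blast+
  have "homeomorphic_map (subtopology X (\<Omega> - {p})) (subtopology X (\<Omega> - {h p})) h"
    using homeomorphic_imp_injective_map[OF h] homeomorphic_imp_surjective_map[OF h] pO
    by (intro homeomorphic_map_subtopologies[OF h]) (auto simp: inj_on_def)
  then have c: "point_complement_components X (h p) = (image h) ` point_complement_components X p"
    by (rule homeomorphic_map_connected_components_of)
  have "inj_on (image h) (Pow \<Omega>)" using homeomorphic_imp_injective_map[OF h]
    by (rule inj_on_image_Pow)
  moreover have "point_complement_components X p \<subseteq> Pow \<Omega>"
    using connected_components_of_subset by fastforce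
  ultimately have "inj_on (image h) (point_complement_components X p)" by (rule inj_on_subset)
  then have e: "point_complement_components X p \<approx> point_complement_components X (h p)"
    unfolding c using eqpoll_sym inj_on_image_eqpoll_self by blast
  then show "col p (h p)" by (simp add: col_def)
  show "h p \<in> B" using p e pO lepoll_trans1 lepoll_trans2 unfolding B_def branch_point_def by blast
qed

end

subsection \<open>Length functions and commutators\<close>

definition supported :: "'a topology \<Rightarrow> ('a \<Rightarrow> 'a) \<Rightarrow> 'a set \<Rightarrow> bool" where
  "supported X f W \<longleftrightarrow> homeo X f \<and> (\<forall>x\<in>topspace X - W. f x = x)"

text \<open>Disjoint sets shrinking to \<open>\<xi>\<close>. In a Hausdorff space they are locally
  finite away from \<open>\<xi>\<close>, which makes infinite gluings continuous.\<close>

definition null_family :: "'a topology \<Rightarrow> (nat \<Rightarrow> 'a set) \<Rightarrow> 'a \<Rightarrow> bool" where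
  "null_family X W \<xi> \<longleftrightarrow> \<xi> \<in> topspace X \<and> (\<forall>n. W n \<subseteq> topspace X - {\<xi>}) \<and> disjoint_family W \<and>
     (\<forall>U. openin X U \<and> \<xi> \<in> U \<longrightarrow> finite {n. \<not> W n \<subseteq> U})"

definition hinv :: "'a topology \<Rightarrow> ('a \<Rightarrow> 'a) \<Rightarrow> 'a \<Rightarrow> 'a" where
  "hinv X f = inv_into (topspace X) f"

lemma hinv_props:
  assumes "homeo X f"
  shows "homeomorphic_maps X X f (hinv X f)" "homeo X (hinv X f)"
    "x \<in> topspace X \<Longrightarrow> hinv X f (f x) = x" "x \<in> topspace X \<Longrightarrow> f (hinv X f x) = x"
    "x \<in> topspace X \<Longrightarrow> f x \<in> topspace X" "x \<in> topspace X \<Longrightarrow> hinv X f x \<in> topspace X"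
proof -
  have inj: "inj_on f (topspace X)" and im: "f ` topspace X = topspace X"
    using assms homeomorphic_imp_injective_map homeomorphic_imp_surjective_map by blast+
  obtain g where g: "homeomorphic_maps X X f g" using assms homeomorphic_map_maps by blast
  show 1: "x \<in> topspace X \<Longrightarrow> hinv X f (f x) = x" for x using inj by (simp add: hinv_def)
  show 2: "x \<in> topspace X \<Longrightarrow> f (hinv X f x) = x" for x using im by (simp add: hinv_def f_inv_into_f)
  show 3: "x \<in> topspace X \<Longrightarrow> f x \<in> topspace X" for x using im by blast
  show 4: "x \<in> topspace X \<Longrightarrow> hinv X f x \<in> topspace X" for x unfolding hinv_def using im
    by (metis inv_into_into)
  have "g x = hinv X f x" if "x \<in> topspace X" for x
    using g 1 2 4 that unfolding homeomorphic_maps_def by metis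
  then have "continuous_map X X (hinv X f)"
    using g continuous_map_eq unfolding homeomorphic_maps_def by metis
  then show "homeomorphic_maps X X f (hinv X f)"
    using g 1 2 by (simp add: homeomorphic_maps_def)
  then show "homeo X (hinv X f)" using homeomorphic_maps_map by blast
qed

lemma homeomorphic_map_funpow:
  assumes "homeo X T" shows "homeo X (T ^^ i)"
proof (induction i)
  case (Suc i)
  then show ?case using homeomorphic_map_compose[OF Suc assms] by (simp only: funpow.simps)
qed (simp add: id_def[symmetric])

text \<open>If \<open>f\<close> moved a point \<open>x\<close> of \<open>W\<close> out of
  \<open>W\<close>, it would fix \<open>f x\<close>, and injectivity would give
  \<open>f x = x\<close>.\<close>

lemma supported_image:
  assumes "supported X f W" "W \<subseteq> topspace X" "x \<in> topspace X" shows "f x \<in> W \<longleftrightarrow> x \<in> W"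
proof -
  have f: "homeo X f" "\<And>x. x \<in> topspace X \<Longrightarrow> x \<notin> W \<Longrightarrow> f x = x" using assms(1)
    by (auto simp: supported_def)
  show ?thesis
  proof (cases "x \<in> W")
    case True
    have "f x \<in> W"
    proof (rule ccontr)
      assume "f x \<notin> W"
      then have "f (f x) = f x" using f hinv_props(5) assms by metis
      then have "f x = x" using homeomorphic_imp_injective_map[OF f(1)] hinv_props(5)[OF f(1)] assms
        by (meson inj_onD)
      then show False using \<open>f x \<notin> W\<close> True by simp
    qed
    then show ?thesis using True by simp
  qed (use f assms in auto)
qed

lemma supported_hinv: "supported X f W \<Longrightarrow> supported X (hinv X f) W"
  unfolding supported_def using hinv_props by (metis DiffD1)

lemma supported_mono: "supported X f W \<Longrightarrow> W \<subseteq> V \<Longrightarrow> supported X f V"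
  unfolding supported_def by blast

lemma supported_conj:
  assumes "homeo X t" "supported X g W"
  shows "supported X (t \<circ> g \<circ> hinv X t) (t ` W)"
proof -
  have g: "homeo X g" "\<And>x. x \<in> topspace X - W \<Longrightarrow> g x = x" using assms(2)
    by (auto simp: supported_def)
  note t = hinv_props[OF assms(1)]
  have "homeo X (t \<circ> g \<circ> hinv X t)"
    using homeomorphic_map_compose[OF t(2) homeomorphic_map_compose[OF g(1) assms(1)]]
      by (simp add: comp_assoc)
  moreover have "t (g (hinv X t x)) = x" if x: "x \<in> topspace X - t ` W" for x
  proof -
    have "hinv X t x \<notin> W" using x t(4)[of x] by force
    then show ?thesis using g(2) x t(4,6) by simp
  qed
  ultimately show ?thesis by (simp add: supported_def)
qed

section \<open>Gluing homeomorphisms with disjoint supports\<close>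

definition patch :: "(nat \<Rightarrow> 'a set) \<Rightarrow> (nat \<Rightarrow> 'a \<Rightarrow> 'a) \<Rightarrow> nat set \<Rightarrow> 'a \<Rightarrow> 'a" where
  "patch W f N x = (if \<exists>n\<in>N. x \<in> W n then f (THE n. x \<in> W n) x else x)"

lemma patch_in:
  assumes "disjoint_family W" "x \<in> W n" "n \<in> N" shows "patch W f N x = f n x"
proof -
  have "(THE n. x \<in> W n) = n" using assms
    by (intro the_equality) (auto simp: disjoint_family_on_def)
  then show ?thesis using assms by (auto simp: patch_def)
qed

lemma patch_out: "(\<And>n. n \<in> N \<Longrightarrow> x \<notin> W n) \<Longrightarrow> patch W f N x = x"
  by (auto simp: patch_def)

text \<open>A gluing over finitely many indices is a composition of the \<open>f n\<close>. The
  index set is a parameter of \<open>patch\<close> because the infinite gluing is compared locally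
  with finite ones.\<close>

lemma patch_continuous_finite:
  assumes W: "disjoint_family W" "\<And>n. W n \<subseteq> topspace X" and f: "\<And>n. supported X (f n) (W n)"
    and N: "finite N"
  shows "continuous_map X X (patch W f N)"
  using N
proof (induction N)
  case empty
  then show ?case by (simp add: patch_def)
next
  case (insert n N)
  have "continuous_map X X (f n)" using homeomorphic_imp_continuous_map[of X X "f n"] f[of n]
    by (simp add: supported_def)
  then have "continuous_map X X (f n \<circ> patch W f N)" using insert.IH continuous_map_compose by blast
  then show ?case
  proof (rule continuous_map_eq)
    fix x assume x: "x \<in> topspace X"
    show "(f n \<circ> patch W f N) x = patch W f (insert n N) x"
    proof (cases "\<exists>m\<in>insert n N. x \<in> W m")
      case True
      then obtain m where m: "m \<in> insert n N" "x \<in> W m" by blast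
      show ?thesis
      proof (cases "m = n")
        case True
        have "x \<notin> W k" if "k \<in> N" for k
        proof -
          have "k \<noteq> n" using that insert.hyps by blast
          then have "W k \<inter> W n = {}" using disjoint_family_onD[OF W(1), of k n] by blast
          then show ?thesis using m True by blast
        qed
        then have "patch W f N x = x" by (rule patch_out)
        then show ?thesis using patch_in[OF W(1) m(2,1)] True by simp
      next
        case False
        then have "m \<in> N" using m by simp
        then have "patch W f N x = f m x" "patch W f (insert n N) x = f m x"
          using patch_in[OF W(1) m(2)] m by auto
        moreover have "f m x \<in> W m" using supported_image[OF f W(2) x] m by blast
        then have "f m x \<in> topspace X - W n" using False W by (auto simp: disjoint_family_on_def)
        ultimately show ?thesis using f by (simp add: supported_def)
      qed
    next
      case False
      then have "patch W f N x = x" "patch W f (insert n N) x = x" by (auto intro!: patch_out)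
      then show ?thesis using f[of n] x False by (simp add: supported_def)
    qed
  qed
qed

text \<open>At \<open>\<xi>\<close>, all but finitely many \<open>W n\<close> lie inside the given
  neighbourhood and are preserved by \<open>f n\<close>; any other point has a neighbourhood meeting
  only finitely many \<open>W n\<close>. The inverse is the gluing of the inverses.\<close>

lemma patch_homeomorphic:
  assumes X: "Hausdorff_space X" and W: "null_family X W \<xi>" and f: "\<And>n. supported X (f n) (W n)"
  shows "supported X (patch W f UNIV) (\<Union>n. W n)"
proof -
  have xi: "\<xi> \<in> topspace X" "\<And>n. \<xi> \<notin> W n" and dis: "disjoint_family W"
    and sub: "\<And>n. W n \<subseteq> topspace X"
    and nul: "\<And>U. openin X U \<Longrightarrow> \<xi> \<in> U \<Longrightarrow> finite {n. \<not> W n \<subseteq> U}"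
    using W by (auto simp: null_family_def)
  have top: "patch W f UNIV \<in> topspace X \<rightarrow> topspace X" if f: "\<And>n. supported X (f n) (W n)" for f
  proof
    fix x assume x: "x \<in> topspace X"
    show "patch W f UNIV x \<in> topspace X"
      using x patch_in[OF dis, of x _ UNIV f] f hinv_props(5)[of X] patch_out[of UNIV x W f]
      unfolding supported_def by (cases "\<exists>n. x \<in> W n") auto
  qed
  have cont: "continuous_map X X (patch W f UNIV)" if f: "\<And>n. supported X (f n) (W n)" for f
    unfolding continuous_map_eq_topcontinuous_at topcontinuous_at_def
  proof (intro ballI conjI allI impI)
    show "patch W f UNIV \<in> topspace X \<rightarrow> topspace X" by (rule top[OF f])
    fix x V assume x: "x \<in> topspace X" "openin X V \<and> patch W f UNIV x \<in> V"
    have pre: "openin X {y \<in> topspace X. patch W f N y \<in> V}" if "finite N" for N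
      using patch_continuous_finite[OF dis sub f that] x(2)
        by (simp add: openin_continuous_map_preimage)
    show "\<exists>U. openin X U \<and> x \<in> U \<and> (\<forall>y\<in>U. patch W f UNIV y \<in> V)"
    proof (cases "x = \<xi>")
      case True
      then have xV: "\<xi> \<in> V" using x(2) xi by (simp add: patch_out)
      define N where "N = {n. \<not> W n \<subseteq> V}"
      have N: "finite N" using nul x(2) xV by (simp add: N_def)
      define U where "U = {y \<in> topspace X. patch W f N y \<in> V} \<inter> V"
      have "patch W f UNIV y \<in> V" if y: "y \<in> U" for y
      proof (cases "\<exists>n. y \<in> W n")
        case True
        then obtain n where n: "y \<in> W n" by blast
        then have e: "patch W f UNIV y = f n y" using patch_in[OF dis] by blast
        show ?thesis
        proof (cases "n \<in> N")
          case True
          then show ?thesis using e patch_in[OF dis n True, of f] y by (simp add: U_def)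
        next
          case False
          moreover have "f n y \<in> W n" using supported_image[OF f sub] n sub by blast
          ultimately show ?thesis using e by (auto simp: N_def)
        qed
      next
        case False
        then show ?thesis using y by (simp add: patch_out U_def)
      qed
      moreover have "openin X U" using pre[OF N] x by (auto simp: U_def)
      moreover have "x \<in> U" using True xV xi by (simp add: U_def patch_out)
      ultimately show ?thesis by blast
    next
      case False
      then obtain U0 V0 where UV: "openin X U0" "openin X V0" "\<xi> \<in> U0" "x \<in> V0" "disjnt U0 V0"
        using X xi x unfolding Hausdorff_space_def by metis
      define N where "N = {n. \<not> W n \<subseteq> U0}"
      have N: "finite N" using nul UV by (simp add: N_def)
      have eq: "patch W f UNIV y = patch W f N y" if "y \<in> V0" for y
      proof (cases "\<exists>n. y \<in> W n")
        case True
        then obtain n where n: "y \<in> W n" by blast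
        then have "n \<in> N" using that UV by (auto simp: N_def disjnt_def)
        then show ?thesis using patch_in[OF dis n] by simp
      qed (simp add: patch_out)
      define U where "U = {y \<in> topspace X. patch W f N y \<in> V} \<inter> V0"
      have "openin X U" "x \<in> U" using pre[OF N] UV x eq[of x] by (auto simp: U_def)
      moreover have "\<forall>y\<in>U. patch W f UNIV y \<in> V" using eq by (simp add: U_def)
      ultimately show ?thesis by blast
    qed
  qed
  define g where "g = (\<lambda>n. hinv X (f n))"
  have g: "supported X (g n) (W n)" for n using supported_hinv[OF f] by (simp add: g_def)
  have inv: "patch W b UNIV (patch W a UNIV x) = x"
    if a: "\<And>n. supported X (a n) (W n)" and ba: "\<And>n x. x \<in> topspace X \<Longrightarrow> b n (a n x) = x"
      and x: "x \<in> topspace X" for a b x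
  proof (cases "\<exists>n. x \<in> W n")
    case True
    then obtain n where n: "x \<in> W n" by blast
    then have "a n x \<in> W n" using supported_image[OF a sub x] by blast
    then show ?thesis using patch_in[OF dis n, of UNIV a] patch_in[OF dis, of "a n x" n UNIV b] ba x
      by simp
  qed (simp add: patch_out)
  have hf: "homeo X (f n)" for n using f[of n] by (simp add: supported_def)
  have gf: "g n (f n x) = x" "f n (g n x) = x" if "x \<in> topspace X" for n x
    using hinv_props(3,4)[OF hf that] by (simp_all add: g_def)
  have "homeomorphic_maps X X (patch W f UNIV) (patch W g UNIV)"
    unfolding homeomorphic_maps_def
  proof (intro conjI ballI)
    show "patch W g UNIV (patch W f UNIV x) = x" if "x \<in> topspace X" for x
      by (rule inv[OF f gf(1) that])
    show "patch W f UNIV (patch W g UNIV x) = x" if "x \<in> topspace X" for x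
      by (rule inv[OF g gf(2) that])
  qed (use cont f g in auto)
  then have "homeo X (patch W f UNIV)" using homeomorphic_maps_map by blast
  then show ?thesis by (auto simp: supported_def patch_out)
qed

text \<open>Homeomorphisms are total functions on the type here; \<open>L_cong\<close> makes
  \<open>L\<close> depend only on their values on the space.\<close>

locale homeo_length =
  fixes X :: "'a topology" and L :: "('a \<Rightarrow> 'a) \<Rightarrow> real"
  assumes L_comp: "homeo X f \<Longrightarrow> homeo X g \<Longrightarrow> L (f \<circ> g) \<le> L f + L g"
    and L_hinv: "homeo X f \<Longrightarrow> L (hinv X f) = L f"
    and L_cong: "homeo X f \<Longrightarrow> homeo X g \<Longrightarrow> (\<And>x. x \<in> topspace X \<Longrightarrow> f x = g x) \<Longrightarrow> L f = L g"
begin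

text \<open>The equation says that \<open>g\<close> is the commutator \<open>F T F^-1 T^-1\<close>;
  without inverses it can be checked pointwise.\<close>

lemma L_commutator:
  assumes F: "homeo X F" and T: "homeo X T" and g: "homeo X g"
    and eq: "\<And>x. x \<in> topspace X \<Longrightarrow> F (T x) = g (T (F x))"
  shows "L g \<le> 2 * L F + 2 * L T"
proof -
  note Fi = hinv_props[OF F] and Ti = hinv_props[OF T]
  define C where "C = F \<circ> (T \<circ> (hinv X F \<circ> hinv X T))"
  have h: "homeo X (hinv X F \<circ> hinv X T)" "homeo X (T \<circ> (hinv X F \<circ> hinv X T))"
    "homeo X C"
    unfolding C_def using homeomorphic_map_compose F T Fi(2) Ti(2) by metis+
  have "L g = L C"
  proof (rule L_cong[OF g h(3)])
    fix x assume "x \<in> topspace X"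
    then show "g x = C x"
      using eq[of "hinv X F (hinv X T x)"] Fi(4)[of "hinv X T x"] Ti(4)[of x] Ti(6)[of x] Fi(6)[of
        "hinv X T x"]
      by (simp add: C_def)
  qed
  also have "\<dots> \<le> L F + (L T + (L (hinv X F) + L (hinv X T)))"
    using L_comp[OF F h(2)] L_comp[OF T h(1)] L_comp[OF Fi(2) Ti(2)] unfolding C_def by linarith
  finally show ?thesis using L_hinv F T by simp
qed

text \<open>
  The element \<open>\<phi>\<close> built from infinitely many translates of \<open>g\<close> satisfies \<open>\<phi> T = g T \<phi>\<close>, so \<open>g\<close> is
  a commutator of \<open>\<phi>\<close> and \<open>T\<close>. Placing copies of countably many such \<open>\<phi>\<close> in the disjoint sets
  \<open>R n ` V\<close> yields a single homeomorphism \<open>F\<close> that recovers every \<open>g n\<close> at a cost independent of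
  \<open>g n\<close>.
\<close>

theorem swindle:
  assumes X: "Hausdorff_space X" and T: "supported X T V" and WV: "W \<subseteq> V" "V \<subseteq> topspace X"
    and nT: "null_family X (\<lambda>i. (T ^^ i) ` W) \<xi>"
    and R: "\<And>n. homeo X (R n)" and nR: "null_family X (\<lambda>n. R n ` V) \<zeta>"
  shows "\<exists>C. \<forall>g. supported X g W \<longrightarrow> L g \<le> C"
proof (rule ccontr)
  assume "\<not> ?thesis"
  \<comment> \<open>The threshold is what recovering \<open>g n\<close> will cost apart from
    \<open>F\<close>: conjugation by \<open>R n\<close> costs \<open>2 * L (R n)\<close>, the
    commutator doubles this and adds \<open>2 * L T\<close>. The surplus \<open>n\<close> then has
    to be below \<open>2 * L F\<close>.\<close>
  then have "\<forall>n::nat. \<exists>g. supported X g W \<and> L g > 4 * L (R n) + 2 * L T + n" by (meson not_le)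
  then obtain g where g: "\<And>n::nat. supported X (g n) W" "\<And>n. L (g n) > 4 * L (R n) + 2 * L T + n"
    by metis
  have hT: "homeo X T" using T by (simp add: supported_def)
  note hTi = homeomorphic_map_funpow[OF hT]
  have TV: "T x \<in> V \<longleftrightarrow> x \<in> V" if "x \<in> topspace X" for x using supported_image[OF T WV(2) that] .
  have W0: "W \<subseteq> topspace X" using WV by blast
  have TW: "(T ^^ i) ` W \<subseteq> V" for i
  proof (induction i)
    case (Suc i)
    then show ?case using TV WV by auto
  qed (use WV in simp)
  have disT: "disjoint_family (\<lambda>i. (T ^^ i) ` W)" and disR: "disjoint_family (\<lambda>n. R n ` V)"
    using nT nR by (auto simp: null_family_def)
  define c where "c = (\<lambda>n i. T ^^ i \<circ> g n \<circ> hinv X (T ^^ i))"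
  have c: "supported X (c n i) ((T ^^ i) ` W)" for n i unfolding c_def
    by (rule supported_conj[OF hTi g(1)])
  \<comment> \<open>Formally \<open>\<phi> n\<close> is the product of the conjugates of
    \<open>g n\<close> by all powers of \<open>T\<close>. Conjugating it by \<open>T\<close> shifts
    the factors and loses only the first, \<open>g n\<close>; this is the identity
    \<open>comm\<close> below.\<close>
  define \<phi> where "\<phi> = (\<lambda>n. patch (\<lambda>i. (T ^^ i) ` W) (c n) UNIV)"
  have \<phi>W: "supported X (\<phi> n) (\<Union>i. (T ^^ i) ` W)" for n
    unfolding \<phi>_def by (rule patch_homeomorphic[OF X nT c])
  then have \<phi>: "supported X (\<phi> n) V" for n by (rule supported_mono) (use TW in blast)
  have \<phi>i: "\<phi> n ((T ^^ i) w) = (T ^^ i) (g n w)" if "w \<in> W" for n i w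
  proof -
    have "\<phi> n ((T ^^ i) w) = c n i ((T ^^ i) w)" unfolding \<phi>_def
      by (rule patch_in[OF disT]) (use that in auto)
    then show ?thesis using hinv_props(3)[OF hTi] that W0 by (auto simp: c_def)
  qed
  have gW: "g n w \<in> W \<longleftrightarrow> w \<in> W" if "w \<in> topspace X" for n w using supported_image[OF g(1) W0 that] .
  have gid: "g n x = x" if "x \<in> topspace X" "x \<notin> W" for n x using g(1) that
    by (simp add: supported_def)
  have comm: "\<phi> n (T y) = g n (T (\<phi> n y))" if y: "y \<in> topspace X" for n y
  proof (cases "\<exists>i. y \<in> (T ^^ i) ` W")
    case True
    then obtain i w where w: "w \<in> W" "y = (T ^^ i) w" by blast
    have e: "\<phi> n y = (T ^^ i) (g n w)" "\<phi> n (T y) = (T ^^ Suc i) (g n w)"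
      using \<phi>i[OF w(1), of n i] \<phi>i[OF w(1), of n "Suc i"] w by auto
    have "g n w \<in> W" using gW w W0 by blast
    then have "(T ^^ Suc i) (g n w) \<notin> (T ^^ 0) ` W"
      using disT unfolding disjoint_family_on_def by blast
    moreover have "(T ^^ Suc i) (g n w) \<in> topspace X"
      using hinv_props(5)[OF hTi] \<open>g n w \<in> W\<close> W0 by blast
    ultimately have "g n ((T ^^ Suc i) (g n w)) = (T ^^ Suc i) (g n w)" by (intro gid) auto
    then show ?thesis using e by simp
  next
    case False
    then have 1: "\<phi> n y = y" using \<phi>W[of n] y by (auto simp: supported_def)
    have Ty: "T y \<in> topspace X" using hinv_props(5)[OF hT y] .
    \<comment> \<open>A point outside all translates can enter them only through \<open>W\<close>,
      the translate with exponent 0.\<close>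
    have "\<phi> n (T y) = g n (T y)"
    proof (cases "T y \<in> W")
      case True
      then show ?thesis using \<phi>i[OF True, of n 0] by simp
    next
      case notW: False
      have "T y \<notin> (T ^^ i) ` W" for i
      proof
        assume "T y \<in> (T ^^ i) ` W"
        moreover have "i \<noteq> 0" using calculation notW by (cases i) auto
        ultimately obtain j w where jw: "w \<in> W" "T y = T ((T ^^ j) w)" by (cases i) auto
        have "(T ^^ j) w \<in> topspace X" using hinv_props(5)[OF hTi] jw W0 by blast
        then have "y = (T ^^ j) w" using homeomorphic_imp_injective_map[OF hT] jw y
          by (meson inj_onD)
        then show False using False jw by blast
      qed
      then have "\<phi> n (T y) = T y" using \<phi>W[of n] Ty by (auto simp: supported_def)
      then show ?thesis using gid[OF Ty notW] by simp
    qed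
    then show ?thesis using 1 by simp
  qed
  define F where "F = patch (\<lambda>n. R n ` V) (\<lambda>n. R n \<circ> \<phi> n \<circ> hinv X (R n)) UNIV"
  have Fs: "supported X F (\<Union>n. R n ` V)"
    unfolding F_def by (rule patch_homeomorphic[OF X nR supported_conj[OF R \<phi>]])
  then have hF: "homeo X F" by (simp add: supported_def)
  have "n < 2 * L F" for n :: nat
  proof -
    note Ri = hinv_props[OF R[of n]]
    \<comment> \<open>\<open>Fn\<close> is known to agree with \<open>\<phi> n\<close> on
      \<open>V\<close> only. Outside \<open>V\<close> its values stay outside \<open>V\<close>,
      where \<open>T\<close> and \<open>g n\<close> are the identity, and this suffices for the
      commutator equation.\<close>
    define Fn where "Fn = hinv X (R n) \<circ> (F \<circ> R n)"
    have h1: "homeo X (F \<circ> R n)" using homeomorphic_map_compose[OF R hF] .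
    have hFn: "homeo X Fn" unfolding Fn_def using homeomorphic_map_compose[OF h1 Ri(2)] .
    have FnV: "Fn y = \<phi> n y" if "y \<in> V" for y
    proof -
      have "F (R n y) = R n (\<phi> n (hinv X (R n) (R n y)))"
        unfolding F_def by (subst patch_in[OF disR, of _ n]) (use that in auto)
      moreover have "y \<in> topspace X" using that WV by blast
      moreover have "\<phi> n y \<in> topspace X" using \<phi>[of n] hinv_props(5)[of X "\<phi> n" y] \<open>y \<in> topspace X\<close>
        by (simp add: supported_def)
      ultimately show ?thesis using Ri(3) by (simp add: Fn_def)
    qed
    have FnV': "Fn y \<notin> V" if y: "y \<in> topspace X" "y \<notin> V" for y
    proof
      assume "Fn y \<in> V"
      define z where "z = hinv X (\<phi> n) (Fn y)"
      have h\<phi>: "homeo X (\<phi> n)" using \<phi> by (simp add: supported_def)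
      have O: "Fn y \<in> topspace X" using hinv_props(5)[OF hFn] y by blast
      have z: "z \<in> V" "z \<in> topspace X" "\<phi> n z = Fn y"
        using supported_image[OF supported_hinv[OF \<phi>] WV(2) O] \<open>Fn y \<in> V\<close> hinv_props(4,6)[OF h\<phi> O]
          by (auto simp: z_def)
      then have "Fn z = Fn y" using FnV by simp
      then have "z = y" using homeomorphic_imp_injective_map[OF hFn] z y by (meson inj_onD)
      then show False using z y by simp
    qed
    have "Fn (T y) = g n (T (Fn y))" if y: "y \<in> topspace X" for y
    proof (cases "y \<in> V")
      case True
      then show ?thesis using FnV TV[OF y] comm[OF y] by simp
    next
      case False
      have O: "Fn y \<in> topspace X" using hinv_props(5)[OF hFn] y by blast
      have "T y = y" "T (Fn y) = Fn y" using T y False FnV'[OF y False] O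
        by (auto simp: supported_def)
      moreover have "g n (Fn y) = Fn y" using gid[OF O] FnV'[OF y False] WV by blast
      ultimately show ?thesis by simp
    qed
    then have "L (g n) \<le> 2 * L Fn + 2 * L T"
      using L_commutator[OF hFn hT] g(1)[of n] by (auto simp: supported_def)
    moreover have "L Fn \<le> L (R n) + (L F + L (R n))"
      using L_comp[OF Ri(2) h1] L_comp[OF hF R[of n]] L_hinv[OF R[of n]] unfolding Fn_def
        by linarith
    ultimately show ?thesis using g(2)[of n] by linarith
  qed
  then show False using reals_Archimedean2[of "2 * L F"] by (meson less_asym)
qed

end

subsection \<open>Local boundedness and fragmentation\<close>

context wdendrite begin

lemma bt_or_J: "q \<in> \<Omega> \<Longrightarrow> b \<in> \<Omega> \<Longrightarrow> b \<noteq> q \<Longrightarrow> x \<in> \<Omega> \<Longrightarrow> x \<noteq> q \<Longrightarrow> bt q b x \<or> J q b x"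
  by (auto simp: bt_def)

lemma bt_J: "bt p x y \<Longrightarrow> J p x z \<Longrightarrow> bt p z y"
  using J_equiv(2,3) joined_domain unfolding bt_def by blast

lemma homeomorphic_map_bt:
  assumes "homeo X h" "p \<in> \<Omega>" "x \<in> \<Omega>" "y \<in> \<Omega>"
  shows "bt (h p) (h x) (h y) \<longleftrightarrow> bt p x y"
  using homeomorphic_map_J[OF assms] hinv_props(5)[OF assms(1)] assms
    inj_on_eq_iff[OF homeomorphic_imp_injective_map[OF assms(1)]] unfolding bt_def by metis

text \<open>The two openness assumptions leave \<open>q\<close> as the only possible boundary point
  of \<open>W\<close>, and there \<open>h\<close> agrees with the identity.\<close>

lemma paste:
  assumes h: "homeo X h" and q: "q \<in> \<Omega>" "h q = q" and W: "openin X W" "openin X (\<Omega> - insert q W)"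
    and hW: "\<And>x. x \<in> \<Omega> \<Longrightarrow> h x \<in> W \<longleftrightarrow> x \<in> W" and qW: "q \<notin> W"
  shows "supported X (\<lambda>x. if x \<in> W then h x else x) W"
proof -
  have cont: "continuous_map X X (\<lambda>x. if x \<in> W then f x else x)"
    if f: "homeo X f" "f q = q" for f
    unfolding continuous_map_eq_topcontinuous_at topcontinuous_at_def
  proof (intro ballI conjI allI impI)
    show "(\<lambda>x. if x \<in> W then f x else x) \<in> \<Omega> \<rightarrow> \<Omega>" using hinv_props(5)[OF f(1)] by auto
    fix x V assume x: "x \<in> \<Omega>" "openin X V \<and> (if x \<in> W then f x else x) \<in> V"
    have pre: "openin X {y \<in> \<Omega>. f y \<in> V}"
      using homeomorphic_imp_continuous_map[OF f(1)] x by (simp add: openin_continuous_map_preimage)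
    consider "x \<in> W" | "x \<in> \<Omega> - insert q W" | "x = q" using x by blast
    then show "\<exists>U. openin X U \<and> x \<in> U \<and> (\<forall>y\<in>U. (if y \<in> W then f y else y) \<in> V)"
    proof cases
      case 1
      then show ?thesis using x W(1) pre by (intro exI[of _ "W \<inter> {y \<in> \<Omega>. f y \<in> V}"]) auto
    next
      case 2
      then show ?thesis using x W(2) by (intro exI[of _ "(\<Omega> - insert q W) \<inter> V"]) auto
    next
      case 3
      then show ?thesis using x pre qW f(2) by (intro exI[of _ "{y \<in> \<Omega>. f y \<in> V} \<inter> V"]) auto
    qed
  qed
  note hi = hinv_props[OF h]
  have iq: "hinv X h q = q" using hi(3)[OF q(1)] q by simp
  have iW: "hinv X h x \<in> W \<longleftrightarrow> x \<in> W" if "x \<in> \<Omega>" for x using hW[OF hi(6)[OF that]] hi(4)[OF that]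
    by simp
  have "homeomorphic_maps X X (\<lambda>x. if x \<in> W then h x else x) (\<lambda>x. if x \<in> W then hinv X h x else x)"
    unfolding homeomorphic_maps_def using cont[OF h q(2)] cont[OF hi(2) iq] hi(3,4) hW iW by auto
  then have "homeo X (\<lambda>x. if x \<in> W then h x else x)" using homeomorphic_maps_map by blast
  then show ?thesis by (simp add: supported_def)
qed

lemma paste_off:
  assumes h: "homeo X h" and q: "q \<in> \<Omega>" "b \<in> \<Omega>" "b \<noteq> q" "h q = q" "h b = b"
  shows "supported X (\<lambda>x. if x \<in> {x. bt q b x} then h x else x) {x. bt q b x}"
proof (rule paste[OF h q(1,4) bt_open])
  have "\<Omega> - insert q {x. bt q b x} = {x. J q b x}" using bt_or_J[OF q(1-3)] joined_domain
    by (auto simp: bt_def)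
  then show "openin X (\<Omega> - insert q {x. bt q b x})" using J_open by simp
  show "h x \<in> {x. bt q b x} \<longleftrightarrow> x \<in> {x. bt q b x}" if "x \<in> \<Omega>" for x
    using homeomorphic_map_bt[OF h q(1,2) that] q by simp
  show "q \<notin> {x. bt q b x}" using bt_dom by blast
qed

lemma paste_on:
  assumes h: "homeo X h" and q: "q \<in> \<Omega>" "b \<in> \<Omega>" "b \<noteq> q" "h q = q" "h b = b"
  shows "supported X (\<lambda>x. if x \<in> {x. J q b x} then h x else x) {x. J q b x}"
proof (rule paste[OF h q(1,4) J_open])
  have "\<Omega> - insert q {x. J q b x} = {x. bt q b x}" using q by (auto simp: bt_def)
  then show "openin X (\<Omega> - insert q {x. J q b x})" using bt_open by simp
  show "h x \<in> {x. J q b x} \<longleftrightarrow> x \<in> {x. J q b x}" if "x \<in> \<Omega>" for x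
    using homeomorphic_map_J[OF h q(1,2) that] q by simp
  show "q \<notin> {x. J q b x}" using joined_domain by blast
qed

text \<open>Of three directions at a branch point, \<open>x\<close> and \<open>y\<close> occupy at
  most one each.\<close>

lemma third_direction:
  assumes m: "m \<in> B" "x \<in> \<Omega>" "y \<in> \<Omega>" "x \<noteq> m" "y \<noteq> m"
  obtains z where "z \<in> B" "bt m z x" "bt m z y"
proof -
  have mO: "m \<in> \<Omega>" using m B_topspace by blast
  obtain u v w where uvw: "bt m u v" "bt m v w" "bt m u w" using branch_triple[OF m(1)] .
  have d: "u \<in> \<Omega>" "v \<in> \<Omega>" "w \<in> \<Omega>" "u \<noteq> m" "v \<noteq> m" "w \<noteq> m" using uvw bt_dom by blast+
  have two: "bt m s c \<or> bt m t c" if "bt m s t" "c \<in> \<Omega>" "c \<noteq> m" for s t c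
    using bt_split[OF that] bt_sym by blast
  have "(bt m u x \<and> bt m u y) \<or> (bt m v x \<and> bt m v y) \<or> (bt m w x \<and> bt m w y)"
    using two[OF uvw(1) m(2,4)] two[OF uvw(2) m(2,4)] two[OF uvw(3) m(2,4)]
      two[OF uvw(1) m(3,5)] two[OF uvw(2) m(3,5)] two[OF uvw(3) m(3,5)] by blast
  then obtain s where s: "bt m s x" "bt m s y" by blast
  then have "s \<in> \<Omega>" "s \<noteq> m" using bt_dom by blast+
  then obtain z where z: "z \<in> B" "J m s z" using branch_in_direction[OF mO] by metis
  then show thesis using that bt_J s by blast
qed

lemma accumulation_point:
  fixes r :: "nat \<Rightarrow> 'a"
  assumes "\<And>i. r i \<in> \<Omega>"
  obtains \<xi> where "\<xi> \<in> \<Omega>" "\<And>U. openin X U \<Longrightarrow> \<xi> \<in> U \<Longrightarrow> infinite {i. r i \<in> U}"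
proof -
  have "\<exists>\<xi>\<in>\<Omega>. \<forall>U. openin X U \<and> \<xi> \<in> U \<longrightarrow> infinite {i. r i \<in> U}"
  proof (rule ccontr)
    assume "\<not> ?thesis"
    then have "\<forall>x\<in>\<Omega>. \<exists>U. openin X U \<and> x \<in> U \<and> finite {i. r i \<in> U}" by blast
    then obtain N where N: "\<And>x. x \<in> \<Omega> \<Longrightarrow> openin X (N x) \<and> x \<in> N x \<and> finite {i. r i \<in> N x}" by metis
    have "\<And>U. U \<in> N ` \<Omega> \<Longrightarrow> openin X U" "\<Omega> \<subseteq> \<Union>(N ` \<Omega>)" using N by blast+
    then obtain \<F> where F: "finite \<F>" "\<F> \<subseteq> N ` \<Omega>" "\<Omega> \<subseteq> \<Union>\<F>"
      using X_props(3) unfolding compact_space_alt by meson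
    have "UNIV \<subseteq> (\<Union>U\<in>\<F>. {i. r i \<in> U})" using assms F(3) by blast
    moreover have "finite (\<Union>U\<in>\<F>. {i. r i \<in> U})" using F N by blast
    ultimately show False using finite_subset infinite_UNIV_nat by blast
  qed
  then show thesis using that by blast
qed

text \<open>
  The translates of \<open>W\<close> lie between consecutive points of a monotone sequence on an arc. They shrink
  to the limit of that sequence, because any point separating infinitely many of them from the limit would
  lie in two of the disjoint sets \<open>E k\<close>.
\<close>

lemma translation:
  assumes T: "homeo X T" and z: "z \<in> \<Omega>" "T z = z" and r: "bt (T r0) r0 z"
    and W: "\<And>x. x \<in> W \<Longrightarrow> J r0 z x \<and> bt (T r0) z x"
  obtains \<xi> where "null_family X (\<lambda>i. (T ^^ i) ` W) \<xi>"
proof -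
  note hTi = homeomorphic_map_funpow[OF T]
  define r where "r = (\<lambda>i. (T ^^ i) r0)"
  \<comment> \<open>\<open>E i\<close> lies beyond \<open>r i\<close> but not beyond
    \<open>r (Suc i)\<close>, going towards \<open>z\<close>. The hypothesis places \<open>W\<close>
    in \<open>E 0\<close>.\<close>
  define E where "E = (\<lambda>i. {x. J (r i) z x \<and> bt (r (Suc i)) z x})"
  have r0: "r0 \<in> \<Omega>" "T r0 \<in> \<Omega>" using r bt_dom by blast+
  have rO: "r i \<in> \<Omega>" for i using hinv_props(5)[OF hTi r0(1)] by (simp add: r_def)
  have Tz: "(T ^^ i) z = z" for i by (induction i) (use z in auto)
  have rT: "(T ^^ i) (T r0) = r (Suc i)" for i by (simp add: r_def funpow_swap1)
  have rS: "bt (r (Suc i)) (r i) z" for i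
    using homeomorphic_map_bt[OF hTi r0(2) r0(1) z(1), of i] r Tz rT by (simp add: r_def)
  have rlt: "bt (r j) (r i) z" if "i < j" for i j
    using that
  proof (induction j)
    case (Suc j)
    then show ?case using rS[of j] bt_chain(1)[of "r j" "r i" z "r (Suc j)"] by (cases "i = j") auto
  qed simp
  have rbt: "bt (r j) (r i) (r k)" if "i < j" "j < k" for i j k
    using bt_chain(2)[OF rlt[OF that(1)] rlt[OF that(2)]] .
  have rJ: "J (r i) z (r j)" if "i < j" for i j
  proof -
    have b: "bt (r j) (r i) z" using rlt that .
    then have "\<not> bt (r i) z (r j)" using bt_asym bt_sym by blast
    moreover have "r i \<noteq> r j" "z \<noteq> r i" using b bt_dom by blast+
    ultimately show ?thesis using rO z(1) by (auto simp: bt_def)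
  qed
  have DD: "J (r i) z x" if "J (r j) z x" "i < j" for i j x
  proof -
    have b: "bt (r j) (r i) z" using rlt that by blast
    then have "bt (r j) (r i) x" using bt_J[OF bt_sym[OF b] that(1)] bt_sym by blast
    then have "\<not> bt (r i) (r j) x" "x \<in> \<Omega>" "x \<noteq> r i" "r i \<noteq> r j" using bt_asym bt_dom by blast+
    then have "J (r i) (r j) x" using rO by (auto simp: bt_def)
    then show ?thesis using rJ[OF that(2)] J_equiv(3) by blast
  qed
  have Ed: "E i \<inter> E j = {}" if "i < j" for i j
  proof -
    have "J (r (Suc i)) z x" if "x \<in> E j" for x
      using that DD[of j x "Suc i"] \<open>i < j\<close> by (cases "j = Suc i") (auto simp: E_def)
    then show ?thesis by (auto simp: E_def bt_def)
  qed
  then have Edis: "E i \<inter> E j = {}" if "i \<noteq> j" for i j using that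
    by (metis Int_commute linorder_neqE_nat)
  have EO: "openin X (E i)" for i
  proof -
    have "E i = {x. J (r i) z x} \<inter> {x. bt (r (Suc i)) z x}" by (auto simp: E_def)
    then show ?thesis using J_open bt_open by (simp add: openin_Int)
  qed
  have WE: "(T ^^ i) ` W \<subseteq> E i" for i
  proof
    fix y assume "y \<in> (T ^^ i) ` W"
    then obtain x where x: "x \<in> W" "y = (T ^^ i) x" by blast
    have "x \<in> \<Omega>" using W[OF x(1)] joined_domain by blast
    then have "J (r i) z y \<longleftrightarrow> J r0 z x" "bt (r (Suc i)) z y \<longleftrightarrow> bt (T r0) z x"
      using homeomorphic_map_J[OF hTi r0(1) z(1), of x i] homeomorphic_map_bt[OF hTi r0(2) z(1), of
        x i]
      by (simp_all add: x(2) Tz rT) (simp_all add: r_def)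
    then show "y \<in> E i" using W[OF x(1)] by (simp add: E_def)
  qed
  obtain \<xi> where xi: "\<xi> \<in> \<Omega>" "\<And>U. openin X U \<Longrightarrow> \<xi> \<in> U \<Longrightarrow> infinite {i. r i \<in> U}"
    using accumulation_point[of r] rO by blast
  have rE: "r i \<notin> E k" if "k < i" for i k
  proof -
    have "J (r (Suc k)) z (r i) \<or> r i = r (Suc k)" using rJ[of "Suc k" i] that
      by (cases "i = Suc k") auto
    then show ?thesis by (auto simp: E_def bt_def)
  qed
  have xiE: "\<xi> \<notin> E k" for k
  proof
    assume "\<xi> \<in> E k"
    then have "infinite {i. r i \<in> E k}" using xi(2) EO by blast
    moreover have "i \<le> k" if "r i \<in> E k" for i using that rE[of k i] by (cases "k < i") auto
    then have "{i. r i \<in> E k} \<subseteq> {..k}" by auto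
    ultimately show False using finite_subset by blast
  qed
  \<comment> \<open>By \<open>nbhd_finite\<close>, shrinking to \<open>\<xi>\<close> has to be
    checked only against half-trees at single branch points \<open>p\<close>.\<close>
  have fin1: "finite {k. \<not> E k \<subseteq> {y. J p \<xi> y}}" if p: "p \<in> B" "p \<noteq> \<xi>" for p
  proof -
    have pO: "p \<in> \<Omega>" using p B_topspace by blast
    have inf: "infinite {i. r i \<in> {y. J p \<xi> y}}"
      using xi(2)[OF J_open, of p \<xi>] J_equiv(1)[OF pO xi(1)] p by blast
    have "\<exists>k1. \<forall>k\<ge>k1. r k \<noteq> p"
    proof (cases "\<exists>k. r k = p")
      case True
      then obtain k where "r k = p" by blast
      then have "r j \<noteq> p" if "k < j" for j using rlt[OF that] bt_dom by blast
      then show ?thesis by (intro exI[of _ "Suc k"]) auto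
    qed auto
    then obtain k1 where k1: "\<And>k. k1 \<le> k \<Longrightarrow> r k \<noteq> p" by blast
    obtain k0 where k0: "k1 \<le> k0" "J p \<xi> (r k0)" using inf unfolding infinite_nat_iff_unbounded_le
      by blast
    \<comment> \<open>Half-trees are convex: \<open>r k\<close> lies between two members of the
      sequence in the half-tree, and such members recur because \<open>\<xi>\<close> is an
      accumulation point.\<close>
    have rA: "J p \<xi> (r k)" if k: "k0 \<le> k" for k
    proof (rule ccontr)
      assume n: "\<not> J p \<xi> (r k)"
      then have "k0 < k" using k k0 by (cases "k0 = k") auto
      obtain j where j: "k < j" "J p \<xi> (r j)" using inf unfolding infinite_nat_iff_unbounded
        by blast
      have "r k \<noteq> p" using k1 k k0 by simp
      then have "bt p \<xi> (r k)" using n bt_or_J[OF pO xi(1) _ rO, of k] p by blast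
      then have b: "bt p (r k0) (r k)" "bt p (r j) (r k)" using bt_J k0 j by blast+
      have "bt (r k) (r k0) p \<or> bt (r k) p (r j)"
        using bt_split[OF rbt[OF \<open>k0 < k\<close> j(1)] pO] \<open>r k \<noteq> p\<close> by blast
      then show False using b bt_asym bt_sym by blast
    qed
    \<comment> \<open>Both ends \<open>r k\<close> and \<open>r (Suc k)\<close> of the region are on
      the side of \<open>\<xi>\<close>, so a point \<open>p\<close> that cuts off some
      \<open>x\<close> in the region lies in the region itself. By disjointness this happens for at
      most one \<open>k\<close>.\<close>
    have pE: "p \<in> E k" if k: "k0 \<le> k" and x: "x \<in> E k" "\<not> J p \<xi> x" for k x
    proof (cases "x = p")
      case False
      have xk: "J (r k) z x" "bt (r (Suc k)) z x" using x by (auto simp: E_def)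
      then have "x \<in> \<Omega>" using joined_domain by blast
      then have "bt p \<xi> x" using x(2) bt_or_J[OF pO xi(1) _ _ False] p by blast
      then have b: "bt p (r k) x" "bt p (r (Suc k)) x" using bt_J rA[of k] rA[of "Suc k"] k by auto
      then have "\<not> bt (r k) p x" "\<not> bt (r (Suc k)) p x" using bt_asym by blast+
      then have j: "J (r k) x p" "J (r (Suc k)) x p"
        using b bt_dom J_equiv(2) unfolding bt_def by blast+
      have "J (r k) z p" using J_equiv(3)[OF xk(1) j(1)] .
      moreover have "bt (r (Suc k)) z p" using bt_J[OF bt_sym[OF xk(2)] j(2)] bt_sym by blast
      ultimately show ?thesis by (simp add: E_def)
    qed (use x in simp)
    have "{k. p \<in> E k} \<subseteq> {SOME k. p \<in> E k}"
      using Edis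
        by (metis (mono_tags, lifting) Int_iff empty_iff insertCI mem_Collect_eq someI subsetI)
    then have "finite {k. p \<in> E k}" using finite_subset by blast
    moreover have "{k. \<not> E k \<subseteq> {y. J p \<xi> y}} \<subseteq> {..<k0} \<union> {k. p \<in> E k}"
    proof
      fix k assume "k \<in> {k. \<not> E k \<subseteq> {y. J p \<xi> y}}"
      then obtain x where "x \<in> E k" "\<not> J p \<xi> x" by blast
      then show "k \<in> {..<k0} \<union> {k. p \<in> E k}" using pE[of k x] by (cases "k0 \<le> k") auto
    qed
    ultimately show ?thesis using finite_subset by blast
  qed
  have "null_family X (\<lambda>i. (T ^^ i) ` W) \<xi>"
    unfolding null_family_def
  proof (intro conjI allI impI)
    show "(T ^^ i) ` W \<subseteq> \<Omega> - {\<xi>}" for i using WE[of i] xiE[of i] openin_subset[OF EO[of i]] by blast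
    show "disjoint_family (\<lambda>i. (T ^^ i) ` W)"
      using WE Edis unfolding disjoint_family_on_def by blast
    fix U assume U: "openin X U \<and> \<xi> \<in> U"
    then obtain F where F: "finite F" "F \<subseteq> B" "\<xi> \<notin> F" "\<And>y. y \<in> \<Omega> \<Longrightarrow> (\<And>p. p \<in> F \<Longrightarrow> J p \<xi> y) \<Longrightarrow> y \<in> U"
      using nbhd_finite by metis
    have "{n. \<not> (T ^^ n) ` W \<subseteq> U} \<subseteq> (\<Union>p\<in>F. {k. \<not> E k \<subseteq> {y. J p \<xi> y}})"
    proof
      fix n assume "n \<in> {n. \<not> (T ^^ n) ` W \<subseteq> U}"
      then obtain y where y: "y \<in> E n" "y \<notin> U" using WE by blast
      then obtain p where "p \<in> F" "\<not> J p \<xi> y" using F(4)[of y] openin_subset[OF EO[of n]] by blast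
      then show "n \<in> (\<Union>p\<in>F. {k. \<not> E k \<subseteq> {y. J p \<xi> y}})" using y by blast
    qed
    moreover have "finite (\<Union>p\<in>F. {k. \<not> E k \<subseteq> {y. J p \<xi> y}})" using F fin1 by blast
    ultimately show "finite {n. \<not> (T ^^ n) ` W \<subseteq> U}" using finite_subset by blast
  qed (use xi in auto)
  then show thesis by (rule that)
qed

text \<open>
  The points are arranged as \<open>b\<close> -- \<open>q'\<close> -- \<open>r0\<close> -- \<open>m\<close> -- \<open>r1\<close> -- \<open>z\<close> along an arc, with \<open>q\<close> hanging off
  the arc at \<open>m\<close>; the homeomorphism moves \<open>r0\<close> to \<open>r1\<close>.
\<close>

lemma inner_half_tree:
  assumes b: "q \<in> B" "b \<in> B" "q \<noteq> b"
  obtains q' T \<xi> where "q' \<in> B" "q' \<noteq> b" "{x. bt q b x} \<subseteq> {x. bt q' b x}"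
    "supported X T {x. bt q' b x}"
    "null_family X (\<lambda>i. (T ^^ i) ` {x. bt q b x}) \<xi>"
proof -
  note O = B_topspace[OF b(1)] B_topspace[OF b(2)]
  obtain m where m: "m \<in> B" "bt m q b" using branch_separates O b(3) by blast
  have mO: "m \<in> \<Omega>" "q \<noteq> m" "b \<noteq> m" using m bt_dom by blast+
  obtain z where z: "z \<in> B" "bt m z q" "bt m z b" using third_direction[OF m(1) O mO(2,3)] .
  have zO: "z \<in> \<Omega>" "z \<noteq> m" using z bt_dom by blast+
  obtain q' where q': "q' \<in> B" "bt q' b m" using branch_separates[of b m] O mO by blast
  have q'O: "q' \<in> \<Omega>" "q' \<noteq> m" "q' \<noteq> b" using q' bt_dom by blast+
  obtain r0 where r0: "r0 \<in> B" "bt r0 q' m" using branch_separates[of q' m] q'O mO by blast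
  \<comment> \<open>\<open>r1\<close> has the order of \<open>r0\<close>, so homogeneity can move
    \<open>r0\<close> to it. As \<open>m\<close> lies between them, the half-tree at
    \<open>q\<close>, which hangs off the arc at \<open>m\<close>, falls into the first region of
    the translation.\<close>
  obtain r1 where r1: "r1 \<in> B" "col r0 r1" "bt r1 m z" using dense[OF r0(1), of m z] mO zO by blast
  have q'm: "bt m q' z" "bt m q' q"
    using bt_chain(2)[OF z(3) bt_sym[OF q'(2)]] bt_chain(2)[OF m(2) bt_sym[OF q'(2)]] bt_sym
      by blast+
  have c: "bt q' b r0" "bt r0 q' z" "bt q' b r1" "bt r1 q' z" "bt r1 r0 z"
  proof -
    show "bt q' b r0" using bt_chain(2)[OF q'(2) r0(2)] .
    show r0z: "bt r0 q' z" using bt_chain(1)[of m z q' r0] q'm(1) r0(2) bt_sym by blast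
    show r1q: "bt r1 q' z" using bt_chain(1)[OF q'm(1) r1(3)] .
    have "bt q' b z" using bt_chain(1)[of m z b q'] z(3) q'(2) bt_sym by blast
    have "bt m r0 z" using bt_chain(2)[of m z q' r0] q'm(1) r0(2) bt_sym by blast
    then show "bt r1 r0 z" using bt_chain(1)[OF _ r1(3)] by blast
    show "bt q' b r1" using bt_chain(2)[OF \<open>bt q' b z\<close> r1q] .
  qed
  obtain h where h: "homeo X h" "h b = b" "h q' = q'" "h r0 = r1" "h z = z"
    using chain_homeomorphism[OF b(2) q'(1) r0(1) z(1) r1(1) z(1) r1(2) col_refl[OF z(1)] c(1-4)]
      by blast
  \<comment> \<open>Since \<open>h\<close> fixes \<open>b\<close> and \<open>q'\<close>, the
    movement can be confined to what \<open>q'\<close> cuts off from \<open>b\<close>.\<close>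
  define T where "T = (\<lambda>x. if x \<in> {x. bt q' b x} then h x else x)"
  have T: "supported X T {x. bt q' b x}"
    unfolding T_def by (rule paste_off[OF h(1)]) (use q'O O h in auto)
  have Tv: "T z = z" "T r0 = r1" using h c(1) by (auto simp: T_def)
  have sub: "bt q' b x" if x: "bt q b x" for x
  proof -
    have "bt q' b q" using bt_chain(1)[of m q b q'] m(2) q'(2) bt_sym by blast
    then show ?thesis using bt_chain(1)[of q x b q'] x bt_sym by blast
  qed
  have W: "J r0 z x \<and> bt (T r0) z x" if x: "bt q b x" for x
  proof -
    have xd: "x \<in> \<Omega>" "x \<noteq> q" using x bt_dom by blast+
    have mx: "bt m b x" using bt_chain(1)[of q x b m] x m(2) bt_sym by blast
    then have xm: "x \<noteq> m" using bt_dom by blast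
    have "\<not> bt m q x"
    proof
      assume "bt m q x"
      moreover have "bt q m x" using bt_chain(2)[OF bt_sym[OF x] m(2)] bt_sym by blast
      ultimately show False using bt_asym by blast
    qed
    then have "bt m z x" using bt_split[OF z(2) xd(1) xm] bt_sym by blast
    then have "bt r1 z x" using bt_chain(1)[of m x z r1] r1(3) bt_sym by blast
    moreover have "J r0 z x"
    proof -
      have "J r0 m u" if "bt m q' u" for u
      proof -
        have "bt m r0 u" using bt_chain(2)[OF bt_sym[OF that] bt_sym[OF r0(2)]] by (rule bt_sym)
        then have "\<not> bt r0 m u" "u \<in> \<Omega>" "u \<noteq> r0" using bt_asym bt_dom by blast+
        then show ?thesis using bt_or_J[OF B_topspace[OF r0(1)] mO(1)] bt_dom[OF r0(2)] by blast
      qed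
      moreover have "bt m q' x"
        using q'm(2) \<open>\<not> bt m q x\<close> bt_split[OF q'm(2) xd(1) xm] bt_sym by blast
      ultimately show ?thesis using q'm(1) J_equiv(2,3) by meson
    qed
    ultimately show ?thesis using Tv by simp
  qed
  obtain \<xi> where "null_family X (\<lambda>i. (T ^^ i) ` {x. bt q b x}) \<xi>"
  proof (rule translation[of T z r0 "{x. bt q b x}"])
    show "homeo X T" using T by (simp add: supported_def)
    show "bt (T r0) r0 z" using c(5) Tv by simp
    show "J r0 z x \<and> bt (T r0) z x" if "x \<in> {x. bt q b x}" for x using W that by simp
  qed (use zO Tv in auto)
  then show thesis using that[OF q'(1) q'O(3) _ T] sub by blast
qed

text \<open>\<open>inner_half_tree\<close> is used twice: to shift the given set inside a larger
  one, and to shift the larger one; the powers of the second shift serve as the \<open>R n\<close>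
  of \<open>swindle\<close>.\<close>

theorem local_bound:
  assumes L: "homeo_length X L" and b: "q \<in> B" "b \<in> B" "q \<noteq> b"
  shows "\<exists>C. \<forall>g. supported X g {x. bt q b x} \<longrightarrow> L g \<le> C"
proof -
  obtain q' T \<xi> where q': "q' \<in> B" "q' \<noteq> b" "{x. bt q b x} \<subseteq> {x. bt q' b x}"
    "supported X T {x. bt q' b x}"
    "null_family X (\<lambda>i. (T ^^ i) ` {x. bt q b x}) \<xi>"
    using inner_half_tree[OF b] .
  obtain q'' R \<zeta> where R: "supported X R {x. bt q'' b x}"
    "null_family X (\<lambda>i. (R ^^ i) ` {x. bt q' b x}) \<zeta>"
    using inner_half_tree[OF q'(1) b(2) q'(2)] by metis
  have hR: "homeo X R" using R by (simp add: supported_def)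
  have "{x. bt q' b x} \<subseteq> \<Omega>" using bt_dom by blast
  then show ?thesis
    using homeo_length.swindle[OF L X_props(5) q'(4,3) _ q'(5) homeomorphic_map_funpow[OF hR] R(2)]
      by blast
qed

end

section \<open>Fragmentation and the global bound\<close>

context wdendrite begin

text \<open>The roots \<open>c n\<close> advance monotonically from \<open>x\<close> towards
  \<open>y\<close>, and \<open>z n\<close> is taken in a third direction at \<open>c n\<close>, so
  the half-trees branch off at different places.\<close>

lemma disjoint_half_trees:
  obtains c z :: "nat \<Rightarrow> 'a" where "\<And>n. c n \<in> B" "\<And>n. z n \<in> B" "\<And>n. z n \<noteq> c n"
    "disjoint_family (\<lambda>n. insert (c n) {w. J (c n) (z n) w})"
proof -
  obtain x y where xy: "x \<in> \<Omega>" "y \<in> \<Omega>" "x \<noteq> y" using B_nonempty(2) by blast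
  have "\<exists>c. \<forall>n. (c n \<in> B \<and> bt (c n) x y) \<and> bt (c (Suc n)) (c n) y"
  proof (rule dependent_nat_choice)
    show "\<exists>c. c \<in> B \<and> bt c x y" using branch_separates xy by blast
    fix c and n :: nat assume c: "c \<in> B \<and> bt c x y"
    then have "c \<noteq> y" using bt_dom by blast
    then obtain d where d: "d \<in> B" "bt d c y" using branch_separates[of c y] B_topspace c xy
      by blast
    then have "bt d x y" using bt_chain(1) c by blast
    then show "\<exists>d. (d \<in> B \<and> bt d x y) \<and> bt d c y" using d by blast
  qed
  then obtain c where c: "\<And>n. c n \<in> B" "\<And>n. bt (c n) x y" "\<And>n. bt (c (Suc n)) (c n) y" by blast
  have lt: "bt (c j) (c i) y" if "i < j" for i j
    using that
  proof (induction j)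
    case (Suc j)
    then show ?case using c(3)[of j] bt_chain(1)[of "c j" "c i" y "c (Suc j)"]
      by (cases "i = j") auto
  qed simp
  have "\<exists>z\<in>B. bt (c n) z x \<and> bt (c n) z y" for n
    using third_direction[OF c(1) xy(1,2)] bt_dom[OF c(2)] by metis
  then obtain z where z: "\<And>n. z n \<in> B" "\<And>n. bt (c n) (z n) x" "\<And>n. bt (c n) (z n) y" by metis
  have dis: "insert (c i) {w. J (c i) (z i) w} \<inter> insert (c j) {w. J (c j) (z j) w} = {}"
    if "i < j" for i j
  proof -
    have "bt (c i) x (c j)" using bt_chain(2)[OF c(2) lt[OF that]] .
    then have cij: "bt (c j) (c i) y" "\<not> bt (c j) x (c i)" "c i \<noteq> c j"
      using lt[OF that] bt_asym bt_sym bt_dom by blast+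
    have zi: "bt (c i) (z i) (c j)"
    proof -
      have "\<not> bt (c i) (c j) y" using cij(1) bt_asym by blast
      moreover have "c j \<in> \<Omega>" using c(1) B_topspace by blast
      ultimately show ?thesis using bt_split[OF z(3)[of i], of "c j"] cij(3)[symmetric] by blast
    qed
    have zj: "bt (c j) (z j) (c i)"
    proof -
      have "c i \<in> \<Omega>" using c(1) B_topspace by blast
      then show ?thesis using bt_split[OF z(2)[of j], of "c i"] cij(2,3) bt_sym by blast
    qed
    have "\<not> J (c j) (z j) w" if "J (c i) (z i) w" for w
    proof -
      have "bt (c i) w (c j)" using bt_J[OF zi that] .
      then have "\<not> bt (c j) w (c i)" using bt_asym bt_sym by blast
      then show ?thesis using bt_J[OF zj] by blast
    qed
    moreover have "\<not> J (c i) (z i) (c j)" "\<not> J (c j) (z j) (c i)" using zi zj by (auto simp: bt_def)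
    ultimately show ?thesis using cij(3) by auto
  qed
  have "disjoint_family (\<lambda>n. insert (c n) {w. J (c n) (z n) w})"
    unfolding disjoint_family_on_def using dis by (metis Int_commute linorder_neqE_nat)
  moreover have "z n \<noteq> c n" for n using z(2) bt_dom by blast
  ultimately show thesis using that c(1) z(1) by blast
qed

text \<open>
  Here \<open>g\<close> moves the half-tree at \<open>p\<close> containing \<open>u\<close> off the half-tree at \<open>q\<close> containing \<open>b\<close>; the
  factor \<open>h\<close> agrees with \<open>g\<close> on the former and is the identity on the latter.
\<close>

lemma fragmentation:
  assumes g: "homeo X g"
    and b: "q \<in> B" "b \<in> B" "p \<in> B" "u \<in> B"
    and c: "bt q b p" "bt p q u" "bt q b (g p)" "bt (g p) q (g u)"
  obtains h e where "supported X h {x. bt q b x}" "supported X e {x. bt p u x}"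
    "\<And>x. x \<in> \<Omega> \<Longrightarrow> g x = h (e x)"
proof -
  note O = b[THEN B_topspace]
  note gi = hinv_props[OF g]
  have d: "b \<noteq> q" "u \<noteq> p" using c bt_dom by blast+
  \<comment> \<open>\<open>k\<close> copies \<open>g\<close> only at \<open>p\<close> and
    \<open>u\<close>, which homogeneity allows while \<open>b\<close> and \<open>q\<close> stay
    fixed. Agreement on a whole half-tree is left to the correction \<open>a\<close>.\<close>
  obtain k where k: "homeo X k" "k b = b" "k q = q" "k p = g p" "k u = g u"
    using chain_homeomorphism[OF b(2,1,3,4) homeomorphic_map_B(1)[OF g b(3)]
      homeomorphic_map_B(1)[OF g b(4)]
      homeomorphic_map_B(2)[OF g b(3)] homeomorphic_map_B(2)[OF g b(4)] c] by metis
  define k' where "k' = (\<lambda>x. if x \<in> {x. bt q b x} then k x else x)"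
  have k': "supported X k' {x. bt q b x}" unfolding k'_def
    by (rule paste_off[OF k(1)]) (use O d k in auto)
  have qbu: "bt q b u" using bt_concat(1)[OF c(1,2)] .
  have kp: "k' p = g p" "k' u = g u" using c(1) qbu k by (auto simp: k'_def)
  have hk': "homeo X k'" using k' by (simp add: supported_def)
  note ki = hinv_props[OF hk']
  \<comment> \<open>\<open>f\<close> fixes \<open>p\<close> and \<open>u\<close>, hence preserves
    the half-tree at \<open>p\<close> containing \<open>u\<close>; restricted to it,
    \<open>f\<close> corrects \<open>k'\<close> to \<open>g\<close>.\<close>
  define f where "f = hinv X k' \<circ> g"
  have hf: "homeo X f" unfolding f_def by (rule homeomorphic_map_compose[OF g ki(2)])
  have fp: "f p = p" "f u = u" using ki(3)[OF O(3)] ki(3)[OF O(4)] kp by (simp_all add: f_def)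
  define a where "a = (\<lambda>x. if x \<in> {x. J p u x} then f x else x)"
  have a: "supported X a {x. J p u x}" unfolding a_def
    by (rule paste_on[OF hf]) (use O d fp in auto)
  have "{x. J p u x} \<subseteq> {x. bt q b x}"
  proof
    fix x assume "x \<in> {x. J p u x}"
    then have "bt p q x" using bt_J[OF bt_sym[OF c(2)]] bt_sym by blast
    then show "x \<in> {x. bt q b x}" using bt_concat(1)[OF c(1)] by blast
  qed
  then have a': "supported X a {x. bt q b x}" using supported_mono[OF a] by blast
  have ha: "homeo X a" using a by (simp add: supported_def)
  define h where "h = k' \<circ> a"
  have hh: "homeo X h" unfolding h_def by (rule homeomorphic_map_compose[OF ha hk'])
  have h: "supported X h {x. bt q b x}" using hh k' a' by (simp add: supported_def h_def)
  note hi = hinv_props[OF hh]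
  have hg: "h x = g x" if "x = p \<or> J p u x" for x
    using that
  proof
    assume "x = p"
    then show ?thesis using kp joined_domain by (auto simp: h_def a_def)
  next
    assume j: "J p u x"
    then have "x \<in> \<Omega>" using joined_domain by blast
    then show ?thesis using j ki(4)[OF gi(5)] by (simp add: h_def a_def f_def)
  qed
  define e where "e = hinv X h \<circ> g"
  have "homeo X e" unfolding e_def by (rule homeomorphic_map_compose[OF g hi(2)])
  moreover have "e x = x" if x: "x \<in> \<Omega> - {x. bt p u x}" for x
  proof -
    have "x = p \<or> J p u x" using x bt_or_J[OF O(3,4) d(2)] by blast
    then have "hinv X h (g x) = hinv X h (h x)" using hg by simp
    then show ?thesis using hi(3) x by (simp add: e_def)
  qed
  ultimately have "supported X e {x. bt p u x}" by (simp add: supported_def)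
  moreover have "g x = h (e x)" if "x \<in> \<Omega>" for x using hi(4)[OF gi(5)[OF that]] by (simp add: e_def)
  ultimately show thesis using that h by blast
qed

theorem homeo_length_bounded:
  assumes L: "homeo_length X L"
  shows "\<exists>C. \<forall>g. homeo X g \<longrightarrow> L g \<le> C"
proof -
  obtain c z :: "nat \<Rightarrow> 'a" where cz: "\<And>n. c n \<in> B" "\<And>n. z n \<in> B" "\<And>n. z n \<noteq> c n"
    and dis: "disjoint_family (\<lambda>n. insert (c n) {w. J (c n) (z n) w})"
    using disjoint_half_trees by blast
  have O: "c n \<in> \<Omega>" "z n \<in> \<Omega>" for n using cz B_topspace by auto
  have "\<exists>C. \<forall>g. supported X g {x. bt (c n) (z n) x} \<longrightarrow> L g \<le> C" for n
    by (rule local_bound[OF L cz(1,2)]) (use cz(3) in metis)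
  then obtain C where C: "\<And>n g. supported X g {x. bt (c n) (z n) x} \<Longrightarrow> L g \<le> C n" by metis
  define M where "M = (\<Sum>n<5. \<bar>C n\<bar>)"
  have M: "C n \<le> M" if "n < 5" for n
  proof -
    have "\<bar>C n\<bar> \<le> M" unfolding M_def by (rule member_le_sum) (use that in auto)
    then show ?thesis by simp
  qed
  have off: "bt (c i) (z i) w" if "w \<in> \<Omega>" "w \<notin> insert (c i) {w. J (c i) (z i) w}" for i w
    using that bt_or_J[OF O cz(3)] by blast
  have "L g \<le> M + M" if g: "homeo X g" for g
  proof -
    note gi = hinv_props[OF g]
    define H where "H = (\<lambda>i. insert (g (c i)) {w. J (g (c i)) (g (z i)) w})"
    have Hd: "w \<notin> H i \<or> w \<notin> H j" if "i \<noteq> j" "w \<in> \<Omega>" for i j w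
    proof -
      have mem: "w \<in> H i \<longleftrightarrow> hinv X g w \<in> insert (c i) {w. J (c i) (z i) w}" for i
        using homeomorphic_map_J[OF g O(1)[of i] O(2)[of i] gi(6)[OF that(2)]] gi(4)[OF that(2)]
          gi(3)[OF O(1)[of i]]
        unfolding H_def by auto
      show ?thesis unfolding mem using dis that(1) unfolding disjoint_family_on_def by blast
    qed
    \<comment> \<open>The three images are disjoint, so \<open>c 3\<close> and \<open>c 4\<close>
      lie in at most one each and some image contains neither. In turn its root \<open>p\<close>
      lies in at most one of the half-trees at \<open>c 3\<close> and \<open>c 4\<close>. This is
      the origin of 3 + 2 = 5.\<close>
    obtain i where i: "i < 3" "c 3 \<notin> H i" "c 4 \<notin> H i"
    proof -
      have "\<exists>i\<in>{0,1,2}. c 3 \<notin> H i \<and> c 4 \<notin> H i"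
        using Hd[of 0 1 "c 3"] Hd[of 0 2 "c 3"] Hd[of 1 2 "c 3"] Hd[of 0 1 "c 4"] Hd[of 0 2 "c 4"]
          Hd[of 1 2 "c 4"] O by auto
      then obtain i where "i \<in> {0,1,2::nat}" "c 3 \<notin> H i" "c 4 \<notin> H i" by blast
      then show thesis by (intro that[of i]) auto
    qed
    define p where "p = g (c i)"
    define u where "u = g (z i)"
    have pu: "p \<in> \<Omega>" "u \<in> \<Omega>" "u \<noteq> p"
      using gi(5) O cz(3) inj_on_eq_iff[OF homeomorphic_imp_injective_map[OF g]]
        by (auto simp: p_def u_def)
    obtain j where j: "j = 3 \<or> j = 4" "p \<notin> insert (c j) {w. J (c j) (z j) w}"
      using dis unfolding disjoint_family_on_def
        by (metis Int_iff UNIV_I empty_iff num.distinct(5) numeral_eq_iff semiring_norm(89))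
    have cj: "c j \<notin> H i" using i j by auto
    have ij: "i \<noteq> j" using i j by auto
    have "bt p u (c j)" using cj bt_or_J[OF pu O(1)] unfolding H_def p_def u_def by blast
    moreover have "bt (c j) (z j) p" using off[OF pu(1) j(2)] .
    moreover have "c i \<notin> insert (c j) {w. J (c j) (z j) w}"
      "c j \<notin> insert (c i) {w. J (c i) (z i) w}"
      using dis ij unfolding disjoint_family_on_def by blast+
    then have "bt (c j) (z j) (c i)" "bt (c i) (z i) (c j)" using off O by blast+
    ultimately obtain h e where he: "supported X h {x. bt (c j) (z j) x}"
      "supported X e {x. bt (c i) (z i) x}" "\<And>x. x \<in> \<Omega> \<Longrightarrow> g x = h (e x)"
      using fragmentation[OF g cz(1)[of j] cz(2)[of j] cz(1)[of i] cz(2)[of i]] bt_sym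
        unfolding p_def u_def by metis
    have hom: "homeo X h" "homeo X e" using he by (auto simp: supported_def)
    have "L g = L (h \<circ> e)"
      by (rule homeo_length.L_cong[OF L g homeomorphic_map_compose[OF hom(2,1)]]) (use he in simp)
    also have "\<dots> \<le> L h + L e" by (rule homeo_length.L_comp[OF L hom])
    also have "\<dots> \<le> M + M"
      using C[OF he(1)] C[OF he(2)] M[of i] M[of j] i j by force
    finally show ?thesis .
  qed
  then show ?thesis by blast
qed

end

subsection \<open>Isometric actions\<close>

text \<open>The sets of centres of balls of radius \<open>t n\<close> around \<open>Y\<close>
  decrease as \<open>t n\<close> tends to the infimum \<open>R\<close> of admissible radii. By the
  parallelogram law, the midpoint of two centres at distance at least \<open>e\<close> would serve
  with squared radius \<open>(t n)^2 - e^2 / 4\<close>, which is eventually below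
  \<open>R^2\<close>; so the diameters tend to 0. Describing \<open>a\<close> by these sets makes
  its invariance under isometries easy to see.\<close>

lemma circumcenter_unique:
  fixes Y :: "'h::{real_inner, complete_space} set"
  assumes Y: "o0 \<in> Y" "\<And>y. y \<in> Y \<Longrightarrow> dist x y \<le> b"
  obtains a and t :: "nat \<Rightarrow> real" where "(\<Inter>n. {c. \<forall>y\<in>Y. dist c y \<le> t n}) = {a}"
proof -
  define A where "A = (\<lambda>t. {c. \<forall>y\<in>Y. dist c y \<le> t})"
  define T where "T = {t. A t \<noteq> {}}"
  have T: "b \<in> T" using Y(2) by (auto simp: T_def A_def)
  have T0: "0 \<le> t" if "t \<in> T" for t
  proof -
    have "A t \<noteq> {}" using that by (simp add: T_def)
    then obtain c where "dist c o0 \<le> t" using Y(1) unfolding A_def by blast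
    then show ?thesis using zero_le_dist[of c o0] by linarith
  qed
  then have bdd: "bdd_below T" by (rule bdd_belowI)
  define R where "R = Inf T"
  have R0: "0 \<le> R" unfolding R_def using T T0 by (intro cInf_greatest) auto
  have RT: "R \<le> t" if "t \<in> T" for t unfolding R_def using that bdd by (rule cInf_lower)
  define t where "t = (\<lambda>n. R + inverse (real (Suc n)))"
  have ne: "A (t n) \<noteq> {}" for n
  proof -
    have "Inf T < t n" by (simp add: t_def R_def)
    then obtain s where s: "s \<in> T" "s < t n" using cInf_lessD[of T "t n"] T by blast
    then obtain c where "c \<in> A s" by (auto simp: T_def)
    then have "c \<in> A (t n)" using s by (force simp: A_def)
    then show ?thesis by blast
  qed
  have mono: "A (t n) \<subseteq> A (t m)" if "m \<le> n" for m n
  proof -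
    have "t n \<le> t m" unfolding t_def using that by (simp add: le_imp_inverse_le)
    then show ?thesis by (force simp: A_def)
  qed
  have closed: "closed (A s)" for s
  proof -
    have "A s = (\<Inter>y\<in>Y. {c. dist c y \<le> s})" by (auto simp: A_def)
    moreover have "closed {c. dist c y \<le> s}" for y by (intro closed_Collect_le continuous_intros)
    ultimately show ?thesis by auto
  qed
  have small: "\<exists>n. \<forall>c\<in>A (t n). \<forall>c'\<in>A (t n). dist c c' < e" if e: "0 < e" for e
  proof -
    have "(\<lambda>n. (R + inverse (real (Suc n)))\<^sup>2) \<longlonglongrightarrow> (R + 0)\<^sup>2"
      by (intro tendsto_intros LIMSEQ_inverse_real_of_nat)
    then have "eventually (\<lambda>n. (t n)\<^sup>2 < R\<^sup>2 + e\<^sup>2 / 4) sequentially"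
      unfolding t_def using e by (intro order_tendstoD(2)) auto
    then obtain n where n: "(t n)\<^sup>2 < R\<^sup>2 + e\<^sup>2 / 4" by (auto simp: eventually_sequentially)
    have "dist c c' < e" if c: "c \<in> A (t n)" "c' \<in> A (t n)" for c c'
    proof (rule ccontr)
      assume "\<not> dist c c' < e"
      then have ge: "e\<^sup>2 \<le> (dist c c')\<^sup>2" using e by (intro power_mono) auto
      define m where "m = (1/2) *\<^sub>R (c + c')"
      define s where "s = (t n)\<^sup>2 - e\<^sup>2 / 4"
      have ms: "(dist m y)\<^sup>2 \<le> s" if y: "y \<in> Y" for y
      proof -
        have "(dist c y)\<^sup>2 \<le> (t n)\<^sup>2" "(dist c' y)\<^sup>2 \<le> (t n)\<^sup>2" using c y
          by (auto simp: A_def intro!: power_mono)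
        moreover have "4 * (dist m y)\<^sup>2 = 2 * (dist c y)\<^sup>2 + 2 * (dist c' y)\<^sup>2 - (dist c c')\<^sup>2"
          unfolding m_def dist_norm power2_norm_eq_inner
          by (simp add: inner_diff_left inner_diff_right inner_add_left inner_add_right
            inner_commute algebra_simps)
        ultimately show ?thesis using ge unfolding s_def by linarith
      qed
      have s0: "0 \<le> s" using ms[OF Y(1)] by (meson order_trans zero_le_power2)
      have "m \<in> A (sqrt s)" using ms by (auto simp: A_def intro: real_le_rsqrt)
      then have "R \<le> sqrt s" using RT by (auto simp: T_def)
      then have "R\<^sup>2 \<le> s" using R0 s0 power_mono[of R "sqrt s" 2] by simp
      then show False using n unfolding s_def by linarith
    qed
    then show ?thesis by blast
  qed
  obtain a where "(\<Inter>(range (\<lambda>n. A (t n)))) = {a}"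
    using decreasing_closed_nest_sing[of "\<lambda>n. A (t n)"] closed ne mono small by metis
  then show thesis using that[of t a] by (simp add: A_def)
qed

lemma isometric_action_fixed_point:
  fixes \<phi> :: "'g \<Rightarrow> 'h::{real_inner, complete_space} \<Rightarrow> 'h"
  assumes act: "isometric_action G UNIV dist \<phi>" and G: "group G"
    and bnd: "\<And>g. g \<in> carrier G \<Longrightarrow> dist x (\<phi> g x) \<le> C"
  shows "\<exists>a. \<forall>g\<in>carrier G. \<phi> g a = a"
proof -
  interpret G: group G by (rule G)
  interpret A: group_action G UNIV \<phi> using act by (simp add: isometric_action_def)
  have iso: "dist (\<phi> g y) (\<phi> g z) = dist y z" if "g \<in> carrier G" for g y z
    using act that by (simp add: isometric_action_def)
  define Y where "Y = {\<phi> g x | g. g \<in> carrier G}"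
  have Y: "\<phi> \<one>\<^bsub>G\<^esub> x \<in> Y" "\<And>y. y \<in> Y \<Longrightarrow> dist x y \<le> C" using bnd by (auto simp: Y_def)
  obtain a and t :: "nat \<Rightarrow> real" where a: "(\<Inter>n. {c. \<forall>y\<in>Y. dist c y \<le> t n}) = {a}"
    by (rule circumcenter_unique[OF Y])
  have "\<phi> g a = a" if g: "g \<in> carrier G" for g
  proof -
    have "dist (\<phi> g a) y \<le> t n" if y: "y \<in> Y" for y n
    proof -
      obtain k where k: "k \<in> carrier G" "y = \<phi> k x" using y by (auto simp: Y_def)
      \<comment> \<open>\<open>w\<close> is the orbit point carried to \<open>y\<close> by
        \<open>\<phi> g\<close>, so the distance from \<open>\<phi> g a\<close> to \<open>y\<close>
        is that from \<open>a\<close> to \<open>w\<close>.\<close>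
      define w where "w = \<phi> (inv\<^bsub>G\<^esub> g \<otimes>\<^bsub>G\<^esub> k) x"
      have "w \<in> Y" using g k by (auto simp: Y_def w_def)
      moreover have "\<phi> g w = y"
        using A.composition_rule[of x g "inv\<^bsub>G\<^esub> g \<otimes>\<^bsub>G\<^esub> k"] g k
          by (simp add: w_def G.m_assoc[symmetric])
      ultimately show ?thesis using iso[OF g, of a w] a
        by (metis (mono_tags, lifting) INT_iff UNIV_I mem_Collect_eq singletonI)
    qed
    then have "\<phi> g a \<in> (\<Inter>n. {c. \<forall>y\<in>Y. dist c y \<le> t n})" by blast
    then show ?thesis using a by simp
  qed
  then show ?thesis by blast
qed

section \<open>The displacement function of an isometric action\<close>

lemma homeomorphic_map_restrict:
  assumes "homeo X f" shows "restrict f (topspace X) \<in> carrier (Homeo X)"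
proof -
  have "homeo X (restrict f (topspace X))" by (rule homeomorphic_map_eq[OF assms]) simp
  moreover have "bij_betw f (topspace X) (topspace X)"
    using homeomorphic_imp_injective_map[OF assms] homeomorphic_imp_surjective_map[OF assms]
      by (simp add: bij_betw_def)
  ultimately show ?thesis by (simp add: Homeo_def Bij_def)
qed

lemma carrier_Homeo: "g \<in> carrier (Homeo X) \<Longrightarrow> homeo X g \<and> restrict g (topspace X) = g"
  by (auto simp: Homeo_def Bij_def extensional_restrict)

lemma Homeo_mult:
  assumes f: "homeo X f" and g: "homeo X g"
  shows "restrict f (topspace X) \<otimes>\<^bsub>Homeo X\<^esub> restrict g (topspace X) = restrict (f \<circ> g) (topspace X)"
proof -
  have "restrict f (topspace X) \<in> Bij (topspace X)" "restrict g (topspace X) \<in> Bij (topspace X)"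
    using homeomorphic_map_restrict[OF f] homeomorphic_map_restrict[OF g] by (auto simp: Homeo_def)
  then have "restrict f (topspace X) \<otimes>\<^bsub>Homeo X\<^esub> restrict g (topspace X) = compose (topspace X)
    (restrict f (topspace X)) (restrict g (topspace X))"
    by (simp add: Homeo_def BijGroup_def)
  also have "\<dots> = restrict (f \<circ> g) (topspace X)"
    using hinv_props(5)[OF g] by (auto simp: compose_def)
  finally show ?thesis .
qed

text \<open>\<open>restrict\<close> turns a total function into the group element it represents.
  Subadditivity is the triangle inequality through the image of \<open>x\<close> under
  \<open>f\<close>; for inverses, apply \<open>f\<close> to \<open>x\<close> and to its image under
  the inverse.\<close>

lemma (in Metric_space) isometric_action_length:
  assumes act: "isometric_action (Homeo X) M d \<phi>" and x: "x \<in> M"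
  shows "homeo_length X (\<lambda>f. d x (\<phi> (restrict f (topspace X)) x))"
proof
  interpret A: group_action "Homeo X" M \<phi> using act by (simp add: isometric_action_def)
  define r :: "('b \<Rightarrow> 'b) \<Rightarrow> 'b \<Rightarrow> 'b" where "r = (\<lambda>f. restrict f (topspace X))"
  have iso: "d (\<phi> g y) (\<phi> g z) = d y z" if "g \<in> carrier (Homeo X)" "y \<in> M" "z \<in> M" for g y z
    using act that by (simp add: isometric_action_def)
  have inM: "\<phi> g y \<in> M" if "g \<in> carrier (Homeo X)" "y \<in> M" for g y using A.element_image that
    by blast
  have r: "homeo X f \<Longrightarrow> r f \<in> carrier (Homeo X)" for f using homeomorphic_map_restrict
    by (auto simp: r_def)
  have comp: "\<phi> (r (f \<circ> g)) x = \<phi> (r f) (\<phi> (r g) x)" if "homeo X f" "homeo X g" for f g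
    using A.composition_rule[OF x r[OF that(1)] r[OF that(2)]] Homeo_mult[OF that]
      by (simp add: r_def)
  fix f assume f: "homeo X f"
  note fi = hinv_props[OF f]
  show "d x (\<phi> (restrict (f \<circ> g) (topspace X)) x) \<le> d x (\<phi> (restrict f (topspace X)) x) + d x (\<phi>
    (restrict g (topspace X)) x)"
    if g: "homeo X g" for g
    using triangle[OF x inM[OF r[OF f] x] inM[OF r[OF f] inM[OF r[OF g] x]]] iso[OF r[OF f] x inM[OF
      r[OF g] x]] comp[OF f g]
    by (simp add: r_def)
  have "r (f \<circ> hinv X f) = \<one>\<^bsub>Homeo X\<^esub>"
    using fi(4) by (auto simp: r_def Homeo_def BijGroup_def)
  moreover have "\<phi> \<one>\<^bsub>Homeo X\<^esub> x = x" using A.id_eq_one x by (metis restrict_apply')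
  ultimately have "\<phi> (r f) (\<phi> (r (hinv X f)) x) = x" using comp[OF f fi(2)] by simp
  then have "d (\<phi> (r f) x) x = d x (\<phi> (r (hinv X f)) x)"
    using iso[OF r[OF f] x inM[OF r[OF fi(2)] x]] by simp
  then show "d x (\<phi> (restrict (hinv X f) (topspace X)) x) = d x (\<phi> (restrict f (topspace X)) x)"
    by (simp add: r_def commute)
  show "d x (\<phi> (restrict f (topspace X)) x) = d x (\<phi> (restrict g (topspace X)) x)"
    if "\<And>y. y \<in> topspace X \<Longrightarrow> f y = g y" for g
    using that by (metis restrict_ext)
qed

lemma (in wdendrite) isometric_action_bounded:
  assumes M: "Metric_space M d" and x: "x \<in> M" and act: "isometric_action (Homeo X) M d \<phi>"
  shows "\<exists>C. \<forall>g\<in>carrier (Homeo X). d x (\<phi> g x) \<le> C"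
proof -
  obtain C where "\<forall>g. homeo X g \<longrightarrow> d x (\<phi> (restrict g \<Omega>) x) \<le> C"
    using homeo_length_bounded[OF Metric_space.isometric_action_length[OF M act x]] by blast
  then have "d x (\<phi> g x) \<le> C" if "g \<in> carrier (Homeo X)" for g using carrier_Homeo[OF that] by metis
  then show ?thesis by blast
qed

theorem theorem1p5:
  fixes S :: "enat set" and X :: "'a topology"
  assumes "S \<noteq> {}" and "S \<subseteq> {3..}"
    and "wazewski_dendrite S X"
  shows "(\<forall>(M :: 'm set) d \<phi>.
            Metric_space M d \<and> M \<noteq> {} \<and> isometric_action (Homeo X) M d \<phi> \<longrightarrow>
            (\<exists>x\<in>M. Metric_space.mbounded M d (orbit (Homeo X) \<phi> x)))
       \<and> property_FH TYPE('h::{real_inner, complete_space}) (Homeo X)"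
proof (intro conjI allI impI)
  interpret wdendrite S X using assms by unfold_locales
  fix M :: "'m set" and d \<phi>
  assume *: "Metric_space M d \<and> M \<noteq> {} \<and> isometric_action (Homeo X) M d \<phi>"
  then obtain x where x: "x \<in> M" by blast
  interpret Metric_space M d using * by blast
  interpret A: group_action "Homeo X" M \<phi> using * by (simp add: isometric_action_def)
  obtain C where C: "\<And>g. g \<in> carrier (Homeo X) \<Longrightarrow> d x (\<phi> g x) \<le> C"
    using isometric_action_bounded[of M d x \<phi>] * x by blast
  have "orbit (Homeo X) \<phi> x \<subseteq> mcball x C"
    using C x A.element_image[OF _ x refl] by (auto simp: orbit_def)
  then have "mbounded (orbit (Homeo X) \<phi> x)" unfolding mbounded_def by blast
  then show "\<exists>x\<in>M. mbounded (orbit (Homeo X) \<phi> x)" using x by blast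
next
  interpret wdendrite S X using assms by unfold_locales
  show "property_FH TYPE('h) (Homeo X)"
    unfolding property_FH_def
  proof (intro allI impI)
    fix \<phi> :: "('a \<Rightarrow> 'a) \<Rightarrow> 'h \<Rightarrow> 'h"
    assume act: "isometric_action (Homeo X) UNIV dist \<phi>"
    have "Metric_space (UNIV :: 'h set) dist"
      by unfold_locales (auto simp: dist_commute dist_triangle)
    then obtain C where "\<And>g. g \<in> carrier (Homeo X) \<Longrightarrow> dist 0 (\<phi> g 0) \<le> C"
      using isometric_action_bounded[OF _ UNIV_I act, of 0] by blast
    then show "\<exists>x. \<forall>g\<in>carrier (Homeo X). \<phi> g x = x"
      by (rule isometric_action_fixed_point[OF act group_Homeo])
  qed
qed

end
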